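(* If $p_0$ is a strongly pseudoconvex boundary point of a domain $D\subset\mathbb{C}^n$, then $$\lim_{z\to p_0}h^k_D(z)=1,$$ where $h^k_D$ is the Fridman invariant of $D$ with respect to the Kobayashi pseudodistance.
   Context: The domain $D$ is not assumed bounded. A boundary point $p_0$ is strongly pseudoconvex if $\partial D$ is $\mathcal{C}^2$-smooth near $p_0$ and the Levi form of $\partial D$ at $p_0$ is positive definite on the complex tangent space. $\mathbb{B}_n\subset\mathbb{C}^n$ is the open unit ball, $\Delta\subset\mathbb{C}$ the open unit disc, $\mathcal{O}(X,Y)$ the set of holomorphic maps from $X$ to $Y$. Lempert function: $l_D(z,w)=\inf\{\tanh^{-1}|\lambda| : f\in\mathcal{O}(\Delta,D),\ f(0)=z,\ f(\lambda)=w\}$ (with $\inf\emptyset=\infty$). The Kobayashi pseudodistance $k_D$ is the largest pseudodistance on $D$ not exceeding $l_D$. Fridman invariant: for $z\in D$, $$h^k_D(z)=\sup\{\tanh r : r>0,\ B^k_D(z,r)\subset f(\mathbb{B}_n),\ f\in\mathcal{O}(\mathbb{B}_n,D),\ f\text{ injective}\},$$ where $B^k_D(z,r)=\{w\in D: k_D(z,w)<r\}$; the value $0$ is allowed (supremum of the empty set is $0$). The limit is over $z\in D$. *)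

theory Defs
  imports "HOL-Complex_Analysis.Complex_Analysis"
begin

text \<open>The space \<open>\<complex>\<^sup>n\<close> is \<^typ>\<open>complex ^ 'n\<close> with its Euclidean norm, so the unit ball is
  \<open>ball 0 1\<close>; derivatives are Frechet derivatives over the reals.\<close>

subsection \<open>Strongly pseudoconvex boundary points\<close>

definition C2_on :: "'a::real_normed_vector set \<Rightarrow> ('a \<Rightarrow> real) \<Rightarrow> bool" where
  "C2_on U \<rho> \<longleftrightarrow>
     (\<exists>(\<rho>' :: 'a \<Rightarrow> 'a \<Rightarrow>\<^sub>L real) (\<rho>'' :: 'a \<Rightarrow> 'a \<Rightarrow>\<^sub>L 'a \<Rightarrow>\<^sub>L real).
        (\<forall>x\<in>U. (\<rho> has_derivative blinfun_apply (\<rho>' x)) (at x)) \<and>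
        (\<forall>x\<in>U. (\<rho>' has_derivative blinfun_apply (\<rho>'' x)) (at x)) \<and>
        continuous_on U \<rho>'')"

text \<open>The Wirtinger operators \<open>\<partial>/\<partial>z\<^sub>j = (\<partial>/\<partial>x\<^sub>j - \<i> \<partial>/\<partial>y\<^sub>j)/2\<close> and
  \<open>\<partial>/\<partial>\<bar>z\<^sub>j = (\<partial>/\<partial>x\<^sub>j + \<i> \<partial>/\<partial>y\<^sub>j)/2\<close>, where the real coordinate directions of
  \<open>z\<^sub>j = x\<^sub>j + \<i> y\<^sub>j\<close> are \<open>axis j 1\<close> and \<open>axis j \<i>\<close>.\<close>

definition wirtinger_dz ::
    "'n::finite \<Rightarrow> (complex ^ 'n \<Rightarrow> complex) \<Rightarrow> complex ^ 'n \<Rightarrow> complex" where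
  "wirtinger_dz j f p =
     (frechet_derivative f (at p) (axis j 1) - \<i> * frechet_derivative f (at p) (axis j \<i>)) / 2"

definition wirtinger_dzbar ::
    "'n::finite \<Rightarrow> (complex ^ 'n \<Rightarrow> complex) \<Rightarrow> complex ^ 'n \<Rightarrow> complex" where
  "wirtinger_dzbar j f p =
     (frechet_derivative f (at p) (axis j 1) + \<i> * frechet_derivative f (at p) (axis j \<i>)) / 2"

definition complex_tangent_space ::
    "(complex ^ 'n \<Rightarrow> real) \<Rightarrow> complex ^ 'n \<Rightarrow> (complex ^ 'n::finite) set" where
  "complex_tangent_space \<rho> p =
     {v. (\<Sum>j\<in>UNIV. wirtinger_dz j (\<lambda>x. complex_of_real (\<rho> x)) p * v $ j) = 0}"

text \<open>For \<open>\<rho>\<close> of class \<open>C\<^sup>2\<close> the double sum is real (the matrix of mixed derivatives is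
  Hermitian), so taking \<open>Re\<close> only changes the type.\<close>

definition levi_form ::
    "(complex ^ 'n \<Rightarrow> real) \<Rightarrow> complex ^ 'n \<Rightarrow> complex ^ 'n::finite \<Rightarrow> real" where
  "levi_form \<rho> p v =
     Re (\<Sum>j\<in>UNIV. \<Sum>k\<in>UNIV.
           wirtinger_dz j (wirtinger_dzbar k (\<lambda>x. complex_of_real (\<rho> x))) p * v $ j * cnj (v $ k))"

text \<open>Since the gradient does not vanish on \<open>U\<close>, the last two conjuncts force
  \<open>frontier D \<inter> U = {x \<in> U. \<rho> x = 0}\<close> for open \<open>D\<close>.\<close>

definition C2_local_defining_function ::
    "'a::real_normed_vector set \<Rightarrow> 'a \<Rightarrow> 'a set \<Rightarrow> ('a \<Rightarrow> real) \<Rightarrow> bool" where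
  "C2_local_defining_function D p U \<rho> \<longleftrightarrow>
     open U \<and> p \<in> U \<and> C2_on U \<rho> \<and>
     (\<forall>x\<in>U. frechet_derivative \<rho> (at x) \<noteq> (\<lambda>v. 0)) \<and>
     D \<inter> U = {x \<in> U. \<rho> x < 0}"

text \<open>Positivity of the Levi form on the complex tangent space does not depend on the local
  defining function, so it is enough to ask for one.\<close>

definition strongly_pseudoconvex_point ::
    "(complex ^ 'n::finite) set \<Rightarrow> complex ^ 'n \<Rightarrow> bool" where
  "strongly_pseudoconvex_point D p \<longleftrightarrow>
     p \<in> frontier D \<and>
     (\<exists>U \<rho>. C2_local_defining_function D p U \<rho> \<and>
        (\<forall>v \<in> complex_tangent_space \<rho> p. v \<noteq> 0 \<longrightarrow> levi_form \<rho> p v > 0))"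

subsection \<open>Holomorphic maps\<close>

definition holomorphic_discs :: "(complex ^ 'n::finite) set \<Rightarrow> (complex \<Rightarrow> complex ^ 'n) set" where
  "holomorphic_discs D =
     {f. (\<forall>i. (\<lambda>\<zeta>. f \<zeta> $ i) holomorphic_on ball 0 1) \<and> f ` ball 0 1 \<subseteq> D}"

text \<open>The matrix \<open>A\<close> below is the complex Jacobian: a map is holomorphic iff its real derivative
  is complex linear at each point.\<close>

definition holomorphic_maps ::
    "(complex ^ 'm::finite) set \<Rightarrow> (complex ^ 'n::finite) set \<Rightarrow> (complex ^ 'm \<Rightarrow> complex ^ 'n) set" where
  "holomorphic_maps X Y =
     {f. (\<forall>x\<in>X. \<exists>A :: complex ^ 'm ^ 'n. (f has_derivative (\<lambda>h. A *v h)) (at x)) \<and> f ` X \<subseteq> Y}"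

subsection \<open>Kobayashi pseudodistance and Fridman invariant\<close>

text \<open>The infimum over the empty set is \<open>\<infinity>\<close> in \<^typ>\<open>ereal\<close>.\<close>

definition lempert :: "(complex ^ 'n::finite) set \<Rightarrow> complex ^ 'n \<Rightarrow> complex ^ 'n \<Rightarrow> ereal" where
  "lempert D z w =
     Inf {ereal (artanh (cmod \<mu>)) | \<mu> f.
            \<mu> \<in> ball 0 1 \<and> f \<in> holomorphic_discs D \<and> f 0 = z \<and> f \<mu> = w}"

definition pseudodistance_on :: "'a set \<Rightarrow> ('a \<Rightarrow> 'a \<Rightarrow> real) \<Rightarrow> bool" where
  "pseudodistance_on D d \<longleftrightarrow>
     (\<forall>x\<in>D. \<forall>y\<in>D. 0 \<le> d x y) \<and>
     (\<forall>x\<in>D. d x x = 0) \<and>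
     (\<forall>x\<in>D. \<forall>y\<in>D. d x y = d y x) \<and>
     (\<forall>x\<in>D. \<forall>y\<in>D. \<forall>z\<in>D. d x z \<le> d x y + d y z)"

text \<open>The pointwise supremum of all pseudodistances below the Lempert function is again a
  pseudodistance (finite because \<open>D\<close> is a domain), hence it is the largest one.\<close>

definition kobayashi :: "(complex ^ 'n::finite) set \<Rightarrow> complex ^ 'n \<Rightarrow> complex ^ 'n \<Rightarrow> ereal" where
  "kobayashi D z w =
     Sup {ereal (d z w) | d. pseudodistance_on D d \<and> (\<forall>x\<in>D. \<forall>y\<in>D. ereal (d x y) \<le> lempert D x y)}"

definition kobayashi_ball :: "(complex ^ 'n::finite) set \<Rightarrow> complex ^ 'n \<Rightarrow> real \<Rightarrow> (complex ^ 'n) set" where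
  "kobayashi_ball D z r = {w \<in> D. kobayashi D z w < ereal r}"

text \<open>Inserting \<open>0\<close> encodes that the supremum of the empty set is \<open>0\<close>; it has no other effect
  because all other elements are positive.\<close>

definition fridman :: "(complex ^ 'n::finite) set \<Rightarrow> complex ^ 'n \<Rightarrow> real" where
  "fridman D z =
     Sup (insert 0 {tanh r | r. r > 0 \<and>
       (\<exists>f \<in> holomorphic_maps (ball (0 :: complex ^ 'n) 1) D.
          inj_on f (ball 0 1) \<and> kobayashi_ball D z r \<subseteq> f ` ball 0 1)})"

end

theory Submission
  imports Defs
begin

text \<open>Near a strongly pseudoconvex point a domain agrees to second order with a ball, after a local
biholomorphic change of coordinates. A Kobayashi ball of fixed radius around a
point \<open>z\<close> at distance \<open>d\<close> from the boundary has size about \<open>d\<close> in the complex normal direction and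
\<open>\<surd>d\<close> in the complex tangential ones. As \<open>z\<close> tends to the boundary point it therefore only sees the
osculating ball, and it fits into a biholomorphic image of the unit ball.

\<^bold>\<open>Normal form\<close> (\<open>exists_normal_chart\<close>). Adding a multiple of \<open>\<rho>\<^sup>2\<close> to a defining function \<open>\<rho>\<close> makes its
Levi form positive definite in all directions. A complex linear map turns this Hermitian form into
the square of the norm, and a quadratic polynomial map removes the rest of the Hessian, which is the
real part of a complex quadratic form. In the new coordinates the defining function \<open>r\<close> satisfies
\<open>r v = r u + \<langle>n u, v - u\<rangle> + |v - u|\<^sup>2 + o(|v - u|\<^sup>2)\<close>, uniformly as both points tend to \<open>0\<close>. This two-point
expansion is all that is used of the geometry of the boundary; it is the main assumption of the
locale \<open>normal_chart\<close>.

\<^bold>\<open>Localization\<close> (\<open>disc_localization\<close>, \<open>discs_collapse_all\<close>). The domain may be unbounded, and nothing is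
known about it far from the point, so analytic discs centred near the point have to be confined. In the
chart the linear function \<open>peak\<close> satisfies \<open>Re (peak u) > |u|\<^sup>2 / 2\<close> on the domain. For large \<open>A\<close> the
plurisubharmonic function \<open>log |u - u0| - A * Re (peak u)\<close> is larger than some constant on a small sphere and
smaller than it on a larger one, so taking the maximum with this constant in between gives a bounded
plurisubharmonic function on the whole domain with a logarithmic pole at \<open>u0\<close>. The maximum principle
then yields a radius \<open>s\<close>, the same for all discs centred near the point, such that the part of the
disc over \<open>|\<zeta>| < s\<close> stays in the chart. Harnack's inequality for \<open>Re peak\<close> shows that the part over
\<open>|\<zeta>| \<le> s / 2\<close> collapses to the point as the centre tends to it, and moving the base point inside
the disc extends this to every radius below \<open>1\<close>.

\<^bold>\<open>Comparison\<close> (\<open>fridman_lower_bound\<close>). The expansion at \<open>u0\<close>, the image of \<open>z\<close>, encloses the domain locally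
in a Siegel domain, which \<open>siegel_map\<close> maps into the unit ball with \<open>u0\<close> going to \<open>0\<close>. For \<open>T < 1\<close> and \<open>z\<close>
close enough to the boundary point, the set where \<open>|siegel_map| \<le> T\<close> lies in an ellipsoid contained in
the domain, and this ellipsoid is an affine image of the unit ball. Put
\<open>rho = artanh (min |siegel_map| T) / 2\<close>, with \<open>T\<close> in place of the minimum outside the chart. By the Schwarz-Pick
lemma and localization \<open>|rho x - rho y|\<close> is at most the Lempert function, the factor \<open>1 / 2\<close> making up for the use of
discs of radius slightly less than \<open>1\<close>. As \<open>|rho x - rho y|\<close> is a pseudodistance, it is at most the Kobayashi
pseudodistance, so the Kobayashi ball of radius \<open>artanh T / 2\<close> about \<open>z\<close> lies in the ellipsoid, and the
Fridman invariant at \<open>z\<close> is at least \<open>tanh (artanh T / 2)\<close>. Finally \<open>T\<close> tends to \<open>1\<close>.\<close>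

section \<open>Holomorphic functions of one variable\<close>

text \<open>A maximum principle for functions that are supported from below by moduli of holomorphic functions,
a form of subharmonicity which survives norms of vector-valued holomorphic functions and maxima. At a
point where \<open>g\<close> is maximal the supporting modulus is maximal too, hence constant, so the set of maximal
points in the open disc is open; a maximal point farthest from the origin must lie on the circle.\<close>

lemma max_principle_holomorphic_support:
  fixes g :: "complex \<Rightarrow> real"
  assumes "0 < t" and cont: "continuous_on (cball 0 t) g"
    and support: "\<And>z. z \<in> ball 0 t \<Longrightarrow>
      \<exists>h e. 0 < e \<and> h holomorphic_on ball z e \<and> cmod (h z) = g z \<and> (\<forall>w\<in>ball z e. cmod (h w) \<le> g w)"
    and sphere: "\<And>z. cmod z = t \<Longrightarrow> g z \<le> M"
    and "cmod z \<le> t"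
  shows "g z \<le> M"
proof -
  have "compact (cball (0::complex) t)" "cball (0::complex) t \<noteq> {}"
    using \<open>0 < t\<close> by auto
  from continuous_attains_sup[OF this cont] obtain x0
    where x0: "x0 \<in> cball 0 t" "\<And>y. y \<in> cball 0 t \<Longrightarrow> g y \<le> g x0" by blast
  define A where "A = {y \<in> cball 0 t. g y = g x0}"
  have "closed A"
    unfolding A_def using continuous_closed_preimage_constant[OF cont] by auto
  then have "compact A"
    by (auto simp: compact_eq_bounded_closed A_def intro: bounded_subset[OF bounded_cball[of 0 t]])
  moreover have "A \<noteq> {}" using x0 by (auto simp: A_def)
  ultimately obtain y where y: "y \<in> A" "\<And>w. w \<in> A \<Longrightarrow> cmod w \<le> cmod y"
    using continuous_attains_sup[of A cmod] continuous_on_norm_id by blast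
  have "cmod y = t"
  proof (rule ccontr)
    assume "cmod y \<noteq> t"
    with y have yt: "y \<in> ball 0 t" by (auto simp: A_def)
    obtain h e where h: "0 < e" "h holomorphic_on ball y e" "cmod (h y) = g y"
      "\<And>w. w \<in> ball y e \<Longrightarrow> cmod (h w) \<le> g w"
      using support[OF yt] by blast
    define d where "d = min e (t - cmod y)"
    have d: "0 < d" "d \<le> e" "d \<le> t - cmod y" using h yt by (auto simp: d_def)
    have sub: "w \<in> cball 0 t" if "w \<in> ball y d" for w
    proof -
      have "cmod w \<le> cmod y + cmod (w - y)" using norm_triangle_sub by blast
      with that d show ?thesis by (auto simp: dist_norm norm_minus_commute)
    qed
    have gy: "g y = g x0" using y by (simp add: A_def)
    have hle: "cmod (h w) \<le> g w" "g w \<le> cmod (h y)" if "w \<in> ball y d" for w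
      using that h d x0 sub[OF that] gy by auto
    have "h constant_on ball y d"
    proof (rule maximum_modulus_principle[of h "ball y d" "ball y d" y])
      show "h holomorphic_on ball y d"
        using h(2) d by (meson holomorphic_on_subset subset_ball)
      show "cmod (h z) \<le> cmod (h y)" if "z \<in> ball y d" for z
        using hle[OF that] by linarith
    qed (use d in auto)
    then have hc: "h w = h y" if "w \<in> ball y d" for w
      using that d unfolding constant_on_def by (metis centre_in_ball)
    have AA: "w \<in> A" if "w \<in> ball y d" for w
      using hle[OF that] hc[OF that] sub[OF that] gy h(3) by (auto simp: A_def)
    define u where "u = (if y = 0 then 1 else y / of_real (cmod y))"
    have u: "cmod u = 1" "y = of_real (cmod y) * u" by (auto simp: u_def norm_divide)
    have "y + of_real (d/2) * u \<in> ball y d"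
      using u d by (simp add: dist_norm norm_mult)
    then have "cmod (y + of_real (d/2) * u) \<le> cmod y" using AA y by blast
    moreover have "y + of_real (d/2) * u = of_real (cmod y + d/2) * u"
      by (subst u(2)) (simp add: algebra_simps)
    moreover have "cmod (of_real (cmod y + d/2) * u) = cmod y + d/2"
      using u d by (simp only: norm_mult norm_of_real) auto
    ultimately show False using d by simp
  qed
  then have "g x0 \<le> M" using sphere[of y] y(1) by (simp add: A_def)
  then show ?thesis using x0 assms(5) by force
qed

lemma norm_pseudohyperbolic_identity:
  fixes a b :: complex
  shows "(cmod (1 - cnj a * b))\<^sup>2 - (cmod (b - a))\<^sup>2 = (1 - (cmod a)\<^sup>2) * (1 - (cmod b)\<^sup>2)"
  by (simp only: cmod_power2) (simp add: power2_eq_square algebra_simps)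

lemma pseudohyperbolic_less:
  fixes a b :: complex
  assumes "cmod a < 1" "cmod b < 1"
  shows "cmod (b - a) < cmod (1 - cnj a * b)"
proof -
  have "(1 - (cmod a)\<^sup>2) * (1 - (cmod b)\<^sup>2) > 0"
    using assms by (simp add: abs_square_less_1)
  then have "(cmod (b - a))\<^sup>2 < (cmod (1 - cnj a * b))\<^sup>2"
    using norm_pseudohyperbolic_identity[of a b] by linarith
  then show ?thesis by (rule power_less_imp_less_base) simp
qed

lemma Schwarz_Pick_disc:
  assumes "0 < s" and hol: "k holomorphic_on ball 0 s"
    and k1: "\<And>z. cmod z < s \<Longrightarrow> cmod (k z) < 1" and "cmod z < s"
  shows "cmod (k z - k 0) \<le> cmod z / s * cmod (1 - cnj (k 0) * k z)"
proof -
  have sz: "cmod (of_real s * z) < s" if "cmod z < 1" for z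
    using that \<open>0 < s\<close> by (simp add: norm_mult)
  have nz: "1 - cnj (k 0) * k (of_real s * z) \<noteq> 0" if "cmod z < 1" for z
    using pseudohyperbolic_less[OF k1 k1, of 0 "of_real s * z"] sz[OF that] \<open>0 < s\<close> by auto
  define K where "K = (\<lambda>z. (k (of_real s * z) - k 0) / (1 - cnj (k 0) * k (of_real s * z)))"
  have holk: "(\<lambda>z. k (of_real s * z)) holomorphic_on ball 0 1"
    by (rule holomorphic_on_compose_gen[OF _ hol, unfolded o_def])
       (use sz in \<open>auto intro!: holomorphic_intros\<close>)
  have holK: "K holomorphic_on ball 0 1" unfolding K_def
    by (intro holomorphic_intros holk) (use nz in auto)
  have K1: "cmod (K z) < 1" if "cmod z < 1" for z
    unfolding K_def norm_divide
    using pseudohyperbolic_less[OF k1 k1, of 0 "of_real s * z"] sz[OF that] \<open>0 < s\<close> nz[OF that]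
    by (simp add: divide_simps)
  have zs: "cmod (z / of_real s) < 1" using assms by (simp add: norm_divide)
  have "cmod (K (z / of_real s)) \<le> cmod (z / of_real s)"
    by (rule Schwarz_Lemma(1)[OF holK _ K1 zs]) (simp_all add: K_def)
  then have "cmod ((k z - k 0) / (1 - cnj (k 0) * k z)) \<le> cmod z / s"
    using \<open>0 < s\<close> by (simp add: K_def norm_divide)
  then show ?thesis
    using nz[OF zs] \<open>0 < s\<close> by (simp add: norm_divide field_simps)
qed

text \<open>The Schwarz-Pick lemma passes to moduli because a point of given modulus is closest to another one,
in the pseudohyperbolic sense, when both have the same argument.\<close>

lemma Schwarz_Pick_modulus:
  assumes "0 < s" and "k holomorphic_on ball 0 s"
    and k1: "\<And>z. cmod z < s \<Longrightarrow> cmod (k z) < 1" and z: "cmod z < s"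
  shows "cmod (k z) - cmod (k 0) \<le> cmod z / s * (1 - cmod (k 0) * cmod (k z))"
proof -
  define a b m where "a = cmod (k 0)" and "b = cmod (k z)" and "m = cmod z / s"
  have ab: "0 \<le> a" "a < 1" "0 \<le> b" "b < 1" "0 \<le> m" "m < 1"
    using k1 z \<open>0 < s\<close> by (auto simp: a_def b_def m_def)
  then have ab1: "0 < 1 - a * b" using mult_strict_mono'[of a 1 b 1] by simp
  define c where "c = cmod (1 - cnj (k 0) * k z)"
  have "1 - a * b \<le> c"
    using norm_triangle_ineq2[of 1 "cnj (k 0) * k z"] by (simp add: a_def b_def c_def norm_mult)
  then have c2: "(1 - a * b)\<^sup>2 \<le> c\<^sup>2" using ab1 by (intro power_mono) auto
  have "(cmod (k z - k 0))\<^sup>2 \<le> (m * c)\<^sup>2"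
    using Schwarz_Pick_disc[OF assms] by (intro power_mono) (auto simp: m_def c_def)
  then have "c\<^sup>2 - m\<^sup>2 * c\<^sup>2 \<le> (1 - a\<^sup>2) * (1 - b\<^sup>2)"
    using norm_pseudohyperbolic_identity[of "k 0" "k z"]
    by (simp add: a_def b_def c_def power_mult_distrib)
  moreover have "(1 - m\<^sup>2) * (1 - a * b)\<^sup>2 \<le> (1 - m\<^sup>2) * c\<^sup>2"
    using c2 ab by (intro mult_left_mono) (auto simp: abs_square_le_1)
  moreover have "(1 - a\<^sup>2) * (1 - b\<^sup>2) = (1 - a * b)\<^sup>2 - (b - a)\<^sup>2"
    by (simp add: power2_eq_square algebra_simps)
  moreover have "(1 - m\<^sup>2) * c\<^sup>2 = c\<^sup>2 - m\<^sup>2 * c\<^sup>2"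
    "(1 - m\<^sup>2) * (1 - a * b)\<^sup>2 = (1 - a * b)\<^sup>2 - m\<^sup>2 * (1 - a * b)\<^sup>2"
    by (simp_all only: left_diff_distrib mult_1)
  moreover have "(m * (1 - a * b))\<^sup>2 = m\<^sup>2 * (1 - a * b)\<^sup>2" by (rule power_mult_distrib)
  ultimately have "(b - a)\<^sup>2 \<le> (m * (1 - a * b))\<^sup>2" by linarith
  then have "b - a \<le> m * (1 - a * b)"
    by (rule power2_le_imp_le) (use ab ab1 in auto)
  then show ?thesis by (simp add: a_def b_def m_def)
qed

text \<open>The hypothesis says that the pseudohyperbolic distance of \<open>a\<close> and \<open>b\<close> is at most \<open>m\<close>; the conclusion is
the corresponding triangle inequality for the hyperbolic distance.\<close>

lemma artanh_le_add:
  fixes a b m :: real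
  assumes "0 \<le> a" "a < 1" "0 \<le> b" "b < 1" "0 \<le> m" "m < 1" "b - a \<le> m * (1 - a * b)"
  shows "artanh b \<le> artanh a + artanh m"
proof -
  have "ln ((1 + b) / (1 - b)) \<le> ln ((1 + a) / (1 - a) * ((1 + m) / (1 - m)))"
  proof (subst ln_le_cancel_iff)
    have "(1 + b) * ((1 - a) * (1 - m)) \<le> (1 + a) * (1 + m) * (1 - b)"
      using assms(7) by (simp add: algebra_simps)
    then show "(1 + b) / (1 - b) \<le> (1 + a) / (1 - a) * ((1 + m) / (1 - m))"
      using assms by (simp add: divide_simps)
  qed (use assms in auto)
  also have "\<dots> = ln ((1 + a) / (1 - a)) + ln ((1 + m) / (1 - m))"
    using assms by (intro ln_mult_pos) auto
  finally show ?thesis by (simp add: artanh_def)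
qed

lemma artanh_mono:
  fixes a b :: real
  assumes "0 \<le> a" "a \<le> b" "b < 1"
  shows "artanh a \<le> artanh b"
  using artanh_le_add[of b a 0] assms by simp

lemma artanh_strict_mono:
  fixes a b :: real
  assumes "0 \<le> a" "a < b" "b < 1"
  shows "artanh a < artanh b"
proof -
  have "ln ((1 + a) / (1 - a)) < ln ((1 + b) / (1 - b))"
    using assms by (subst ln_less_cancel_iff) (auto simp: divide_simps algebra_simps)
  then show ?thesis by (simp add: artanh_def)
qed

lemma artanh_nonneg: "0 \<le> a \<Longrightarrow> a < 1 \<Longrightarrow> 0 \<le> artanh (a::real)"
  using artanh_mono[of 0 a] by simp

lemma tanh_artanh_real:
  fixes a :: real assumes "0 \<le> a" "a < 1" shows "tanh (artanh a) = a"
proof -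
  have "0 < (1 + a) / (1 - a)" using assms by simp
  then have "exp (2 * artanh a) = (1 + a) / (1 - a)" by (simp add: artanh_def)
  then have "exp (- (2 * artanh a)) = (1 - a) / (1 + a)" by (simp add: exp_minus)
  then have "tanh (artanh a) = (1 - (1 - a) / (1 + a)) / (1 + (1 - a) / (1 + a))"
    by (simp add: tanh_real_altdef)
  also have "\<dots> = a" using assms by (simp add: divide_simps)
  finally show ?thesis .
qed

text \<open>Since \<open>2 * artanh m = artanh (2 * m / (1 + m\<^sup>2))\<close>, passing from the disc of radius \<open>1\<close> to a disc of radius \<open>s\<close>
at most doubles hyperbolic distances from the centre, in the stated range.\<close>

lemma artanh_dilate_le_double:
  fixes m s :: real
  assumes "0 \<le> m" "m < 1" "1 + m\<^sup>2 \<le> 2 * s"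
  shows "m / s < 1" "artanh (m / s) \<le> 2 * artanh m"
proof -
  have s: "0 < s" using assms(3) by (smt (verit) zero_le_power2)
  have "0 < (1 - m)\<^sup>2" using assms by simp
  then have "2 * m < 2 * s" using assms(3) by (simp add: power2_eq_square algebra_simps)
  then show "m / s < 1" using s by simp
  then have "artanh (m / s) \<le> artanh m + artanh m"
  proof (intro artanh_le_add)
    have "m / s * (1 + m\<^sup>2) \<le> m / s * (2 * s)" using assms s by (intro mult_left_mono) auto
    then have "m / s * (1 + m\<^sup>2) \<le> 2 * m" using s by simp
    then show "m / s - m \<le> m * (1 - m * (m / s))"
      by (simp add: algebra_simps power2_eq_square)
  qed (use assms s in auto)
  then show "artanh (m / s) \<le> 2 * artanh m" by simp
qed

text \<open>The map \<open>(P - P 0) / (P + cnj (P 0))\<close> sends the right half plane to the unit disc and \<open>P 0\<close> to the centre, so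
it has modulus at most \<open>1 / 2\<close> on the disc of half the radius.\<close>

lemma half_plane_Harnack:
  assumes "0 < s" and hol: "P holomorphic_on ball 0 s"
    and pos: "\<And>z. cmod z < s \<Longrightarrow> Re (P z) > 0" and z: "cmod z \<le> s / 2"
  shows "cmod (P z) \<le> 3 * cmod (P 0)"
proof -
  define k where "k = (\<lambda>z. (P z - P 0) / (P z + cnj (P 0)))"
  have P0: "Re (P 0) > 0" using pos \<open>0 < s\<close> by simp
  have nz: "P z + cnj (P 0) \<noteq> 0" if "cmod z < s" for z
    using pos[OF that] P0 by (auto simp: complex_eq_iff)
  have "k holomorphic_on ball 0 s"
    unfolding k_def by (intro holomorphic_intros hol) (use nz in auto)
  moreover have "cmod (k z) < 1" if "cmod z < s" for z
  proof -
    have "(cmod (P z - P 0))\<^sup>2 < (cmod (P z + cnj (P 0)))\<^sup>2"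
      unfolding cmod_power2 using mult_pos_pos[OF pos[OF that] P0]
      by (simp add: power2_eq_square algebra_simps)
    then have "cmod (P z - P 0) < cmod (P z + cnj (P 0))" by (rule power_less_imp_less_base) simp
    then show ?thesis using nz[OF that] by (simp add: k_def norm_divide divide_simps)
  qed
  ultimately have "cmod (k z - k 0) \<le> cmod z / s * cmod (1 - cnj (k 0) * k z)"
    using z \<open>0 < s\<close> by (intro Schwarz_Pick_disc) auto
  then have "cmod (k z) \<le> cmod z / s" by (simp add: k_def)
  also have "\<dots> \<le> 1 / 2" using z \<open>0 < s\<close> by (simp add: divide_simps)
  finally have "cmod (P z - P 0) \<le> 1 / 2 * cmod (P z + cnj (P 0))"
    using nz z \<open>0 < s\<close> by (simp add: k_def norm_divide divide_simps)
  moreover have "cmod (P z) \<le> cmod (P 0) + cmod (P z - P 0)" using norm_triangle_sub by blast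
  moreover have "cmod (P z + cnj (P 0)) \<le> cmod (P z) + cmod (P 0)"
    using norm_triangle_ineq[of "P z" "cnj (P 0)"] by simp
  ultimately show ?thesis by linarith
qed

section \<open>Hermitian product and analytic discs\<close>

definition herm :: "complex ^ 'n::finite \<Rightarrow> complex ^ 'n \<Rightarrow> complex" where
  "herm x y = (\<Sum>i\<in>UNIV. x $ i * cnj (y $ i))"

lemma herm_add_left: "herm (x + y) z = herm x z + herm y z"
  and herm_diff_left: "herm (x - y) z = herm x z - herm y z"
  and herm_smult_left: "herm (c *s x) z = c * herm x z"
  and herm_zero_left [simp]: "herm 0 z = 0"
  by (simp_all add: herm_def sum.distrib sum_subtractf sum_distrib_left ring_distribs mult.assoc)

lemma herm_add_right: "herm z (x + y) = herm z x + herm z y"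
  and herm_smult_right: "herm z (c *s x) = cnj c * herm z x"
  and herm_zero_right [simp]: "herm z 0 = 0"
  by (simp_all add: herm_def sum.distrib sum_subtractf sum_distrib_left ring_distribs mult_ac)

lemma herm_commute: "herm y x = cnj (herm x y)"
  by (simp add: herm_def mult.commute)

lemma Re_herm: "Re (herm x y) = inner x y"
  by (simp add: herm_def inner_vec_def inner_complex_def)

lemma herm_self: "herm x x = of_real ((norm x)\<^sup>2)"
proof -
  have "Im (herm x x) = 0" by (simp add: herm_def)
  then show ?thesis by (simp add: complex_eq_iff Re_herm power2_norm_eq_inner)
qed

lemma norm_smult_vec: "norm (c *s x) = cmod c * norm (x :: complex ^ 'n::finite)"
proof -
  have "of_real ((norm (c *s x))\<^sup>2) = c * cnj c * of_real ((norm x)\<^sup>2)"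
    by (simp only: herm_self[symmetric] herm_smult_left herm_smult_right mult_ac)
  also have "\<dots> = of_real ((cmod c * norm x)\<^sup>2)"
    by (simp only: complex_norm_square[symmetric] power_mult_distrib of_real_mult)
  finally show ?thesis
    by (metis of_real_eq_iff power2_eq_imp_eq norm_ge_zero mult_nonneg_nonneg)
qed

lemma herm_Cauchy_Schwarz: "cmod (herm x y) \<le> norm x * norm y"
proof (cases "herm x y = 0")
  case False
  define c where "c = cnj (herm x y) / of_real (cmod (herm x y))"
  have c: "cmod c = 1" using False by (simp add: c_def norm_divide)
  have "c * herm x y = of_real (cmod (herm x y))"
    using False complex_norm_square[of "herm x y"]
    by (simp add: c_def divide_simps power2_eq_square mult.commute)
  then have "cmod (herm x y) = inner (c *s x) y"
    by (metis Re_complex_of_real Re_herm herm_smult_left)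
  also have "\<dots> \<le> norm (c *s x) * norm y" by (rule norm_cauchy_schwarz)
  finally show ?thesis using c by (simp add: norm_smult_vec)
qed simp

text \<open>Reduces statements about norms of vector-valued holomorphic maps to scalar ones. For \<open>x = 0\<close> the vector
\<open>e\<close> is \<open>0\<close>, which is why its norm is only bounded by \<open>1\<close>.\<close>

lemma norming_vector:
  obtains e :: "complex ^ 'n::finite"
  where "norm e \<le> 1" "herm x e = of_real (norm x)" "\<And>y. cmod (herm y e) \<le> norm y"
proof -
  define e where "e = of_real (inverse (norm x)) *s x"
  have e: "norm e \<le> 1"
    unfolding e_def norm_smult_vec by (cases "x = 0") (simp_all add: norm_inverse)
  moreover have "herm x e = of_real (norm x)"
    by (cases "x = 0") (simp_all add: e_def herm_smult_right herm_self power2_eq_square)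
  moreover have "cmod (herm y e) \<le> norm y" for y
    using herm_Cauchy_Schwarz[of y e] mult_left_mono[OF e norm_ge_zero[of y]] by simp
  ultimately show ?thesis using that by blast
qed

lemma herm_holomorphic:
  fixes u :: "complex \<Rightarrow> complex ^ 'n::finite"
  assumes "\<And>i. (\<lambda>z. u z $ i) holomorphic_on S"
  shows "(\<lambda>z. herm (u z) v) holomorphic_on S"
  unfolding herm_def by (intro holomorphic_intros assms)

lemma continuous_on_herm [continuous_intros]:
  assumes "continuous_on S u"
  shows "continuous_on S (\<lambda>z. herm (u z) v)"
  unfolding herm_def by (intro continuous_intros assms)

lemma holomorphic_disc_continuous:
  assumes "f \<in> holomorphic_discs D"
  shows "continuous_on (ball 0 1) f"
proof -
  have "continuous_on (ball 0 1) (\<lambda>z. \<chi> i. f z $ i)"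
    using assms
    by (intro continuous_on_vec_lambda holomorphic_on_imp_continuous_on) (simp add: holomorphic_discs_def)
  then show ?thesis by simp
qed

lemma holomorphic_disc_vimage_open:
  assumes "f \<in> holomorphic_discs D" "open W"
  shows "open {z \<in> ball 0 1. f z \<in> W}"
  using continuous_open_preimage[OF holomorphic_disc_continuous[OF assms(1)] open_ball assms(2)]
  by (simp add: vimage_def Int_def)

lemma has_derivative_vec_lambda:
  fixes f :: "'c::finite \<Rightarrow> 'a::real_normed_vector \<Rightarrow> 'b::real_normed_vector"
  assumes "\<And>i. (f i has_derivative f' i) F"
  shows "((\<lambda>x. \<chi> i. f i x) has_derivative (\<lambda>h. \<chi> i. f' i h)) F"
proof -
  have ax: "bounded_linear (axis i :: 'b \<Rightarrow> 'b ^ 'c)" for i :: 'c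
    by (rule bounded_linear_intro[where K = 1])
       (simp_all add: vec_eq_iff axis_def norm_vec_def L2_set_def if_distrib[of norm]
         if_distrib[of "\<lambda>x. x\<^sup>2"] cong: if_cong)
  have eq: "(\<chi> i. g i) = (\<Sum>i\<in>UNIV. axis i (g i))" for g :: "'c \<Rightarrow> 'b"
    by (simp add: vec_eq_iff axis_def if_distrib cong: if_cong)
  show ?thesis
    unfolding eq by (intro has_derivative_sum bounded_linear.has_derivative[OF ax] assms)
qed

text \<open>By the chain rule the derivative of the composition is the complex linear derivative of \<open>g\<close> applied to
a multiple of the tangent vector of the disc, so it is multiplication by a complex number.\<close>

lemma holomorphic_disc_compose:
  fixes g :: "complex ^ 'n::finite \<Rightarrow> complex ^ 'm::finite"
  assumes f: "f \<in> holomorphic_discs D"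
    and g: "\<And>x. x \<in> W \<Longrightarrow> \<exists>A. (g has_derivative (\<lambda>h. A *v h)) (at x)"
    and "open W"
  shows "(\<lambda>z. g (f z) $ j) holomorphic_on {z \<in> ball 0 1. f z \<in> W}"
proof (rule holomorphic_onI)
  fix z assume z: "z \<in> {z \<in> ball 0 1. f z \<in> W}"
  obtain A where A: "(g has_derivative (\<lambda>h. A *v h)) (at (f z))" using g z by blast
  define c where "c i = deriv (\<lambda>z. f z $ i) z" for i
  have "((\<lambda>z. f z $ i) has_field_derivative c i) (at z)" for i
    using f z unfolding c_def holomorphic_discs_def
    by (auto intro!: holomorphic_derivI[of _ "ball 0 1"])
  then have "((\<lambda>z. f z $ i) has_derivative (\<lambda>h. c i * h)) (at z)" for i
    by (simp add: has_field_derivative_def)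
  then have "((\<lambda>z. \<chi> i. f z $ i) has_derivative (\<lambda>h. \<chi> i. c i * h)) (at z)"
    by (rule has_derivative_vec_lambda)
  then have "(f has_derivative (\<lambda>h. \<chi> i. c i * h)) (at z)" by simp
  from diff_chain_at[OF this A]
  have "((\<lambda>z. g (f z)) has_derivative (\<lambda>h. A *v (\<chi> i. c i * h))) (at z)" by (simp add: o_def)
  from bounded_linear.has_derivative[OF bounded_linear_vec_nth this]
  have "((\<lambda>z. g (f z) $ j) has_derivative (\<lambda>h. (A *v (\<chi> i. c i * h)) $ j)) (at z)" .
  moreover have "(\<lambda>h. (A *v (\<chi> i. c i * h)) $ j) = (\<lambda>h. (\<Sum>i\<in>UNIV. A $ j $ i * c i) * h)"
    by (rule ext) (simp add: matrix_vector_mult_def sum_distrib_right mult.assoc)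
  ultimately have "((\<lambda>z. g (f z) $ j) has_field_derivative (\<Sum>i\<in>UNIV. A $ j $ i * c i)) (at z)"
    by (simp add: has_field_derivative_def)
  then show "(\<lambda>z. g (f z) $ j) field_differentiable at z within {z \<in> ball 0 1. f z \<in> W}"
    using field_differentiable_at_within field_differentiable_def by blast
qed

text \<open>The automorphism of the unit disc that takes \<open>0\<close> to \<open>a\<close>.\<close>

definition disc_shift :: "complex \<Rightarrow> complex \<Rightarrow> complex" where
  "disc_shift a z = (z + a) / (1 + cnj a * z)"

lemma disc_shift:
  assumes "cmod a < 1"
  shows "disc_shift a holomorphic_on ball 0 1" "disc_shift a 0 = a"
    "cmod z < 1 \<Longrightarrow> cmod (disc_shift a z) < 1"
    "cmod z < 1 \<Longrightarrow> disc_shift a ((z - a) / (1 - cnj a * z)) = z"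
proof -
  have nz: "1 + cnj a * z \<noteq> 0" "cmod (disc_shift a z) < 1" if "cmod z < 1" for z
  proof -
    have "cmod (z + a) < cmod (1 + cnj a * z)"
      using pseudohyperbolic_less[of "- a" z] assms that by simp
    then show "1 + cnj a * z \<noteq> 0" "cmod (disc_shift a z) < 1"
      by (auto simp: disc_shift_def norm_divide divide_simps)
  qed
  show "disc_shift a holomorphic_on ball 0 1"
    unfolding disc_shift_def by (intro holomorphic_intros) (use nz in auto)
  show "disc_shift a 0 = a" by (simp add: disc_shift_def)
  show "cmod z < 1 \<Longrightarrow> cmod (disc_shift a z) < 1" by (rule nz)
  assume z: "cmod z < 1"
  have d: "1 - cnj a * z \<noteq> 0" using pseudohyperbolic_less[OF assms z] by auto
  have aa: "1 - a * cnj a \<noteq> 0"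
    using pseudohyperbolic_less[OF assms assms] by (auto simp: mult.commute)
  have "disc_shift a ((z - a) / (1 - cnj a * z)) =
    ((z - a) + a * (1 - cnj a * z)) / ((1 - cnj a * z) + cnj a * (z - a))"
    using d by (simp add: disc_shift_def divide_simps)
  also have "\<dots> = (z * (1 - a * cnj a)) / (1 - a * cnj a)" by (simp add: algebra_simps)
  finally show "disc_shift a ((z - a) / (1 - cnj a * z)) = z" using aa by simp
qed

lemma holomorphic_disc_shift:
  assumes "f \<in> holomorphic_discs D" "cmod a < 1"
  shows "(\<lambda>z. f (disc_shift a z)) \<in> holomorphic_discs D"
proof -
  have sub: "disc_shift a ` ball 0 1 \<subseteq> ball 0 1" using disc_shift(3)[OF assms(2)] by auto
  then have "(\<lambda>z. f (disc_shift a z) $ i) holomorphic_on ball 0 1" for i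
    using assms holomorphic_on_compose_gen[OF disc_shift(1)[OF assms(2)], of "\<lambda>z. f z $ i" "ball 0 1"]
    by (simp add: holomorphic_discs_def o_def)
  then show ?thesis using assms(1) sub unfolding holomorphic_discs_def by blast
qed

text \<open>The automorphism \<open>\<zeta> \<mapsto> (m - \<zeta>) / (1 - cnj m * \<zeta>)\<close> interchanges \<open>0\<close> and \<open>m\<close>.\<close>

lemma lempert_commute_le: "lempert D x y \<le> lempert D y x"
  unfolding lempert_def
proof (rule Inf_greatest, clarify)
  fix m :: complex and f assume m: "m \<in> ball 0 1" and f: "f \<in> holomorphic_discs D"
  define g where "g z = f (disc_shift m (- z))" for z
  have m1: "cmod m < 1" using m by simp
  have "(\<lambda>z. f (disc_shift m z)) \<in> holomorphic_discs D" using holomorphic_disc_shift[OF f m1] .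
  then have "g \<in> holomorphic_discs D"
    unfolding holomorphic_discs_def g_def
  proof (safe, goal_cases)
    case (1 i)
    have "(\<lambda>z::complex. - z) holomorphic_on ball 0 1" by (intro holomorphic_intros)
    moreover have "(\<lambda>z::complex. - z) \<in> ball 0 1 \<rightarrow> ball 0 1" by simp
    ultimately show ?case
      using holomorphic_on_compose_gen[of "\<lambda>z. - z" "ball 0 1" "\<lambda>z. f (disc_shift m z) $ i" "ball 0 1"] 1
      unfolding o_def by blast
  qed auto
  moreover have "g 0 = f m" by (simp add: g_def disc_shift(2)[OF m1])
  moreover have "g m = f 0" by (simp add: g_def disc_shift_def)
  ultimately show "Inf {ereal (artanh (cmod \<mu>)) | \<mu> h.
      \<mu> \<in> ball 0 1 \<and> h \<in> holomorphic_discs D \<and> h 0 = f m \<and> h \<mu> = f 0} \<le> ereal (artanh (cmod m))"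
    using m by (intro Inf_lower) blast
qed

section \<open>The Siegel domain model\<close>

text \<open>For a unit vector \<open>\<nu>\<close> this is the component of \<open>x\<close> orthogonal to the complex line of \<open>\<nu>\<close>.\<close>

definition perp :: "complex ^ 'n::finite \<Rightarrow> complex ^ 'n \<Rightarrow> complex ^ 'n" where
  "perp \<nu> x = x - herm x \<nu> *s \<nu>"

lemma perp_add: "perp \<nu> (x + y) = perp \<nu> x + perp \<nu> y"
  and perp_diff: "perp \<nu> (x - y) = perp \<nu> x - perp \<nu> y"
  and perp_smult: "perp \<nu> (c *s x) = c *s perp \<nu> x"
  by (simp_all add: perp_def herm_add_left herm_diff_left herm_smult_left vec_eq_iff algebra_simps)

lemma herm_perp:
  assumes "norm \<nu> = 1"
  shows "herm \<nu> \<nu> = 1" "herm (perp \<nu> x) \<nu> = 0" "perp \<nu> \<nu> = 0"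
  using assms by (simp_all add: perp_def herm_diff_left herm_smult_left herm_self)

lemma herm_split:
  assumes "norm \<nu> = 1"
  shows "herm (a *s \<nu> + b *s perp \<nu> x) \<nu> = a" "perp \<nu> (a *s \<nu> + b *s perp \<nu> x) = b *s perp \<nu> x"
proof -
  show "herm (a *s \<nu> + b *s perp \<nu> x) \<nu> = a"
    using herm_perp[OF assms] by (simp add: herm_add_left herm_smult_left)
  then show "perp \<nu> (a *s \<nu> + b *s perp \<nu> x) = b *s perp \<nu> x"
    by (simp add: perp_def)
qed

lemma norm_split:
  assumes "norm \<nu> = 1"
  shows "(norm (a *s \<nu> + b *s perp \<nu> x))\<^sup>2 = (cmod a)\<^sup>2 + (cmod b)\<^sup>2 * (norm (perp \<nu> x))\<^sup>2"
proof -
  let ?p = "perp \<nu> x"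
  have "herm \<nu> ?p = 0" using herm_perp[OF assms] herm_commute[of \<nu> ?p] by simp
  then have "herm (a *s \<nu> + b *s ?p) (a *s \<nu> + b *s ?p) = a * cnj a + b * cnj b * herm ?p ?p"
    using herm_perp[OF assms]
    by (simp add: herm_add_left herm_add_right herm_smult_left herm_smult_right mult_ac)
  then have "of_real ((norm (a *s \<nu> + b *s ?p))\<^sup>2) = (of_real ((cmod a)\<^sup>2 + (cmod b)\<^sup>2 * (norm ?p)\<^sup>2) :: complex)"
    by (simp only: herm_self complex_norm_square[symmetric] of_real_add of_real_mult)
  then show ?thesis by (simp only: of_real_eq_iff)
qed

lemma norm_square_split:
  assumes "norm \<nu> = 1"
  shows "(norm x)\<^sup>2 = (cmod (herm x \<nu>))\<^sup>2 + (norm (perp \<nu> x))\<^sup>2"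
  using norm_split[OF assms, of "herm x \<nu>" 1 x] by (simp add: perp_def)

lemma complex_linear_matrix:
  fixes L :: "complex ^ 'm::finite \<Rightarrow> complex ^ 'n::finite"
  assumes "\<And>x y. L (x + y) = L x + L y" "\<And>c x. L (c *s x) = c *s L x"
  shows "\<exists>A. L = (\<lambda>h. A *v h)"
proof -
  have "Vector_Spaces.linear (*s) (*s) L"
    using assms by (intro Vector_Spaces.linear.intro module_hom.intro module_hom_axioms.intro
        vec.vector_space_axioms vec.module_axioms) auto
  then show ?thesis using matrix_works by (metis ext)
qed

text \<open>Stretching by \<open>\<alpha>\<close> along \<open>\<nu>\<close> and by \<open>\<beta>\<close> orthogonally to it is complex linear.\<close>

lemma ellipsoid_affine_image:
  fixes \<nu> c :: "complex ^ 'n::finite"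
  assumes \<nu>: "norm \<nu> = 1" and \<alpha>: "0 < \<alpha>" and \<beta>: "0 < \<beta>"
  obtains em :: "complex ^ 'n \<Rightarrow> complex ^ 'n" and A :: "complex ^ 'n ^ 'n"
  where "\<And>x. (em has_derivative (\<lambda>h. A *v h)) (at x)" "inj em"
    "em ` ball 0 1 = {v. (cmod (herm (v - c) \<nu>) / \<alpha>)\<^sup>2 + (norm (perp \<nu> (v - c)) / \<beta>)\<^sup>2 < 1}"
proof -
  define L where "L h = (of_real \<alpha> * herm h \<nu>) *s \<nu> + of_real \<beta> *s perp \<nu> h" for h
  have "L (x + y) = L x + L y" "L (d *s x) = d *s L x" for x y d
    by (simp_all add: L_def herm_add_left herm_smult_left perp_add perp_smult vec_eq_iff algebra_simps)
  then obtain A where A: "L = (\<lambda>h. A *v h)" using complex_linear_matrix by blast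
  define em where "em x = c + L x" for x
  have coord: "herm (em x - c) \<nu> = of_real \<alpha> * herm x \<nu>" "perp \<nu> (em x - c) = of_real \<beta> *s perp \<nu> x" for x
    using herm_split[OF \<nu>] by (simp_all add: em_def L_def)
  have "(em has_derivative (\<lambda>h. A *v h)) (at x)" for x
  proof -
    have "((\<lambda>x. c + A *v x) has_derivative (\<lambda>h. 0 + A *v h)) (at x)"
      by (intro has_derivative_add has_derivative_const bounded_linear_imp_has_derivative) simp
    moreover have "em = (\<lambda>x. c + A *v x)" by (rule ext) (simp add: em_def A)
    ultimately show ?thesis by simp
  qed
  moreover have "inj em"
  proof (rule injI)
    fix x y assume "em x = em y"
    then have "of_real \<alpha> * herm x \<nu> = of_real \<alpha> * herm y \<nu>"
      "of_real \<beta> *s perp \<nu> x = of_real \<beta> *s perp \<nu> y" by (metis coord)+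
    then have "herm x \<nu> = herm y \<nu>" "perp \<nu> x = perp \<nu> y"
      using \<alpha> \<beta> by (simp_all add: vec_eq_iff)
    then show "x = y" by (simp add: perp_def)
  qed
  moreover have mem: "(cmod (herm (em x - c) \<nu>) / \<alpha>)\<^sup>2 + (norm (perp \<nu> (em x - c)) / \<beta>)\<^sup>2 = (norm x)\<^sup>2" for x
    using \<alpha> \<beta> by (simp add: coord norm_mult norm_smult_vec norm_square_split[OF \<nu>, of x])
  have "em ` ball 0 1 = {v. (cmod (herm (v - c) \<nu>) / \<alpha>)\<^sup>2 + (norm (perp \<nu> (v - c)) / \<beta>)\<^sup>2 < 1}"
  proof (intro equalityI subsetI)
    fix v assume "v \<in> em ` ball 0 1"
    then show "v \<in> {v. (cmod (herm (v - c) \<nu>) / \<alpha>)\<^sup>2 + (norm (perp \<nu> (v - c)) / \<beta>)\<^sup>2 < 1}"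
      by (auto simp: mem abs_square_less_1)
  next
    fix v assume v: "v \<in> {v. (cmod (herm (v - c) \<nu>) / \<alpha>)\<^sup>2 + (norm (perp \<nu> (v - c)) / \<beta>)\<^sup>2 < 1}"
    define x where "x = (herm (v - c) \<nu> / of_real \<alpha>) *s \<nu> + of_real (1 / \<beta>) *s perp \<nu> (v - c)"
    have "em x = c + (of_real \<alpha> * (herm (v - c) \<nu> / of_real \<alpha>)) *s \<nu> + of_real \<beta> *s (of_real (1 / \<beta>) *s perp \<nu> (v - c))"
      unfolding em_def L_def x_def herm_split[OF \<nu>] by (simp add: add.assoc)
    also have "\<dots> = v" using \<alpha> \<beta> by (simp add: perp_def vec_eq_iff)
    finally have "em x = v" .
    then have "(norm x)\<^sup>2 < 1" using v mem[of x] by simp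
    then have "x \<in> ball 0 1" by (simp add: abs_square_less_1)
    then show "v \<in> em ` ball 0 1" using \<open>em x = v\<close> by blast
  qed
  ultimately show ?thesis using that by blast
qed

text \<open>With \<open>w = herm x \<nu> + t\<close> as normal coordinate, this is the map with components \<open>(w - t) / (w + t)\<close> and
\<open>2 * sqrt (a * t) * x' / (w + t)\<close>, where \<open>x'\<close> is the tangential part of \<open>x\<close>. It is the Cayley transform of the Siegel
domain \<open>Re w > a * |x'|\<^sup>2\<close> onto the unit ball, normalized such that the point \<open>w = t\<close>, \<open>x' = 0\<close>, that is \<open>x = 0\<close>, goes
to the centre.\<close>

definition siegel_map :: "complex ^ 'n::finite \<Rightarrow> real \<Rightarrow> real \<Rightarrow> complex ^ 'n \<Rightarrow> complex ^ 'n" where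
  "siegel_map \<nu> t a x =
     (1 / (herm x \<nu> + 2 * of_real t)) *s (herm x \<nu> *s \<nu> + of_real (2 * sqrt (a * t)) *s perp \<nu> x)"

lemma siegel_map_zero [simp]: "siegel_map \<nu> t a 0 = 0"
  by (simp add: siegel_map_def perp_def vec_eq_iff)

lemma siegel_den_square:
  assumes "0 < t" "W = z + of_real t"
  shows "(cmod (z + 2 * of_real t))\<^sup>2 = (cmod z)\<^sup>2 + 4 * t * Re W"
    "(cmod (z + 2 * of_real t))\<^sup>2 = (cmod W)\<^sup>2 + t\<^sup>2 + 2 * t * Re W"
  unfolding assms(2) cmod_power2 by (simp_all add: power2_eq_square algebra_simps)

lemma norm_siegel_map:
  assumes "norm \<nu> = 1" "0 < t" "0 \<le> a" "0 \<le> Re (herm x \<nu>) + t"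
  shows "(norm (siegel_map \<nu> t a x))\<^sup>2 * (cmod (herm x \<nu> + 2 * of_real t))\<^sup>2 =
    (cmod (herm x \<nu>))\<^sup>2 + 4 * a * t * (norm (perp \<nu> x))\<^sup>2"
proof -
  have "Re (herm x \<nu> + 2 * of_real t) > 0" using assms by simp
  then have nz: "herm x \<nu> + 2 * of_real t \<noteq> 0" by (metis less_irrefl zero_complex.sel(1))
  have "(norm (siegel_map \<nu> t a x))\<^sup>2 * (cmod (herm x \<nu> + 2 * of_real t))\<^sup>2 =
    (norm (herm x \<nu> *s \<nu> + of_real (2 * sqrt (a * t)) *s perp \<nu> x))\<^sup>2"
    unfolding siegel_map_def norm_smult_vec using nz
    by (simp add: power_mult_distrib norm_divide power_divide)
  also have "\<dots> = (cmod (herm x \<nu>))\<^sup>2 + (2 * sqrt (a * t))\<^sup>2 * (norm (perp \<nu> x))\<^sup>2"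
    unfolding norm_split[OF assms(1)] norm_of_real power2_abs ..
  also have "(2 * sqrt (a * t))\<^sup>2 = 4 * a * t" using assms by (simp add: power_mult_distrib)
  finally show ?thesis .
qed

lemma siegel_map_in_ball:
  assumes \<nu>: "norm \<nu> = 1" and t: "0 < t" and a: "0 \<le> a"
    and x: "a * (norm (perp \<nu> x))\<^sup>2 < Re (herm x \<nu>) + t"
  shows "norm (siegel_map \<nu> t a x) < 1"
proof -
  define q where "q = (cmod (herm x \<nu> + 2 * of_real t))\<^sup>2"
  have X: "0 < Re (herm x \<nu>) + t" using x a by (smt (verit) mult_nonneg_nonneg zero_le_power2)
  have q: "q = (cmod (herm x \<nu>))\<^sup>2 + 4 * t * (Re (herm x \<nu>) + t)"
    using siegel_den_square(1)[OF t refl, of "herm x \<nu>"] by (simp add: q_def)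
  have "0 < 4 * t * (Re (herm x \<nu>) + t)" using t X by simp
  then have q0: "0 < q" unfolding q by (smt (verit) zero_le_power2)
  have "4 * t * (a * (norm (perp \<nu> x))\<^sup>2) < 4 * t * (Re (herm x \<nu>) + t)"
    using x t by (intro mult_strict_left_mono) auto
  moreover have "(norm (siegel_map \<nu> t a x))\<^sup>2 * q =
      (cmod (herm x \<nu>))\<^sup>2 + 4 * t * (a * (norm (perp \<nu> x))\<^sup>2)"
    using norm_siegel_map[OF \<nu> t a, of x] X unfolding q_def by (simp add: mult_ac)
  ultimately have "(norm (siegel_map \<nu> t a x))\<^sup>2 * q < q" using q by linarith
  then have "(norm (siegel_map \<nu> t a x))\<^sup>2 < 1" using q0 by simp
  then show ?thesis by (simp add: abs_square_less_1)
qed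

text \<open>A ball of fixed radius in the intrinsic metric of the Siegel domain \<open>g * Re W > (1 - \<epsilon>) * |x'|\<^sup>2\<close> is
contained in the smaller ellipsoid of the conclusion. On the sublevel set the amount by which
\<open>g * Re W\<close> exceeds \<open>(1 - \<epsilon>) * |x'|\<^sup>2\<close> is at least \<open>g * \<kappa> * |W + t|\<^sup>2 / (4 * t)\<close>. This is at least comparable to \<open>g * \<kappa> * Re W\<close>,
which pays for the change from \<open>1 - \<epsilon>\<close> to \<open>1 + \<epsilon>\<close>, and for small \<open>t\<close> it also dominates any fixed
multiple of \<open>|W|\<^sup>2\<close> and of \<open>t\<^sup>2\<close>.\<close>

lemma siegel_map_sublevel:
  assumes \<nu>: "norm \<nu> = 1" and t: "0 < t" and g: "0 < g" and \<kappa>: "0 < \<kappa>" "\<kappa> \<le> 1"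
    and \<epsilon>: "0 \<le> \<epsilon>" "\<epsilon> \<le> \<kappa> / 8" and K: "0 < K" "16 * K * t \<le> g * \<kappa>" "64 * t < g * \<kappa>"
    and W: "W = herm x \<nu> + of_real t" "0 \<le> Re W"
    and le: "(norm (siegel_map \<nu> t ((1 - \<epsilon>) / g) x))\<^sup>2 \<le> 1 - \<kappa>"
  shows "(1 + \<epsilon>) * (norm (perp \<nu> x))\<^sup>2 + K * (cmod W)\<^sup>2 + 4 * t\<^sup>2 < g * Re W"
proof -
  define q p X where "q = (cmod (herm x \<nu> + 2 * of_real t))\<^sup>2" and "p = (norm (perp \<nu> x))\<^sup>2" and "X = Re W"
  have p: "0 \<le> p" and X: "0 \<le> X" using W by (simp_all add: p_def X_def)
  have \<epsilon>1: "\<epsilon> \<le> 1 / 8" using \<epsilon> \<kappa> by simp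
  have q1: "q = (cmod (herm x \<nu>))\<^sup>2 + 4 * t * X" and q2: "q = (cmod W)\<^sup>2 + t\<^sup>2 + 2 * t * X"
    using siegel_den_square[OF t W(1)] by (simp_all add: q_def X_def)
  have "0 \<le> q" by (simp add: q_def)
  have Re: "Re (herm x \<nu>) + t = X" by (simp add: X_def W)
  have "(cmod (herm x \<nu>))\<^sup>2 + 4 * ((1 - \<epsilon>) / g) * t * p \<le> (1 - \<kappa>) * q"
    using norm_siegel_map[OF \<nu> t, of "(1 - \<epsilon>) / g" x] mult_right_mono[OF le, of q] \<epsilon>1 g X Re \<open>0 \<le> q\<close>
    by (simp add: q_def p_def)
  then have "4 * ((1 - \<epsilon>) / g) * t * p + \<kappa> * q \<le> 4 * t * X" using q1 by (simp add: algebra_simps)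
  then have "g * (4 * ((1 - \<epsilon>) / g) * t * p + \<kappa> * q) \<le> g * (4 * t * X)"
    using g by (intro mult_left_mono) auto
  moreover have "g * (4 * ((1 - \<epsilon>) / g) * t * p) = 4 * t * ((1 - \<epsilon>) * p)" using g by simp
  ultimately have main: "4 * t * ((1 - \<epsilon>) * p) + g * \<kappa> * q \<le> 4 * t * (g * X)"
    by (simp only: distrib_left mult.assoc mult.left_commute[of g])
  have gkq: "0 \<le> g * \<kappa> * q" using g \<kappa> \<open>0 \<le> q\<close> by simp
  then have "4 * t * ((1 - \<epsilon>) * p) \<le> 4 * t * (g * X)" using main by linarith
  then have "(1 - \<epsilon>) * p \<le> g * X" using t by simp
  moreover have "1 / 2 * p \<le> (1 - \<epsilon>) * p" using \<epsilon>1 p by (intro mult_right_mono) auto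
  ultimately have p2: "p \<le> 2 * (g * X)" by linarith
  have gX: "0 \<le> g * X" using g X by simp
  have "\<epsilon> * p \<le> \<kappa> / 8 * (2 * (g * X))" using \<epsilon> p2 p gX \<kappa> by (intro mult_mono) auto
  then have "8 * t * (\<epsilon> * p) \<le> 8 * t * (\<kappa> / 8 * (2 * (g * X)))" using t by (intro mult_left_mono) auto
  also have "\<dots> = g * \<kappa> / 2 * (4 * t * X)" by simp
  also have "\<dots> \<le> g * \<kappa> / 2 * q" using q1 g \<kappa> by (intro mult_left_mono) auto
  finally have b1: "8 * t * (\<epsilon> * p) \<le> g * \<kappa> / 2 * q" .
  have Wq: "(cmod W)\<^sup>2 \<le> q" and tq: "t\<^sup>2 \<le> q" using q2 t X by simp_all
  have "16 * K * t * (cmod W)\<^sup>2 \<le> g * \<kappa> * q" using K g \<kappa> Wq by (intro mult_mono[of "16 * K * t" "g * \<kappa>"]) auto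
  then have b2: "4 * t * (K * (cmod W)\<^sup>2) \<le> g * \<kappa> / 4 * q" by (simp add: mult_ac)
  have "64 * t * t\<^sup>2 < g * \<kappa> * t\<^sup>2" using K t by (intro mult_strict_right_mono) auto
  also have "\<dots> \<le> g * \<kappa> * q" using tq g \<kappa> by (intro mult_left_mono) auto
  finally have b3: "4 * t * (4 * t\<^sup>2) < g * \<kappa> / 4 * q" by simp
  have "4 * t * ((1 + \<epsilon>) * p + K * (cmod W)\<^sup>2 + 4 * t\<^sup>2) =
      4 * t * ((1 - \<epsilon>) * p) + 8 * t * (\<epsilon> * p) + 4 * t * (K * (cmod W)\<^sup>2) + 4 * t * (4 * t\<^sup>2)"
    by (simp add: algebra_simps)
  also have "\<dots> < 4 * t * ((1 - \<epsilon>) * p) + g * \<kappa> * q" 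
  proof -
    have "g * \<kappa> / 2 * q = (g * \<kappa> * q) / 2" "g * \<kappa> / 4 * q = (g * \<kappa> * q) / 4" by simp_all
    then show ?thesis using b1 b2 b3 by linarith
  qed
  also have "\<dots> \<le> 4 * t * (g * X)" by (rule main)
  finally show ?thesis using t by (simp add: p_def X_def)
qed

text \<open>Completing the square in the normal coordinate puts the inequality into the normal form of an ellipsoid.\<close>

lemma inner_ellipsoid:
  assumes \<nu>: "norm \<nu> = 1" and K: "0 < K" and \<epsilon>: "0 \<le> \<epsilon>" and t: "16 * K * t\<^sup>2 < g\<^sup>2"
  shows "(1 + \<epsilon>) * (norm (perp \<nu> x))\<^sup>2 + K * (cmod (herm x \<nu> + of_real t))\<^sup>2 + 4 * t\<^sup>2 < g * (Re (herm x \<nu>) + t)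
    \<longleftrightarrow> (cmod (herm (x - of_real (g / (2 * K) - t) *s \<nu>) \<nu>) / (sqrt (g\<^sup>2 / (4 * K) - 4 * t\<^sup>2) / sqrt K))\<^sup>2
      + (norm (perp \<nu> (x - of_real (g / (2 * K) - t) *s \<nu>)) / (sqrt (g\<^sup>2 / (4 * K) - 4 * t\<^sup>2) / sqrt (1 + \<epsilon>)))\<^sup>2 < 1"
    "0 < g\<^sup>2 / (4 * K) - 4 * t\<^sup>2"
proof -
  define R where "R = g\<^sup>2 / (4 * K) - 4 * t\<^sup>2"
  show "0 < g\<^sup>2 / (4 * K) - 4 * t\<^sup>2" using t K by (simp add: field_simps)
  then have R: "0 < R" by (simp add: R_def)
  define W where "W = herm x \<nu> + of_real t"
  have h: "herm (x - of_real (g / (2 * K) - t) *s \<nu>) \<nu> = W - of_real (g / (2 * K))"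
    using herm_perp[OF \<nu>] by (simp add: herm_diff_left herm_smult_left W_def)
  have p: "perp \<nu> (x - of_real (g / (2 * K) - t) *s \<nu>) = perp \<nu> x"
    using herm_perp[OF \<nu>] by (simp add: perp_diff perp_smult)
  have sq0: "(cmod (W - of_real c))\<^sup>2 = (cmod W)\<^sup>2 - 2 * c * Re W + c\<^sup>2" for c
    unfolding cmod_power2 by (simp add: power2_eq_square algebra_simps)
  have sq: "K * (cmod (W - of_real (g / (2 * K))))\<^sup>2 = K * (cmod W)\<^sup>2 - g * Re W + g\<^sup>2 / (4 * K)"
    unfolding sq0 using K by (simp add: power2_eq_square field_simps)
  have "(cmod (W - of_real (g / (2 * K))) / (sqrt R / sqrt K))\<^sup>2 + (norm (perp \<nu> x) / (sqrt R / sqrt (1 + \<epsilon>)))\<^sup>2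
    = (K * (cmod (W - of_real (g / (2 * K))))\<^sup>2 + (1 + \<epsilon>) * (norm (perp \<nu> x))\<^sup>2) / R"
    using R K \<epsilon> by (simp add: power_divide power_mult_distrib add_divide_distrib mult.commute)
  also have "\<dots> < 1 \<longleftrightarrow> K * (cmod (W - of_real (g / (2 * K))))\<^sup>2 + (1 + \<epsilon>) * (norm (perp \<nu> x))\<^sup>2 < R"
    using R by simp
  also have "\<dots> \<longleftrightarrow> (1 + \<epsilon>) * (norm (perp \<nu> x))\<^sup>2 + K * (cmod W)\<^sup>2 + 4 * t\<^sup>2 < g * Re W"
    unfolding sq R_def by linarith
  finally show "(1 + \<epsilon>) * (norm (perp \<nu> x))\<^sup>2 + K * (cmod (herm x \<nu> + of_real t))\<^sup>2 + 4 * t\<^sup>2 < g * (Re (herm x \<nu>) + t)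
    \<longleftrightarrow> (cmod (herm (x - of_real (g / (2 * K) - t) *s \<nu>) \<nu>) / (sqrt (g\<^sup>2 / (4 * K) - 4 * t\<^sup>2) / sqrt K))\<^sup>2
      + (norm (perp \<nu> (x - of_real (g / (2 * K) - t) *s \<nu>)) / (sqrt (g\<^sup>2 / (4 * K) - 4 * t\<^sup>2) / sqrt (1 + \<epsilon>)))\<^sup>2 < 1"
    unfolding h p R_def[symmetric] by (simp add: W_def)
qed

text \<open>Since \<open>K * |W|\<^sup>2 < g * |W|\<close> the ellipsoid has size \<open>g / K\<close> in the normal and \<open>g / sqrt K\<close> in the tangential directions; a
large \<open>K\<close> thus keeps it inside a given neighbourhood without changing its curvature in the tangential directions.\<close>

lemma inner_ellipsoid_small:
  assumes \<nu>: "norm \<nu> = 1" and K: "0 < K" and \<epsilon>: "0 \<le> \<epsilon>" and t: "0 \<le> t" and g: "0 < g"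
    and x: "(1 + \<epsilon>) * (norm (perp \<nu> x))\<^sup>2 + K * (cmod (herm x \<nu> + of_real t))\<^sup>2 + 4 * t\<^sup>2 < g * (Re (herm x \<nu>) + t)"
    and \<delta>: "0 < \<delta>" "g \<le> \<delta> * K" "g\<^sup>2 \<le> \<delta>\<^sup>2 * K" "t \<le> \<delta>"
  shows "norm x < 3 * \<delta>"
proof -
  define w where "w = cmod (herm x \<nu> + of_real t)"
  have Rew: "Re (herm x \<nu>) + t \<le> w"
    using complex_Re_le_cmod[of "herm x \<nu> + of_real t"] by (simp add: w_def)
  have p0: "0 \<le> (1 + \<epsilon>) * (norm (perp \<nu> x))\<^sup>2" using \<epsilon> by simp
  have Kw: "0 \<le> K * w\<^sup>2" using K by simp
  have gw: "g * (Re (herm x \<nu>) + t) \<le> g * w" using Rew g by simp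
  have "K * w\<^sup>2 < g * w" using x gw p0 zero_le_power2[of t] unfolding w_def by linarith
  then have "w * (K * w) < w * g" by (simp add: power2_eq_square mult_ac)
  moreover have "0 \<le> w" by (simp add: w_def)
  ultimately have "K * w < g" by (simp add: mult_less_cancel_left)
  then have "K * w < K * \<delta>" using \<delta> by (simp add: mult.commute)
  then have w: "w < \<delta>" using K by simp
  have "(norm (perp \<nu> x))\<^sup>2 \<le> (1 + \<epsilon>) * (norm (perp \<nu> x))\<^sup>2" using \<epsilon> by (simp add: algebra_simps)
  then have "(norm (perp \<nu> x))\<^sup>2 < g * w"
    using x gw Kw zero_le_power2[of t] unfolding w_def by linarith
  then have "K * (norm (perp \<nu> x))\<^sup>2 < K * (g * w)" using K by simp
  also have "\<dots> = g * (K * w)" by simp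
  also have "\<dots> \<le> g * g" using \<open>K * w < g\<close> g by simp
  also have "\<dots> \<le> K * \<delta>\<^sup>2" using \<delta> by (simp add: power2_eq_square mult_ac)
  finally have "(norm (perp \<nu> x))\<^sup>2 < \<delta>\<^sup>2" using K by simp
  then have p: "norm (perp \<nu> x) < \<delta>" using \<delta> by (simp add: power_less_imp_less_base)
  have "cmod (herm x \<nu>) \<le> w + t"
    using norm_triangle_ineq4[of "herm x \<nu> + of_real t" "of_real t"] t by (simp add: w_def)
  moreover have "norm x \<le> norm (perp \<nu> x) + norm (herm x \<nu> *s \<nu>)"
    using norm_triangle_ineq[of "perp \<nu> x" "herm x \<nu> *s \<nu>"] by (simp add: perp_def)
  ultimately show ?thesis using w p \<delta> \<nu> by (simp add: norm_smult_vec)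
qed

section \<open>Normal charts and localization of discs\<close>

text \<open>A chart \<open>G\<close> with inverse \<open>Gam\<close>, centred at a boundary point, in which the domain osculates a ball. The
assumption \<open>expansion\<close> says that the Hessian of the defining function \<open>r\<close> at the origin is twice the real inner
product and is continuous there; stating it for pairs of points makes it usable at interior
base points close to the boundary.\<close>

locale normal_chart =
  fixes D :: "(complex ^ 'n::finite) set" and N V :: "(complex ^ 'n) set"
    and G Gam :: "complex ^ 'n \<Rightarrow> complex ^ 'n"
    and r :: "complex ^ 'n \<Rightarrow> real" and n :: "complex ^ 'n \<Rightarrow> complex ^ 'n"
  assumes openD: "open D" and openN: "open N" and N0: "0 \<in> N" and openV: "open V"
    and homeo: "homeomorphism N V G Gam"
    and G_hol: "\<And>u. u \<in> N \<Longrightarrow> \<exists>A :: complex ^ 'n ^ 'n. (G has_derivative (\<lambda>h. A *v h)) (at u)"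
    and Gam_hol: "\<And>x. x \<in> V \<Longrightarrow> \<exists>A :: complex ^ 'n ^ 'n. (Gam has_derivative (\<lambda>h. A *v h)) (at x)"
    and D_sign: "\<And>u. u \<in> N \<Longrightarrow> G u \<in> D \<longleftrightarrow> r u < 0"
    and r0: "r 0 = 0" and n0: "n 0 \<noteq> 0" and n_tendsto: "(n \<longlongrightarrow> n 0) (at 0)"
    and expansion: "\<And>\<epsilon>. 0 < \<epsilon> \<Longrightarrow> \<exists>\<delta>>0. \<forall>u v. norm u < \<delta> \<longrightarrow> norm v < \<delta> \<longrightarrow>
       \<bar>r v - r u - inner (n u) (v - u) - (norm (v - u))\<^sup>2\<bar> \<le> \<epsilon> * (norm (v - u))\<^sup>2"
begin

lemma Gam_G: "u \<in> N \<Longrightarrow> Gam (G u) = u" and G_Gam: "x \<in> V \<Longrightarrow> G (Gam x) = x"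
  and G_in: "u \<in> N \<Longrightarrow> G u \<in> V" and Gam_in: "x \<in> V \<Longrightarrow> Gam x \<in> N"
  and Gam_cont: "continuous_on V Gam" and G_cont: "continuous_on N G"
  using homeo by (auto simp: homeomorphism_def)

text \<open>Minus the complex linear function whose real part is the differential of \<open>r\<close> at the origin. The quadratic term of
\<open>r\<close> makes \<open>Re (peak u)\<close> positive on the part of the domain near the origin.\<close>

definition peak :: "complex ^ 'n \<Rightarrow> complex" where
  "peak u = - herm u (n 0)"

lemma Re_peak_le: "Re (peak u) \<le> norm u * norm (n 0)"
  and norm_peak_le: "cmod (peak u) \<le> norm u * norm (n 0)"
proof -
  show "cmod (peak u) \<le> norm u * norm (n 0)"
    using herm_Cauchy_Schwarz by (simp add: peak_def)
  then show "Re (peak u) \<le> norm u * norm (n 0)"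
    using complex_Re_le_cmod order_trans by blast
qed

lemma peak_radius:
  obtains \<delta> where "0 < \<delta>" "cball 0 \<delta> \<subseteq> N"
    "\<And>u. norm u \<le> \<delta> \<Longrightarrow> r u < 0 \<Longrightarrow> (norm u)\<^sup>2 / 2 < Re (peak u)"
proof -
  obtain d where d: "0 < d" and ex: "\<And>v. norm v < d \<Longrightarrow>
       \<bar>r v - r 0 - inner (n 0) (v - 0) - (norm (v - 0))\<^sup>2\<bar> \<le> 1/2 * (norm (v - 0))\<^sup>2"
    using expansion[of "1/2"] by (metis half_gt_zero_iff norm_zero zero_less_one)
  obtain e where e: "0 < e" "cball 0 e \<subseteq> N"
    using openN N0 open_contains_cball by blast
  show ?thesis
  proof (rule that[of "min (d/2) e"])
    show "cball 0 (min (d/2) e) \<subseteq> N" using e by auto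
    show "(norm u)\<^sup>2 / 2 < Re (peak u)" if "norm u \<le> min (d/2) e" "r u < 0" for u
    proof -
      have "Re (peak u) = - inner (n 0) u" by (simp add: peak_def Re_herm inner_commute)
      moreover have "\<bar>r u - inner (n 0) u - (norm u)\<^sup>2\<bar> \<le> 1/2 * (norm u)\<^sup>2"
        using ex[of u] that d r0 by simp
      ultimately show ?thesis using that(2) by linarith
    qed
  qed (use d e in auto)
qed

lemma chart_disc_holomorphic:
  assumes "f \<in> holomorphic_discs D"
  shows "(\<lambda>z. Gam (f z) $ i) holomorphic_on {z \<in> ball 0 1. f z \<in> V}"
  using holomorphic_disc_compose[OF assms Gam_hol openV] .

lemma Gam_vimage_open:
  assumes "open W" shows "open {x \<in> V. Gam x \<in> W}"
  using continuous_open_preimage[OF Gam_cont openV assms] by (simp add: vimage_def Int_def)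

lemma Gam_vimage_compact:
  assumes "compact K" "K \<subseteq> N" shows "compact {x \<in> V. Gam x \<in> K}"
proof -
  have "{x \<in> V. Gam x \<in> K} = G ` K"
    using assms Gam_G G_Gam G_in by force
  then show ?thesis
    using assms G_cont compact_continuous_image continuous_on_subset by metis
qed

text \<open>The function \<open>norm (u - u0) * exp (- A * Re (peak u))\<close> is the exponential of a plurisubharmonic function with pole
\<open>u0\<close>. On the sphere of radius \<open>\<delta>\<close> the factor \<open>exp\<close> is at most \<open>exp (- A * \<delta>\<^sup>2 / 2)\<close>, whereas on a much smaller sphere of radius
\<open>\<delta>'\<close> it is at least \<open>exp (- A * \<delta>' * norm (n 0))\<close>. If \<open>\<delta>' * norm (n 0)\<close> is less than \<open>\<delta>\<^sup>2 / 2\<close> and \<open>A\<close> is large, this outweighs the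
factor \<open>\<delta>' / \<delta>\<close> between the norms.\<close>

lemma pole_barrier:
  assumes \<delta>: "0 < \<delta>" "cball 0 \<delta> \<subseteq> N"
    and pk: "\<And>u. norm u \<le> \<delta> \<Longrightarrow> r u < 0 \<Longrightarrow> (norm u)\<^sup>2 / 2 < Re (peak u)"
  obtains \<delta>' A \<beta> where "0 < \<delta>'" "\<delta>' < \<delta>" "0 < A" "0 < \<beta>" "\<beta> \<le> 2 * \<delta>"
    "\<And>u0 u. norm u0 < \<delta>' / 2 \<Longrightarrow> norm u = \<delta>' \<Longrightarrow> \<beta> < norm (u - u0) * exp (- A * Re (peak u))"
    "\<And>u0 u. norm u0 < \<delta>' / 2 \<Longrightarrow> norm u = \<delta> \<Longrightarrow> r u < 0 \<Longrightarrow>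
        norm (u - u0) * exp (- A * Re (peak u)) < \<beta>"
    "\<And>u0 u. norm u0 < \<delta>' / 2 \<Longrightarrow> norm u \<le> \<delta> \<Longrightarrow> r u < 0 \<Longrightarrow>
        norm (u - u0) * exp (- A * Re (peak u)) \<le> 2 * \<delta>"
proof -
  define c where "c = norm (n 0)"
  have c: "0 < c" using n0 by (simp add: c_def)
  define d where "d = min (\<delta> / 2) (\<delta>\<^sup>2 / (8 * c))"
  have d: "0 < d" "d \<le> \<delta> / 2" "d * c \<le> \<delta>\<^sup>2 / 8"
  proof -
    have "d \<le> \<delta>\<^sup>2 / (8 * c)" by (simp add: d_def)
    then show "d * c \<le> \<delta>\<^sup>2 / 8" using c by (simp add: field_simps)
  qed (use \<delta> c in \<open>auto simp: d_def\<close>)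
  define A where "A = 16 / (d * \<delta>)"
  have A: "0 < A" using d \<delta> by (simp add: A_def)
  define \<beta> where "\<beta> = 3 / 2 * \<delta> * exp (- A * (\<delta>\<^sup>2 / 2))"
  have exp1: "exp (- A * x) \<le> 1" if "0 \<le> x" for x using that A by simp
  have near: "norm (u - u0) \<le> norm u + d / 2" "norm u - d / 2 < norm (u - u0)" 
    if "norm u0 < d / 2" for u u0 :: "complex ^ 'n"
    using norm_triangle_ineq4[of u u0] norm_triangle_ineq2[of u u0] that by linarith+
  show ?thesis
  proof (rule that[of d A \<beta>])
    show "0 < \<beta>" using \<delta> by (simp add: \<beta>_def)
    show "\<beta> \<le> 2 * \<delta>"
    proof -
      have "\<beta> \<le> 3 / 2 * \<delta> * 1"
        unfolding \<beta>_def using exp1[of "\<delta>\<^sup>2 / 2"] \<delta> by (intro mult_left_mono) auto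
      then show ?thesis using \<delta> by simp
    qed
  next
    fix u0 u :: "complex ^ 'n" assume u0: "norm u0 < d / 2" and u: "norm u = d"
    have "4 * \<delta> / d = A * (\<delta>\<^sup>2 / 4)" using d \<delta> by (simp add: A_def power2_eq_square)
    also have "\<dots> \<le> A * (\<delta>\<^sup>2 / 2 - d * c)"
      using d(3) A zero_le_power2[of \<delta>] by (intro mult_left_mono) linarith+
    also have "\<dots> < exp (A * (\<delta>\<^sup>2 / 2 - d * c))"
      using exp_ge_add_one_self[of "A * (\<delta>\<^sup>2 / 2 - d * c)"] by linarith
    finally have "4 * \<delta> / d < exp (- A * (d * c)) * exp (A * (\<delta>\<^sup>2 / 2))"
      by (simp add: exp_add[symmetric] algebra_simps)
    then have "4 * \<delta> / d * exp (- A * (\<delta>\<^sup>2 / 2)) <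
        exp (- A * (d * c)) * exp (A * (\<delta>\<^sup>2 / 2)) * exp (- A * (\<delta>\<^sup>2 / 2))"
      by (intro mult_strict_right_mono) auto
    also have "\<dots> = exp (- A * (d * c))" by (simp add: mult.assoc exp_add[symmetric])
    finally have "4 * \<delta> / d * exp (- A * (\<delta>\<^sup>2 / 2)) < exp (- A * (d * c))" .
    then have "d / 2 * (4 * \<delta> / d * exp (- A * (\<delta>\<^sup>2 / 2))) < d / 2 * exp (- A * (d * c))"
      using d by (intro mult_strict_left_mono) auto
    then have "2 * \<delta> * exp (- A * (\<delta>\<^sup>2 / 2)) < d / 2 * exp (- A * (d * c))" using d by simp
    moreover have "3 / 2 * \<delta> * exp (- A * (\<delta>\<^sup>2 / 2)) \<le> 2 * \<delta> * exp (- A * (\<delta>\<^sup>2 / 2))"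
      using \<delta> by (intro mult_right_mono) auto
    ultimately have "\<beta> < d / 2 * exp (- A * (d * c))" by (simp add: \<beta>_def)
    also have "\<dots> \<le> norm (u - u0) * exp (- A * Re (peak u))"
    proof (rule mult_mono)
      show "d / 2 \<le> norm (u - u0)" using near(2)[OF u0, of u] u by simp
      show "exp (- A * (d * c)) \<le> exp (- A * Re (peak u))"
        using Re_peak_le[of u] A u by (simp add: c_def)
    qed auto
    finally show "\<beta> < norm (u - u0) * exp (- A * Re (peak u))" .
  next
    fix u0 u :: "complex ^ 'n" assume u0: "norm u0 < d / 2" and u: "norm u = \<delta>" "r u < 0"
    have "norm (u - u0) * exp (- A * Re (peak u)) \<le> (3 / 2 * \<delta>) * exp (- A * Re (peak u))"
      using near(1)[OF u0, of u] u d by (intro mult_right_mono) auto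
    also have "\<dots> < 3 / 2 * \<delta> * exp (- A * (\<delta>\<^sup>2 / 2))"
      using pk[of u] u \<delta> A by (intro mult_strict_left_mono) auto
    finally show "norm (u - u0) * exp (- A * Re (peak u)) < \<beta>" by (simp add: \<beta>_def)
  next
    fix u0 u :: "complex ^ 'n" assume u0: "norm u0 < d / 2" and u: "norm u \<le> \<delta>" "r u < 0"
    have "0 \<le> Re (peak u)" using pk[OF u] by (smt (verit) zero_le_power2 divide_nonneg_pos)
    then have "norm (u - u0) * exp (- A * Re (peak u)) \<le> norm (u - u0) * 1"
      using exp1 by (intro mult_left_mono) auto
    then show "norm (u - u0) * exp (- A * Re (peak u)) \<le> 2 * \<delta>"
      using near(1)[OF u0, of u] u d by simp
  qed (use d A \<delta> in auto)
qed

text \<open>The bounds of \<open>pole_barrier\<close> allow the function there to be glued with the constant \<open>\<beta>\<close>, by taking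
maxima between the two spheres, to a continuous function \<open>U\<close> on the whole domain which is bounded by
\<open>2 * \<delta>\<close>, vanishes at the centre of the disc, and locally has a modulus of a holomorphic function as
support from below. The maximum principle is applied to \<open>(U (f w))\<^sup>2 / cmod w\<close>, which extends by \<open>0\<close> to the
origin because \<open>U (f w)\<close> vanishes there to first order; using the square avoids having to divide out the zero of
\<open>f - f 0\<close>. It gives \<open>U (f z) < \<beta>\<close> for small \<open>z\<close>, and \<open>U < \<beta>\<close> holds only near the boundary point.\<close>

lemma disc_localization:
  assumes \<delta>: "0 < \<delta>" "cball 0 \<delta> \<subseteq> N"
    and pk: "\<And>u. norm u \<le> \<delta> \<Longrightarrow> r u < 0 \<Longrightarrow> (norm u)\<^sup>2 / 2 < Re (peak u)"
  obtains s \<eta> where "0 < s" "s \<le> 1" "0 < \<eta>"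
    "\<And>f z. f \<in> holomorphic_discs D \<Longrightarrow> f 0 \<in> V \<Longrightarrow> norm (Gam (f 0)) < \<eta> \<Longrightarrow> cmod z < s \<Longrightarrow>
       f z \<in> V \<and> norm (Gam (f z)) < \<delta>"
proof -
  obtain d A \<beta> where d: "0 < d" "d < \<delta>" and A: "0 < A" and \<beta>: "0 < \<beta>" "\<beta> \<le> 2 * \<delta>"
    and inner_bd: "\<And>u0 u. norm u0 < d / 2 \<Longrightarrow> norm u = d \<Longrightarrow> \<beta> < norm (u - u0) * exp (- A * Re (peak u))"
    and outer_bd: "\<And>u0 u. norm u0 < d / 2 \<Longrightarrow> norm u = \<delta> \<Longrightarrow> r u < 0 \<Longrightarrow>
        norm (u - u0) * exp (- A * Re (peak u)) < \<beta>"
    and upper: "\<And>u0 u. norm u0 < d / 2 \<Longrightarrow> norm u \<le> \<delta> \<Longrightarrow> r u < 0 \<Longrightarrow>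
        norm (u - u0) * exp (- A * Re (peak u)) \<le> 2 * \<delta>"
    using pole_barrier[OF \<delta> pk] by blast
  define s where "s = min (1/2) (\<beta>\<^sup>2 / (8 * \<delta>\<^sup>2))"
  have s: "0 < s" "s \<le> 1/2" "8 * \<delta>\<^sup>2 * s \<le> \<beta>\<^sup>2"
  proof -
    have "s \<le> \<beta>\<^sup>2 / (8 * \<delta>\<^sup>2)" by (simp add: s_def)
    then show "8 * \<delta>\<^sup>2 * s \<le> \<beta>\<^sup>2" using \<delta> by (simp add: field_simps)
  qed (use \<beta> \<delta> in \<open>auto simp: s_def\<close>)
  have main: "f z \<in> V \<and> norm (Gam (f z)) < \<delta>"
    if f: "f \<in> holomorphic_discs D" and f0: "f 0 \<in> V" "norm (Gam (f 0)) < d / 2" and z: "cmod z < s" for f z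
  proof -
    define u0 where "u0 = Gam (f 0)"
    have u0: "norm u0 < d / 2" using f0 by (simp add: u0_def)
    define e where "e x = norm (Gam x - u0) * exp (- A * Re (peak (Gam x)))" for x
    (* S is where the barrier e is used, W the shell where both alternatives of the maximum are possible,
       and the closed set C contains all points where U may differ from the constant \<beta>; Z is the core, on
       which U may drop below \<beta>. *)
    define S where "S = {x \<in> V. norm (Gam x) < \<delta> \<and> (norm (Gam x) < d \<or> \<beta> < e x)}"
    define W where "W = {x \<in> V. d < norm (Gam x) \<and> norm (Gam x) < \<delta>}"
    define Z where "Z = {x \<in> V. Gam x \<in> cball 0 d}"
    define Q where "Q = {x \<in> V. Gam x \<in> cball 0 \<delta>}"
    define C where "C = {x \<in> Q. norm (Gam x) \<le> d \<or> \<beta> \<le> e x}"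
    have e_cont: "continuous_on V e"
      unfolding e_def peak_def by (intro continuous_intros Gam_cont)
    have "continuous_on V (\<lambda>x. norm (Gam x))" by (intro continuous_intros Gam_cont)
    note cont = this e_cont
    have "open S"
    proof -
      have "open {x \<in> V. norm (Gam x) \<in> {..<d}}" "open {x \<in> V. norm (Gam x) \<in> {..<\<delta>}}"
        "open {x \<in> V. e x \<in> {\<beta><..}}"
        using continuous_open_preimage[OF cont(1) openV, of "{..<d}"]
          continuous_open_preimage[OF cont(1) openV, of "{..<\<delta>}"]
          continuous_open_preimage[OF cont(2) openV, of "{\<beta><..}"]
        by (simp_all add: vimage_def Int_def)
      then have "open ({x \<in> V. norm (Gam x) \<in> {..<\<delta>}} \<inter> ({x \<in> V. norm (Gam x) \<in> {..<d}} \<union> {x \<in> V. e x \<in> {\<beta><..}}))"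
        by (intro open_Int open_Un)
      also have "({x \<in> V. norm (Gam x) \<in> {..<\<delta>}} \<inter> ({x \<in> V. norm (Gam x) \<in> {..<d}} \<union> {x \<in> V. e x \<in> {\<beta><..}})) = S"
        by (auto simp: S_def)
      finally show ?thesis .
    qed
    have "open W"
    proof -
      have "open {x \<in> V. norm (Gam x) \<in> {d<..<\<delta>}}"
        using continuous_open_preimage[OF cont(1) openV, of "{d<..<\<delta>}"] by (simp add: vimage_def Int_def)
      also have "{x \<in> V. norm (Gam x) \<in> {d<..<\<delta>}} = W" by (auto simp: W_def)
      finally show ?thesis .
    qed
    have "cball 0 d \<subseteq> N" using d \<delta> by (meson less_imp_le order_trans subset_cball)
    then have "closed Z"
      unfolding Z_def by (intro compact_imp_closed Gam_vimage_compact) auto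
    have "closed Q"
      unfolding Q_def using \<delta> by (intro compact_imp_closed Gam_vimage_compact) auto
    have "closed C"
    proof -
      have QV: "Q \<subseteq> V" by (auto simp: Q_def)
      have "closed {x \<in> Q. norm (Gam x) \<in> {..d}}" "closed {x \<in> Q. e x \<in> {\<beta>..}}"
        using continuous_closed_preimage[OF continuous_on_subset[OF cont(1) QV] \<open>closed Q\<close>, of "{..d}"]
          continuous_closed_preimage[OF continuous_on_subset[OF cont(2) QV] \<open>closed Q\<close>, of "{\<beta>..}"]
        by (simp_all add: vimage_def Int_def)
      moreover have "C = {x \<in> Q. norm (Gam x) \<in> {..d}} \<union> {x \<in> Q. e x \<in> {\<beta>..}}"
        by (auto simp: C_def)
      ultimately show ?thesis by auto
    qed
    define U where "U x = (if x \<in> S then e x else \<beta>)" for x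
    have rneg: "r (Gam x) < 0" if "x \<in> D" "x \<in> V" for x
      using D_sign[OF Gam_in[OF that(2)]] that G_Gam by simp
    have cover: "x \<in> S \<or> x \<in> W \<or> x \<in> - C" if "x \<in> D" for x
    proof (rule ccontr)
      assume a: "\<not> ?thesis"
      then have x: "x \<in> V" "norm (Gam x) \<le> \<delta>" "norm (Gam x) \<le> d \<or> \<beta> \<le> e x"
        by (auto simp: C_def Q_def)
      have r: "r (Gam x) < 0" using rneg that x by blast
      consider "norm (Gam x) < d" | "norm (Gam x) = d" | "d < norm (Gam x)" "norm (Gam x) < \<delta>"
        | "norm (Gam x) = \<delta>" using x by linarith
      then show False
      proof cases
        case 1 then show ?thesis using a x d by (auto simp: S_def)
      next
        case 2 then show ?thesis using a x d inner_bd[OF u0 2] by (auto simp: S_def e_def)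
      next
        case 3 then show ?thesis using a x by (auto simp: W_def)
      next
        case 4 then show ?thesis using x d outer_bd[OF u0 4 r] by (auto simp: e_def)
      qed
    qed
    have U_S: "U x = e x" if "x \<in> S" for x using that by (simp add: U_def)
    have U_W: "U x = max (e x) \<beta>" if "x \<in> W" for x
      using that by (auto simp: U_def S_def W_def max_def)
    have U_C: "U x = \<beta>" if "x \<in> - C" for x
    proof -
      have "x \<notin> S" using that by (auto simp: S_def C_def Q_def)
      then show ?thesis by (simp add: U_def)
    qed
    have U_Z: "\<beta> \<le> U x" if "x \<notin> Z" for x
      using that by (auto simp: U_def S_def Z_def)
    have U_pos: "0 \<le> U x" for x using \<beta> by (auto simp: U_def e_def)
    have U_le: "U x \<le> 2 * \<delta>" if "x \<in> D" for x
      using \<beta> upper[OF u0] rneg that by (auto simp: U_def S_def e_def)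
    have U_cont: "continuous_on D U"
    proof -
      have SV: "S \<subseteq> V" and WV: "W \<subseteq> V" by (auto simp: S_def W_def)
      have "isCont U x" if "x \<in> D" for x
        using cover[OF that]
      proof (elim disjE)
        assume x: "x \<in> S"
        have "isCont e x" using e_cont openV SV x continuous_on_eq_continuous_at by blast
        then show ?thesis
          using x \<open>open S\<close> U_S by (subst isCont_cong[where g = e]) (auto simp: eventually_nhds)
      next
        assume x: "x \<in> W"
        have "isCont e x" using e_cont openV WV x continuous_on_eq_continuous_at by blast
        then have "isCont (\<lambda>x. max (e x) \<beta>) x" by (intro continuous_intros)
        then show ?thesis
          using x \<open>open W\<close> U_W
          by (subst isCont_cong[where g = "\<lambda>x. max (e x) \<beta>"]) (auto simp: eventually_nhds)
      next
        assume x: "x \<in> - C"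
        have "open (- C)" using \<open>closed C\<close> by auto
        then show ?thesis
          using x U_C by (subst isCont_cong[where g = "\<lambda>x. \<beta>"]) (auto simp: eventually_nhds)
      qed
      then show ?thesis by (simp add: continuous_at_imp_continuous_on)
    qed
    have fD: "f w \<in> D" if "cmod w < 1" for w using f that by (auto simp: holomorphic_discs_def)
    define g where "g w = (U (f w))\<^sup>2 / cmod w" for w
    have fcont: "continuous_on (ball 0 1) f" using holomorphic_disc_continuous[OF f] .
    have holS: "(\<lambda>w. Gam (f w) $ i) holomorphic_on {w \<in> ball 0 1. f w \<in> S}" for i
      by (rule holomorphic_on_subset[OF chart_disc_holomorphic[OF f]]) (auto simp: S_def)
    have openS: "open {w \<in> ball 0 1. f w \<in> S}" using holomorphic_disc_vimage_open[OF f \<open>open S\<close>] .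
    have f0S: "f 0 \<in> S" using f0 d by (auto simp: S_def)
    have g_cont: "continuous_on (cball 0 (1/2)) g"
    proof (rule continuous_at_imp_continuous_on, rule ballI)
      fix w :: complex assume "w \<in> cball 0 (1/2)"
      then have w: "w \<in> ball 0 1" by auto
      show "isCont g w"
      proof (cases "w = 0")
        case False
        have "continuous_on (ball 0 1) (\<lambda>w. U (f w))"
          by (rule continuous_on_compose2[OF U_cont fcont]) (use fD in auto)
        then have "isCont (\<lambda>w. U (f w)) w" using w continuous_on_eq_continuous_at open_ball by blast
        then show ?thesis unfolding g_def using False by (intro continuous_intros) auto
      next
        case True
        have 0: "0 \<in> {w \<in> ball 0 1. f w \<in> S}" using f0S by simp
        (* q bounds g near the origin by products of a factor tending to 0 and a bounded difference quotient. *)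
        define q where "q w = (\<Sum>i\<in>UNIV. cmod (Gam (f w) $ i - u0 $ i) * cmod ((Gam (f w) $ i - u0 $ i) / w))" for w
        have "(q \<longlongrightarrow> (\<Sum>i\<in>UNIV. cmod 0 * cmod (deriv (\<lambda>w. Gam (f w) $ i) 0))) (at 0)"
          unfolding q_def
        proof (intro tendsto_intros)
          fix i
          have der: "((\<lambda>w. Gam (f w) $ i) has_field_derivative deriv (\<lambda>w. Gam (f w) $ i) 0) (at 0)"
            using holomorphic_derivI[OF holS openS 0] by simp
          then show "((\<lambda>w. (Gam (f w) $ i - u0 $ i) / w) \<longlongrightarrow> deriv (\<lambda>w. Gam (f w) $ i) 0) (at 0)"
            by (simp add: has_field_derivative_iff u0_def)
          show "((\<lambda>w. Gam (f w) $ i - u0 $ i) \<longlongrightarrow> 0) (at 0)"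
            using DERIV_isCont[OF der] by (simp add: isCont_def u0_def LIM_zero_iff)
        qed
        then have q0: "(q \<longlongrightarrow> 0) (at 0)" by simp
        have le: "g w \<le> q w" if "w \<in> {w \<in> ball 0 1. f w \<in> S}" for w
        proof -
          have wV: "f w \<in> V" "norm (Gam (f w)) \<le> \<delta>" using that by (auto simp: S_def)
          have "r (Gam (f w)) < 0" using rneg fD wV that by simp
          then have "0 \<le> Re (peak (Gam (f w)))"
            using pk[OF wV(2)] by (smt (verit) zero_le_power2 divide_nonneg_pos)
          then have "exp (- A * Re (peak (Gam (f w)))) \<le> 1" using A by simp
          then have "e (f w) \<le> norm (Gam (f w) - u0) * 1"
            unfolding e_def by (intro mult_left_mono) auto
          then have "(U (f w))\<^sup>2 \<le> (norm (Gam (f w) - u0))\<^sup>2"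
            using U_S[of "f w"] that U_pos[of "f w"] by (intro power_mono) auto
          also have "\<dots> = (\<Sum>i\<in>UNIV. (cmod (Gam (f w) $ i - u0 $ i))\<^sup>2)"
            by (simp add: norm_vec_def L2_set_def sum_nonneg)
          finally have "g w \<le> (\<Sum>i\<in>UNIV. (cmod (Gam (f w) $ i - u0 $ i))\<^sup>2) / cmod w"
            unfolding g_def by (intro divide_right_mono) auto
          also have "\<dots> = q w"
            by (simp add: q_def sum_divide_distrib norm_divide power2_eq_square)
          finally show ?thesis .
        qed
        have "(g \<longlongrightarrow> 0) (at 0)"
        proof (rule tendsto_sandwich[OF _ _ tendsto_const q0])
          show "\<forall>\<^sub>F w in at 0. 0 \<le> g w" by (simp add: g_def)
          show "\<forall>\<^sub>F w in at 0. g w \<le> q w"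
            using le openS 0 unfolding eventually_at_topological by blast
        qed
        then show ?thesis using True by (simp add: isCont_def g_def)
      qed
    qed
    have "g z \<le> 8 * \<delta>\<^sup>2"
    proof (rule max_principle_holomorphic_support[OF _ g_cont])
      fix w :: complex assume "w \<in> ball 0 (1/2)"
      then have w1: "cmod w < 1" by simp
      show "\<exists>h e. 0 < e \<and> h holomorphic_on ball w e \<and> cmod (h w) = g w \<and> (\<forall>x\<in>ball w e. cmod (h x) \<le> g x)"
      proof (cases "w = 0")
        case True
        show ?thesis
          by (rule exI[of _ "\<lambda>_. 0"], rule exI[of _ 1]) (auto simp: True g_def)
      next
        case w0: False
        show ?thesis
        proof (cases "f w \<in> S")
          case True
          have "open ({w \<in> ball 0 1. f w \<in> S} - {0})" using openS by auto
          moreover have "w \<in> {w \<in> ball 0 1. f w \<in> S} - {0}" using True w0 w1 by simp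
          ultimately obtain \<rho> where \<rho>: "0 < \<rho>" "ball w \<rho> \<subseteq> {w \<in> ball 0 1. f w \<in> S} - {0}"
            using openE by blast
          obtain v where v: "herm (Gam (f w) - u0) v = of_real (norm (Gam (f w) - u0))"
            "\<And>y. cmod (herm y v) \<le> norm y" using norming_vector by metis
          define h where "h x = (herm (Gam (f x) - u0) v * exp (of_real (- A) * peak (Gam (f x))))\<^sup>2 / x" for x
          have "(\<lambda>x. (Gam (f x) - u0) $ i) holomorphic_on ball w \<rho>"
            "(\<lambda>x. Gam (f x) $ i) holomorphic_on ball w \<rho>" for i
            using holomorphic_on_subset[OF holS[of i]] \<rho>(2)
            by (auto intro!: holomorphic_intros)
          moreover have nz: "x \<noteq> 0" if "x \<in> ball w \<rho>" for x using that \<rho>(2) by blast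
          ultimately have "h holomorphic_on ball w \<rho>"
            unfolding h_def peak_def
            by (intro holomorphic_intros herm_holomorphic) (auto simp del: mem_ball dest: nz)
          moreover have hx: "cmod (h x) = (cmod (herm (Gam (f x) - u0) v) * exp (- A * Re (peak (Gam (f x)))))\<^sup>2 / cmod x" for x
            by (simp add: h_def norm_mult norm_divide norm_power)
          have "cmod (h w) = g w"
            using True by (simp add: hx v(1) g_def U_S e_def)
          moreover have "cmod (h x) \<le> g x" if "x \<in> ball w \<rho>" for x
          proof -
            have "f x \<in> S" using that \<rho>(2) by auto
            then show ?thesis unfolding hx g_def U_S[OF \<open>f x \<in> S\<close>] e_def
              by (intro divide_right_mono power_mono mult_right_mono v(2)) auto
          qed
          ultimately show ?thesis using \<rho>(1) by blast
        next
          case False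
          have "f w \<notin> Z"
          proof
            assume "f w \<in> Z"
            then have "f w \<in> V" "norm (Gam (f w)) < d \<or> norm (Gam (f w)) = d" by (auto simp: Z_def)
            then show False using False d inner_bd[OF u0, of "Gam (f w)"] by (auto simp: S_def e_def)
          qed
          have "open ({w \<in> ball 0 1. f w \<in> - Z} - {0})"
            using holomorphic_disc_vimage_open[OF f, of "- Z"] \<open>closed Z\<close> by auto
          moreover have "w \<in> {w \<in> ball 0 1. f w \<in> - Z} - {0}" using \<open>f w \<notin> Z\<close> w0 w1 by simp
          ultimately obtain \<rho> where \<rho>: "0 < \<rho>" "ball w \<rho> \<subseteq> {w \<in> ball 0 1. f w \<in> - Z} - {0}"
            using openE by blast
          define h where "h x = (of_real \<beta>)\<^sup>2 / x" for x :: complex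
          have nz: "x \<noteq> 0" if "x \<in> ball w \<rho>" for x using that \<rho>(2) by blast
          have "h holomorphic_on ball w \<rho>"
            unfolding h_def by (intro holomorphic_intros) (auto simp del: mem_ball dest: nz)
          moreover have hx: "cmod (h x) = \<beta>\<^sup>2 / cmod x" for x
            by (simp add: h_def norm_divide norm_power)
          have "cmod (h w) = g w" using False by (simp add: hx g_def U_def)
          moreover have "cmod (h x) \<le> g x" if "x \<in> ball w \<rho>" for x
          proof -
            have "f x \<notin> Z" using that \<rho>(2) by auto
            then show ?thesis unfolding hx g_def using \<beta>
              by (intro divide_right_mono power_mono U_Z) auto
          qed
          ultimately show ?thesis using \<rho>(1) by blast
        qed
      qed
    next
      fix w :: complex assume w: "cmod w = 1/2"
      then have "(U (f w))\<^sup>2 \<le> (2 * \<delta>)\<^sup>2" using U_le U_pos fD by (intro power_mono) auto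
      then show "g w \<le> 8 * \<delta>\<^sup>2" unfolding g_def w by (simp add: power2_eq_square)
    qed (use z s in auto)
    have "U (f z) < \<beta>"
    proof (cases "z = 0")
      case True
      have "U (f 0) = 0" using U_S[OF f0S] by (simp add: e_def u0_def)
      then show ?thesis using True \<beta> by simp
    next
      case False
      then have "(U (f z))\<^sup>2 \<le> 8 * \<delta>\<^sup>2 * cmod z"
        using \<open>g z \<le> 8 * \<delta>\<^sup>2\<close> by (simp add: g_def divide_simps)
      also have "\<dots> < 8 * \<delta>\<^sup>2 * s" using z \<delta> by (intro mult_strict_left_mono) auto
      also have "\<dots> \<le> \<beta>\<^sup>2" by (rule s(3))
      finally show ?thesis using \<beta> by (simp add: power_less_imp_less_base)
    qed
    then have "f z \<in> S" by (auto simp: U_def split: if_splits)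
    then show ?thesis by (simp add: S_def)
  qed
  show ?thesis
    by (rule that[of s "d/2"]) (use main s d in auto)
qed

text \<open>The part over \<open>cmod z \<le> s\<close> of a disc shrinks to the boundary point when the centre of the disc tends to it.\<close>

definition discs_collapse :: "real \<Rightarrow> bool" where
  "discs_collapse s \<longleftrightarrow> (\<forall>\<delta>>0. \<exists>\<eta>>0. \<forall>f z. f \<in> holomorphic_discs D \<longrightarrow> f 0 \<in> V \<longrightarrow> norm (Gam (f 0)) < \<eta> \<longrightarrow>
     cmod z \<le> s \<longrightarrow> f z \<in> V \<and> norm (Gam (f z)) < \<delta>)"

text \<open>On the radius \<open>s\<close> given by localization, \<open>peak\<close> takes values in the right half plane along the disc, so Harnack's
inequality bounds it by its value at the centre, and \<open>Re (peak u) > (norm u)\<^sup>2 / 2\<close> turns this into a bound for \<open>u\<close>.\<close>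

lemma discs_collapse_some: obtains s where "0 < s" "s < 1" "discs_collapse s"
proof -
  obtain \<delta> where \<delta>: "0 < \<delta>" "cball 0 \<delta> \<subseteq> N"
    and pk: "\<And>u. norm u \<le> \<delta> \<Longrightarrow> r u < 0 \<Longrightarrow> (norm u)\<^sup>2 / 2 < Re (peak u)"
    using peak_radius by blast
  obtain s \<eta> where s: "0 < s" "s \<le> 1" and \<eta>: "0 < \<eta>"
    and loc: "\<And>f z. f \<in> holomorphic_discs D \<Longrightarrow> f 0 \<in> V \<Longrightarrow> norm (Gam (f 0)) < \<eta> \<Longrightarrow> cmod z < s \<Longrightarrow>
       f z \<in> V \<and> norm (Gam (f z)) < \<delta>"
    using disc_localization[OF \<delta> pk] by blast
  define c where "c = norm (n 0)"
  have c: "0 < c" using n0 by (simp add: c_def)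
  have "discs_collapse (s / 2)"
    unfolding discs_collapse_def
  proof (intro allI impI)
    fix \<epsilon> :: real assume \<epsilon>: "0 < \<epsilon>"
    define \<kappa> where "\<kappa> = min \<eta> (\<epsilon>\<^sup>2 / (6 * c))"
    have \<kappa>: "0 < \<kappa>" "\<kappa> \<le> \<eta>" "6 * c * \<kappa> \<le> \<epsilon>\<^sup>2"
    proof -
      have "\<kappa> \<le> \<epsilon>\<^sup>2 / (6 * c)" by (simp add: \<kappa>_def)
      then show "6 * c * \<kappa> \<le> \<epsilon>\<^sup>2" using c by (simp add: field_simps)
    qed (use \<epsilon> \<eta> c in \<open>auto simp: \<kappa>_def\<close>)
    have "f z \<in> V \<and> norm (Gam (f z)) < \<epsilon>"
      if f: "f \<in> holomorphic_discs D" "f 0 \<in> V" "norm (Gam (f 0)) < \<kappa>" and z: "cmod z \<le> s / 2" for f z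
    proof -
      have in_V: "f w \<in> V" "norm (Gam (f w)) < \<delta>" "w \<in> ball 0 1" "r (Gam (f w)) < 0" if "cmod w < s" for w
      proof -
        show *: "f w \<in> V" "norm (Gam (f w)) < \<delta>" "w \<in> ball 0 1"
          using loc[of f w] f \<kappa> that s by auto
        have "f w \<in> D" using f(1) *(3) by (auto simp: holomorphic_discs_def)
        then show "r (Gam (f w)) < 0"
          using D_sign[OF Gam_in[OF *(1)]] G_Gam[OF *(1)] by simp
      qed
      have pos: "(norm (Gam (f w)))\<^sup>2 / 2 < Re (peak (Gam (f w)))" if "cmod w < s" for w
        using pk in_V that by (simp add: less_imp_le)
      have "(\<lambda>w. Gam (f w) $ i) holomorphic_on ball 0 s" for i
        using holomorphic_on_subset[OF chart_disc_holomorphic[OF f(1)]] in_V by (simp add: subset_iff)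
      then have "(\<lambda>w. peak (Gam (f w))) holomorphic_on ball 0 s"
        unfolding peak_def by (intro holomorphic_intros herm_holomorphic)
      then have "cmod (peak (Gam (f z))) \<le> 3 * cmod (peak (Gam (f 0)))"
      proof (rule half_plane_Harnack[OF s(1) _ _ z])
        show "0 < Re (peak (Gam (f w)))" if "cmod w < s" for w
          using pos[OF that] by (smt (verit) zero_le_power2 divide_nonneg_pos)
      qed
      also have "\<dots> \<le> 3 * (norm (Gam (f 0)) * c)"
        using norm_peak_le by (simp add: c_def)
      also have "\<dots> \<le> 3 * (\<kappa> * c)" using f c by simp
      finally have "(norm (Gam (f z)))\<^sup>2 / 2 < 3 * (\<kappa> * c)"
        using pos[of z] z s complex_Re_le_cmod[of "peak (Gam (f z))"] by linarith
      then have "(norm (Gam (f z)))\<^sup>2 < \<epsilon>\<^sup>2" using \<kappa> by (simp add: mult.commute mult.left_commute)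
      then have "norm (Gam (f z)) < \<epsilon>" using \<epsilon> by (simp add: power_less_imp_less_base)
      then show ?thesis using in_V[of z] z s by simp
    qed
    then show "\<exists>\<eta>>0. \<forall>f z. f \<in> holomorphic_discs D \<longrightarrow> f 0 \<in> V \<longrightarrow> norm (Gam (f 0)) < \<eta> \<longrightarrow>
       cmod z \<le> s / 2 \<longrightarrow> f z \<in> V \<and> norm (Gam (f z)) < \<epsilon>"
      using \<kappa>(1) by blast
  qed
  then show ?thesis using that[of "s/2"] s by simp
qed

lemma discs_collapse_mono: "discs_collapse s \<Longrightarrow> s' \<le> s \<Longrightarrow> discs_collapse s'"
  unfolding discs_collapse_def by (meson order_trans)

text \<open>A point at modulus at most \<open>(s + s1) / (1 + s * s1)\<close> is reached from the centre by a point of modulus at most \<open>s\<close> on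
the same radius and then by a pseudohyperbolic step of length at most \<open>s1\<close>; moving the centre to the intermediate point
reduces the claim to the two hypotheses.\<close>

lemma discs_collapse_add:
  assumes s: "discs_collapse s" "0 < s" "s < 1" and s1: "discs_collapse s1" "0 < s1" "s1 < 1"
  shows "discs_collapse ((s + s1) / (1 + s * s1))"
  unfolding discs_collapse_def
proof (intro allI impI)
  fix \<epsilon> :: real assume "0 < \<epsilon>"
  then obtain \<kappa> where \<kappa>: "0 < \<kappa>"
    and sh1: "\<And>f z. f \<in> holomorphic_discs D \<Longrightarrow> f 0 \<in> V \<Longrightarrow> norm (Gam (f 0)) < \<kappa> \<Longrightarrow> cmod z \<le> s1 \<Longrightarrow>
      f z \<in> V \<and> norm (Gam (f z)) < \<epsilon>" using s1(1) unfolding discs_collapse_def by meson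
  have "0 < min \<kappa> \<epsilon>" using \<kappa> \<open>0 < \<epsilon>\<close> by simp
  then obtain \<eta> where \<eta>: "0 < \<eta>"
    and sh: "\<And>f z. f \<in> holomorphic_discs D \<Longrightarrow> f 0 \<in> V \<Longrightarrow> norm (Gam (f 0)) < \<eta> \<Longrightarrow> cmod z \<le> s \<Longrightarrow>
      f z \<in> V \<and> norm (Gam (f z)) < min \<kappa> \<epsilon>" using s(1) unfolding discs_collapse_def by meson
  have "f z \<in> V \<and> norm (Gam (f z)) < \<epsilon>"
    if f: "f \<in> holomorphic_discs D" "f 0 \<in> V" "norm (Gam (f 0)) < \<eta>"
      and z: "cmod z \<le> (s + s1) / (1 + s * s1)" for f z
  proof (cases "cmod z \<le> s")
    case True then show ?thesis using sh[OF f] by auto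
  next
    case False
    have p: "0 < 1 + s * s1" using s s1 by (simp add: add_pos_pos)
    have "(s + s1) / (1 + s * s1) < 1"
    proof -
      have "0 < (1 - s) * (1 - s1)" using s s1 by simp
      then show ?thesis using p by (simp add: algebra_simps)
    qed
    then have z1: "cmod z < 1" using z by simp
    define a where "a = of_real (s / cmod z) * z"
    have z0: "0 < cmod z" using False s by linarith
    have a: "cmod a = s" using z0 s by (simp add: a_def norm_mult norm_divide)
    have a1: "cmod a < 1" using a s by simp
    define y where "y = (z - a) / (1 - cnj a * z)"
    have "cnj a * z = of_real (s / cmod z) * (z * cnj z)" by (simp add: a_def)
    also have "\<dots> = of_real (s / cmod z * (cmod z)\<^sup>2)"
      by (simp only: complex_norm_square[symmetric] of_real_mult)
    also have "s / cmod z * (cmod z)\<^sup>2 = s * cmod z" using z0 by (simp add: power2_eq_square)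
    finally have "cnj a * z = of_real (s * cmod z)" .
    then have "1 - cnj a * z = of_real (1 - s * cmod z)" by simp
    moreover have "s * cmod z < 1" using s z1 z0 by (smt (verit) mult_less_cancel_left2)
    ultimately have den: "cmod (1 - cnj a * z) = 1 - s * cmod z"
      by (simp only: norm_of_real)
    have "z - a = of_real (1 - s / cmod z) * z" by (simp add: a_def algebra_simps)
    then have "cmod (z - a) = \<bar>1 - s / cmod z\<bar> * cmod z" by (simp only: norm_mult norm_of_real)
    also have "\<dots> = cmod z - s" using z0 False by (simp add: abs_if divide_simps algebra_simps)
    finally have "cmod y = (cmod z - s) / (1 - s * cmod z)"
      using den by (simp add: y_def norm_divide)
    also have "\<dots> \<le> s1"
    proof -
      have "cmod z * (1 + s * s1) \<le> s + s1" using z p by (simp add: pos_le_divide_eq)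
      then show ?thesis using \<open>s * cmod z < 1\<close> by (simp add: divide_simps algebra_simps)
    qed
    finally have y: "cmod y \<le> s1" .
    let ?g = "\<lambda>w. f (disc_shift a w)"
    have "?g 0 \<in> V" "norm (Gam (?g 0)) < \<kappa>"
      using sh[OF f, of a] a disc_shift(2)[OF a1] by auto
    then have "?g y \<in> V \<and> norm (Gam (?g y)) < \<epsilon>"
      using sh1[OF holomorphic_disc_shift[OF f(1) a1] _ _ y] by blast
    then show ?thesis using disc_shift(4)[OF a1 z1] by (simp add: y_def)
  qed
  then show "\<exists>\<eta>>0. \<forall>f z. f \<in> holomorphic_discs D \<longrightarrow> f 0 \<in> V \<longrightarrow> norm (Gam (f 0)) < \<eta> \<longrightarrow>
      cmod z \<le> (s + s1) / (1 + s * s1) \<longrightarrow> f z \<in> V \<and> norm (Gam (f z)) < \<epsilon>"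
    using \<eta> by blast
qed

text \<open>Under \<open>s \<mapsto> (s + s1) / (1 + s * s1)\<close> the distance of \<open>s\<close> to \<open>1\<close> shrinks at least by the factor \<open>1 - s1\<close>.\<close>

lemma discs_collapse_all:
  assumes "s < 1" shows "discs_collapse s"
proof -
  obtain s1 where s1: "0 < s1" "s1 < 1" "discs_collapse s1" using discs_collapse_some by blast
  have "\<exists>t. discs_collapse t \<and> 0 < t \<and> t < 1 \<and> 1 - t \<le> (1 - s1) ^ k" for k
  proof (induction k)
    case 0 then show ?case using s1 by auto
  next
    case (Suc k)
    then obtain t where t: "discs_collapse t" "0 < t" "t < 1" "1 - t \<le> (1 - s1) ^ k" by blast
    define t' where "t' = (t + s1) / (1 + t * s1)"
    have p: "1 < 1 + t * s1" using t s1 by simp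
    have eq: "1 - t' = (1 - t) * (1 - s1) / (1 + t * s1)"
      using p by (simp add: t'_def field_simps)
    have pos: "0 < (1 - t) * (1 - s1)" using t s1 by simp
    have "1 - t' \<le> (1 - t) * (1 - s1)" unfolding eq
      using mult_left_mono[of 1 "1 + t * s1" "(1 - t) * (1 - s1)"] pos p
      by (simp add: pos_divide_le_eq)
    also have "\<dots> \<le> (1 - s1) ^ k * (1 - s1)" using t s1 by (intro mult_right_mono) auto
    finally have "1 - t' \<le> (1 - s1) ^ Suc k" by (simp add: mult.commute)
    moreover have "0 < t'" unfolding t'_def using t s1 p by (intro divide_pos_pos) linarith+
    moreover have "0 < 1 - t'" unfolding eq using pos p by simp
    moreover have "discs_collapse t'" unfolding t'_def by (rule discs_collapse_add) (use t s1 in auto)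
    ultimately show ?case by auto
  qed
  moreover obtain k where "(1 - s1) ^ k < 1 - s"
    using real_arch_pow_inv[of "1 - s" "1 - s1"] s1 assms by auto
  ultimately obtain t where "discs_collapse t" "1 - t < 1 - s" by (meson le_less_trans)
  then show ?thesis using discs_collapse_mono by simp
qed

end

section \<open>Lower bound for the Fridman invariant\<close>

text \<open>A bound in one direction suffices because the Lempert function is symmetric; the absolute difference of the values of
a function is always a pseudodistance.\<close>

lemma kobayashi_ge:
  fixes rho :: "complex ^ 'n::finite \<Rightarrow> real"
  assumes lip: "\<And>x y. x \<in> D \<Longrightarrow> y \<in> D \<Longrightarrow> ereal (rho y - rho x) \<le> lempert D x y"
  shows "ereal \<bar>rho w - rho z\<bar> \<le> kobayashi D z w"
proof -
  define d where "d = (\<lambda>x y. \<bar>rho y - rho x\<bar>)"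
  have "pseudodistance_on D d" by (auto simp: pseudodistance_on_def d_def)
  moreover have "ereal (d x y) \<le> lempert D x y" if "x \<in> D" "y \<in> D" for x y
  proof (cases "rho x \<le> rho y")
    case True then show ?thesis using lip[OF that] by (simp add: d_def)
  next
    case False
    then show ?thesis
      using order_trans[OF lip[OF that(2,1)] lempert_commute_le] by (simp add: d_def)
  qed
  ultimately show ?thesis unfolding kobayashi_def by (intro Sup_upper) (auto simp: d_def)
qed

lemma fridman_ge:
  fixes D :: "(complex ^ 'n::finite) set" and F :: "complex ^ 'n \<Rightarrow> complex ^ 'n"
  assumes "0 < s" "F \<in> holomorphic_maps (ball 0 1) D" "inj_on F (ball 0 1)"
    "kobayashi_ball D z s \<subseteq> F ` ball 0 1"
  shows "tanh s \<le> fridman D z"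
  unfolding fridman_def
proof (rule cSup_upper)
  show "bdd_above (insert 0 {tanh r | r. r > 0 \<and>
       (\<exists>f \<in> holomorphic_maps (ball (0 :: complex ^ 'n) 1) D.
          inj_on f (ball 0 1) \<and> kobayashi_ball D z r \<subseteq> f ` ball 0 1)})"
    by (rule bdd_aboveI[of _ 1]) (auto simp: less_imp_le tanh_real_lt_1)
qed (intro insertI2 CollectI exI[of _ s], use assms in blast)

lemma fridman_le_1: "fridman D z \<le> 1"
  unfolding fridman_def
  by (rule cSup_least) (auto simp: less_imp_le tanh_real_lt_1)

context normal_chart
begin

lemma defining_tendsto_0: "(r \<longlongrightarrow> 0) (at 0)"
proof -
  obtain d where d: "0 < d" and ex: "\<And>v. norm v < d \<Longrightarrow>
       \<bar>r v - r 0 - inner (n 0) (v - 0) - (norm (v - 0))\<^sup>2\<bar> \<le> 1 * (norm (v - 0))\<^sup>2"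
    using expansion[of 1] by (metis norm_zero zero_less_one)
  show ?thesis
  proof (rule tendsto_rabs_zero_cancel, rule tendsto_sandwich[OF _ _ tendsto_const])
    show "((\<lambda>v. norm (n 0) * norm v + 2 * (norm v)\<^sup>2) \<longlongrightarrow> 0) (at 0)"
      by (auto intro!: tendsto_eq_intros)
    have "\<bar>r v\<bar> \<le> norm (n 0) * norm v + 2 * (norm v)\<^sup>2" if "norm v < d" for v
      using ex[OF that] Cauchy_Schwarz_ineq2[of "n 0" v] r0 by simp
    then show "\<forall>\<^sub>F v in at 0. \<bar>r v\<bar> \<le> norm (n 0) * norm v + 2 * (norm v)\<^sup>2"
      unfolding eventually_at using d by (auto simp: dist_norm intro!: exI[of _ d])
  qed auto
qed

text \<open>The function \<open>rho\<close> is defined with the Siegel domain at the base point \<open>z\<close>. If \<open>rho\<close> is below its maximal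
value at the centre of a disc, this centre lies in the ellipsoid \<open>E\<close>, which is so close to the boundary point that the disc
stays in the chart over radius \<open>s\<close>, and the Schwarz-Pick lemma applies to its image under the map to the ball.
If not, \<open>rho\<close> cannot increase along the disc; and for \<open>cmod m \<ge> T\<close> the bound \<open>rho \<le> artanh T / 2\<close> is enough. Applying this with the endpoints interchanged takes care of
the other sign.\<close>

lemma fridman_lower_bound:
  assumes T: "0 < T" "T < 1"
  shows "\<exists>\<eta>>0. \<forall>z\<in>D. z \<in> V \<longrightarrow> norm (Gam z) < \<eta> \<longrightarrow> tanh (artanh T / 2) \<le> fridman D z"
proof -
  define \<kappa> where "\<kappa> = 1 - T\<^sup>2"
  (* The loss \<epsilon> of curvature must be small compared with the gap \<kappa> between T and 1. *)
  define \<epsilon> where "\<epsilon> = \<kappa> / 8"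
  have "T\<^sup>2 < 1" using T by (simp add: abs_square_less_1)
  then have \<kappa>: "0 < \<kappa>" "\<kappa> \<le> 1" and \<epsilon>: "0 < \<epsilon>" "\<epsilon> \<le> 1 / 8" by (auto simp: \<kappa>_def \<epsilon>_def)
  obtain d where d: "0 < d" and ex: "\<And>u v. norm u < d \<Longrightarrow> norm v < d \<Longrightarrow>
       \<bar>r v - r u - inner (n u) (v - u) - (norm (v - u))\<^sup>2\<bar> \<le> \<epsilon> * (norm (v - u))\<^sup>2"
    using expansion[OF \<epsilon>(1)] by blast
  obtain d' where d': "0 < d'" "cball 0 d' \<subseteq> N" using openN N0 open_contains_cball by blast
  define \<delta> where "\<delta> = min d d'"
  have \<delta>: "0 < \<delta>" "\<delta> \<le> d" "\<And>u. norm u < \<delta> \<Longrightarrow> u \<in> N"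
    using d d' by (auto simp: \<delta>_def subset_iff)
  (* For moduli up to T the disc of radius s has distances from the centre at most twice those of the unit disc. *)
  define s where "s = (1 + T\<^sup>2) / 2"
  have s: "T < s" "s < 1"
  proof -
    have "0 < (1 - T)\<^sup>2" using T by simp
    then show "T < s" by (simp add: s_def power2_eq_square algebra_simps)
  qed (use \<open>T\<^sup>2 < 1\<close> in \<open>simp add: s_def\<close>)
  obtain \<eta> where \<eta>: "0 < \<eta>" and shr: "\<And>f z. f \<in> holomorphic_discs D \<Longrightarrow> f 0 \<in> V \<Longrightarrow>
      norm (Gam (f 0)) < \<eta> \<Longrightarrow> cmod z \<le> s \<Longrightarrow> f z \<in> V \<and> norm (Gam (f z)) < \<delta>"
    using discs_collapse_all[OF s(2)] \<delta>(1) unfolding discs_collapse_def by meson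
  define \<mu> where "\<mu> = min \<delta> \<eta> / 4"
  have \<mu>: "0 < \<mu>" "4 * \<mu> \<le> \<delta>" "4 * \<mu> \<le> \<eta>" using \<delta> \<eta> by (auto simp: \<mu>_def)
  define g1 g2 where "g1 = norm (n 0) / 2" and "g2 = 2 * norm (n 0)"
  have g12: "0 < g1" "g1 < norm (n 0)" "norm (n 0) < g2" "0 < g2" using n0 by (auto simp: g1_def g2_def)
  (* K makes the inner ellipsoid so small that discs starting in it stay in the chart;
     \<tau> bounds t, which is the distance of the base point to the boundary to first order. *)
  define K where "K = 4 + g2 / \<mu> + (g2 / \<mu>)\<^sup>2"
  have K: "4 \<le> K" "g2 \<le> \<mu> * K" "g2\<^sup>2 \<le> \<mu>\<^sup>2 * K"
    using \<mu> g12 by (auto simp: K_def field_simps power2_eq_square)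
  define \<tau> where "\<tau> = min (min \<mu> (g1 * \<kappa> / (16 * K))) (min (g1 * \<kappa> / 64) (g1 / (8 * K)))"
  have \<tau>: "0 < \<tau>" using \<mu> g12 \<kappa> K by (auto simp: \<tau>_def)
  have t_small: "t \<le> \<mu>" "16 * K * t \<le> g * \<kappa>" "64 * t < g * \<kappa>" "16 * K * t\<^sup>2 < g\<^sup>2"
    if t: "0 < t" "t < \<tau>" and g: "g1 \<le> g" for t g
  proof -
    have b: "t < \<mu>" "t < g1 * \<kappa> / (16 * K)" "t < g1 * \<kappa> / 64" "t < g1 / (8 * K)"
      using t by (auto simp: \<tau>_def)
    have gk: "g1 * \<kappa> \<le> g * \<kappa>" using g \<kappa> by simp
    show "t \<le> \<mu>" using b by simp
    show "16 * K * t \<le> g * \<kappa>" using b(2) gk K by (simp add: field_simps)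
    show "64 * t < g * \<kappa>" using b(3) gk by simp
    have "8 * K * t < g1" using b(4) K by (simp add: field_simps)
    then have "(8 * K * t)\<^sup>2 < g\<^sup>2" using g t K by (intro power_strict_mono) auto
    moreover have "16 * K * t\<^sup>2 \<le> (8 * K * t)\<^sup>2"
    proof -
      have "(16 * K * t\<^sup>2) * 1 \<le> (16 * K * t\<^sup>2) * K" using K by (intro mult_left_mono) auto
      then have "16 * K * t\<^sup>2 \<le> (16 * K * t\<^sup>2) * K" by simp
      also have "\<dots> \<le> (8 * K * t)\<^sup>2"
        using zero_le_power2[of "K * t"] by (simp add: power2_eq_square mult_ac)
      finally show ?thesis .
    qed
    ultimately show "16 * K * t\<^sup>2 < g\<^sup>2" by linarith
  qed
  have "\<forall>\<^sub>F u in at 0. g1 < norm (n u) \<and> norm (n u) < g2 \<and> - r u < g1 * \<tau>"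
  proof -
    have "((\<lambda>u. norm (n u)) \<longlongrightarrow> norm (n 0)) (at 0)" by (intro tendsto_norm n_tendsto)
    moreover have "((\<lambda>u. - r u) \<longlongrightarrow> - 0) (at 0)" by (intro tendsto_minus defining_tendsto_0)
    ultimately show ?thesis
      using g12 \<tau> order_tendstoD by (intro eventually_conj) (auto simp: order_tendstoD)
  qed
  then obtain \<eta>2 where \<eta>2: "0 < \<eta>2" and ev: "\<And>u. u \<noteq> 0 \<Longrightarrow> norm u < \<eta>2 \<Longrightarrow>
      g1 < norm (n u) \<and> norm (n u) < g2 \<and> - r u < g1 * \<tau>"
    unfolding eventually_at by (auto simp: dist_norm)
  have bound: "tanh (artanh T / 2) \<le> fridman D z"
    if z: "z \<in> D" "z \<in> V" "norm (Gam z) < min \<mu> \<eta>2" for z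
  proof -
    define u0 where "u0 = Gam z"
    have u0: "norm u0 < \<mu>" "norm u0 < \<eta>2" "u0 \<in> N" "G u0 = z" "r u0 < 0"
      using z Gam_in G_Gam D_sign[OF Gam_in[OF z(2)]] by (auto simp: u0_def)
    have "u0 \<noteq> 0" using u0 r0 by auto
    define g where "g = norm (n u0)"
    have g: "g1 < g" "g < g2" "- r u0 < g1 * \<tau>" "0 < g"
      using ev[OF \<open>u0 \<noteq> 0\<close> u0(2)] g12 by (auto simp: g_def)
    (* \<nu> is the inner unit normal of the level set of r through u0. *)
    define \<nu> where "\<nu> = of_real (- 1 / g) *s n u0"
    have \<nu>: "norm \<nu> = 1" using g by (simp add: \<nu>_def norm_smult_vec g_def norm_divide)
    have n_\<nu>: "inner (n u0) x = - g * Re (herm x \<nu>)" for x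
    proof -
      have "herm x \<nu> = of_real (- 1 / g) * herm x (n u0)"
        by (simp only: \<nu>_def herm_smult_right complex_cnj_complex_of_real)
      then show ?thesis using g by (simp add: Re_herm inner_commute)
    qed
    define t where "t = - r u0 / g"
    have t: "0 < t" "t < \<tau>"
    proof -
      show "0 < t" using u0 g by (simp add: t_def divide_neg_pos)
      have "- r u0 < g * \<tau>" using g \<tau> by (smt (verit) mult_right_mono)
      then show "t < \<tau>" using g by (simp add: t_def field_simps)
    qed
    note ts = t_small[OF t less_imp_le[OF g(1)]]
    have expand: "\<bar>r v + g * (Re (herm (v - u0) \<nu>) + t) - (norm (v - u0))\<^sup>2\<bar> \<le> \<epsilon> * (norm (v - u0))\<^sup>2"
      if "norm v < \<delta>" for v
    proof -
      have "g * t = - r u0" using g by (simp add: t_def)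
      then have "r v + g * (Re (herm (v - u0) \<nu>) + t) - (norm (v - u0))\<^sup>2 =
          r v - r u0 - inner (n u0) (v - u0) - (norm (v - u0))\<^sup>2"
        by (simp add: n_\<nu> distrib_left)
      then show ?thesis using ex[of u0 v] that u0 \<mu> \<delta> by simp
    qed
    define X where "X v = Re (herm (v - u0) \<nu>) + t" for v
    define E where "E = {v. (1 + \<epsilon>) * (norm (perp \<nu> (v - u0)))\<^sup>2 +
       K * (cmod (herm (v - u0) \<nu> + of_real t))\<^sup>2 + 4 * t\<^sup>2 < g * X v}"
    define a where "a = (1 - \<epsilon>) / g"
    have a: "0 \<le> a" using g \<epsilon> by (simp add: a_def)
    define \<psi> where "\<psi> v = siegel_map \<nu> t a (v - u0)" for v
    have E_small: "norm v < 4 * \<mu>" if "v \<in> E" for v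
    proof -
      have "g\<^sup>2 \<le> g2\<^sup>2" using g by (intro power_mono) auto
      then have "g\<^sup>2 \<le> \<mu>\<^sup>2 * K" using K by linarith
      then have "norm (v - u0) < 3 * \<mu>"
        using that K g \<mu> t \<epsilon> ts unfolding E_def X_def
        by (intro inner_ellipsoid_small[OF \<nu>, of K \<epsilon> t g]) auto
      then show ?thesis using norm_triangle_sub[of v u0] u0 by linarith
    qed
    have E_neg: "r v < 0" if "v \<in> E" for v
    proof -
      define w p where "w = cmod (herm (v - u0) \<nu> + of_real t)" and "p = (norm (perp \<nu> (v - u0)))\<^sup>2"
      have sq: "(norm (v - u0))\<^sup>2 = (cmod (herm (v - u0) \<nu>))\<^sup>2 + p"
        unfolding p_def by (rule norm_square_split[OF \<nu>])
      have "cmod (herm (v - u0) \<nu>) \<le> w + t"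
        using norm_triangle_ineq4[of "herm (v - u0) \<nu> + of_real t" "of_real t"] t by (simp add: w_def)
      then have "(cmod (herm (v - u0) \<nu>))\<^sup>2 \<le> (w + t)\<^sup>2" by (intro power_mono) auto
      also have "\<dots> \<le> 2 * w\<^sup>2 + 2 * t\<^sup>2"
        using zero_le_power2[of "w - t"] by (simp add: power2_eq_square algebra_simps)
      finally have h: "(cmod (herm (v - u0) \<nu>))\<^sup>2 \<le> 2 * w\<^sup>2 + 2 * t\<^sup>2" .
      have "r v \<le> - g * X v + (1 + \<epsilon>) * (norm (v - u0))\<^sup>2"
        using expand[of v] E_small[OF that] \<mu> unfolding X_def by (simp add: algebra_simps)
      also have "\<dots> = - g * X v + (1 + \<epsilon>) * p + (1 + \<epsilon>) * (cmod (herm (v - u0) \<nu>))\<^sup>2"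
        unfolding sq by (simp add: algebra_simps)
      also have "\<dots> \<le> - g * X v + (1 + \<epsilon>) * p + 2 * (2 * w\<^sup>2 + 2 * t\<^sup>2)"
        using mult_mono[OF _ h, of "1 + \<epsilon>" 2] \<epsilon> by simp
      also have "\<dots> \<le> - g * X v + (1 + \<epsilon>) * p + K * w\<^sup>2 + 4 * t\<^sup>2"
        using mult_right_mono[OF K(1), of "w\<^sup>2"] by simp
      also have "\<dots> < 0" using that by (simp add: E_def w_def p_def)
      finally show ?thesis .
    qed
    have outer: "(1 - \<epsilon>) * (norm (v - u0))\<^sup>2 < g * X v" if "norm v < \<delta>" "r v < 0" for v
      using expand[OF that(1)] that(2) unfolding X_def by (simp add: algebra_simps)
    have X_pos: "0 < X v" and \<psi>_lt: "norm (\<psi> v) < 1" if v: "norm v < \<delta>" "r v < 0" for v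
    proof -
      have "0 \<le> (1 - \<epsilon>) * (norm (v - u0))\<^sup>2" using \<epsilon> by simp
      then show "0 < X v" using outer[OF v] g by (smt (verit) zero_less_mult_pos)
      have "(1 - \<epsilon>) * (norm (perp \<nu> (v - u0)))\<^sup>2 \<le> (1 - \<epsilon>) * (norm (v - u0))\<^sup>2"
        using norm_square_split[OF \<nu>, of "v - u0"] \<epsilon> by (intro mult_left_mono) auto
      then have "a * (norm (perp \<nu> (v - u0)))\<^sup>2 < X v"
        using outer[OF v] g by (simp add: a_def divide_simps mult.commute)
      then show "norm (\<psi> v) < 1"
        unfolding \<psi>_def X_def by (intro siegel_map_in_ball \<nu> t a)
    qed
    have \<psi>_E: "v \<in> E" if v: "norm v < \<delta>" "r v < 0" and le: "norm (\<psi> v) \<le> T" for v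
    proof -
      have "(norm (\<psi> v))\<^sup>2 \<le> 1 - \<kappa>" using power_mono[OF le, of 2] by (simp add: \<kappa>_def)
      then show ?thesis
        using siegel_map_sublevel[OF \<nu> t(1) g(4) \<kappa>, of \<epsilon> K "herm (v - u0) \<nu> + of_real t" "v - u0"]
          X_pos[OF v] \<epsilon> K ts by (simp add: E_def X_def \<psi>_def a_def \<epsilon>_def)
    qed
    define h where "h x = (if x \<in> V \<and> norm (Gam x) < \<delta> then norm (\<psi> (Gam x)) else 1)" for x
    define rho where "rho x = artanh (min (h x) T) / 2" for x
    have neg: "r (Gam x) < 0" if "x \<in> D" "x \<in> V" for x
      using D_sign[OF Gam_in[OF that(2)]] that G_Gam by simp
    have h0: "0 \<le> h x" for x by (simp add: h_def)
    have rho_le: "rho x \<le> artanh T / 2" "0 \<le> rho x" for x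
      using h0[of x] T artanh_mono[of "min (h x) T" T] artanh_nonneg[of "min (h x) T"]
      by (auto simp: rho_def)
    have deep: "x \<in> V" "norm (Gam x) < \<delta>" "Gam x \<in> E" if "x \<in> D" "h x < T" for x
    proof -
      show *: "x \<in> V" "norm (Gam x) < \<delta>" using that T by (auto simp: h_def split: if_splits)
      then show "Gam x \<in> E" using \<psi>_E[of "Gam x"] that neg by (simp add: h_def)
    qed
    have lip: "ereal (rho y - rho x) \<le> lempert D x y" if "x \<in> D" "y \<in> D" for x y
      unfolding lempert_def
    proof (rule Inf_greatest, clarify)
      fix m :: complex and f
      assume m: "m \<in> ball 0 1" and f: "f \<in> holomorphic_discs D" and xy: "x = f 0" "y = f m"
      have m1: "cmod m < 1" using m by simp
      show "ereal (rho (f m) - rho (f 0)) \<le> ereal (artanh (cmod m))"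
      proof (cases "T \<le> h (f 0) \<or> T \<le> cmod m")
        case True
        have "artanh T \<le> artanh (cmod m)" "0 \<le> artanh (cmod m)" "0 \<le> artanh T" if "T \<le> cmod m"
          using artanh_mono[OF _ that] artanh_nonneg T m1 by auto
        moreover have "rho (f 0) = artanh T / 2" if "T \<le> h (f 0)"
          using that by (simp add: rho_def min_def)
        moreover have "0 \<le> artanh (cmod m)" using artanh_nonneg m1 by simp
        ultimately show ?thesis using True rho_le[of "f m"] rho_le[of "f 0"] by auto
      next
        case False
        then have hT: "h (f 0) < T" and mT: "cmod m < T" by auto
        have f0: "f 0 \<in> V" "norm (Gam (f 0)) < \<eta>"
          using deep[of "f 0"] hT that xy E_small[of "Gam (f 0)"] \<mu> by auto
        have inV: "f w \<in> V" "norm (Gam (f w)) < \<delta>" "w \<in> ball 0 1" "r (Gam (f w)) < 0" if "cmod w \<le> s" for w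
        proof -
          show *: "f w \<in> V" "norm (Gam (f w)) < \<delta>" "w \<in> ball 0 1" using shr[OF f f0 that] that s by auto
          have "f w \<in> D" using f *(3) by (auto simp: holomorphic_discs_def)
          then show "r (Gam (f w)) < 0" using neg * by blast
        qed
        obtain e where e: "herm (\<psi> (Gam (f m))) e = of_real (norm (\<psi> (Gam (f m))))"
          "\<And>y. cmod (herm y e) \<le> norm y" using norming_vector by metis
        define k where "k w = herm (\<psi> (Gam (f w))) e" for w
        have holG: "(\<lambda>w. Gam (f w) $ i) holomorphic_on ball 0 s" for i
          by (rule holomorphic_on_subset[OF chart_disc_holomorphic[OF f]]) (use inV in auto)
        have "k holomorphic_on ball 0 s"
        proof -
          have den: "herm (Gam (f w) - u0) \<nu> + 2 * of_real t \<noteq> 0" if "w \<in> ball 0 s" for w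
          proof -
            have "0 < X (Gam (f w))" using X_pos[of "Gam (f w)"] inV[of w] that by simp
            then have "Re (herm (Gam (f w) - u0) \<nu> + 2 * of_real t) > 0" using t by (simp add: X_def)
            then show ?thesis by (metis less_irrefl zero_complex.sel(1))
          qed
          have 1: "(\<lambda>w. (Gam (f w) - u0) $ i) holomorphic_on ball 0 s" for i
            using holG by (auto intro!: holomorphic_intros)
          have 2: "(\<lambda>w. herm (Gam (f w) - u0) \<nu>) holomorphic_on ball 0 s"
            by (intro herm_holomorphic 1)
          have "(\<lambda>w. 1 / (herm (Gam (f w) - u0) \<nu> + 2 * of_real t) *
            (herm (Gam (f w) - u0) \<nu> * herm \<nu> e + of_real (2 * sqrt (a * t)) *
              (herm (Gam (f w) - u0) e - herm (Gam (f w) - u0) \<nu> * herm \<nu> e))) holomorphic_on ball 0 s"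
            by (intro holomorphic_intros herm_holomorphic 1 2) (use den in blast)
          moreover have "k = (\<lambda>w. 1 / (herm (Gam (f w) - u0) \<nu> + 2 * of_real t) *
            (herm (Gam (f w) - u0) \<nu> * herm \<nu> e + of_real (2 * sqrt (a * t)) *
              (herm (Gam (f w) - u0) e - herm (Gam (f w) - u0) \<nu> * herm \<nu> e)))"
            unfolding k_def \<psi>_def siegel_map_def perp_def
            by (simp only: herm_smult_left herm_add_left herm_diff_left[of "v - u0" for v])
          ultimately show ?thesis by simp
        qed
        moreover have "cmod (k w) < 1" if "cmod w < s" for w
          using e(2)[of "\<psi> (Gam (f w))"] \<psi>_lt[of "Gam (f w)"] inV[of w] that by (simp add: k_def)
        moreover have "0 < s" "cmod m < s" using s T mT by auto
        ultimately have "cmod (k m) - cmod (k 0) \<le> cmod m / s * (1 - cmod (k 0) * cmod (k m))"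
          and k1: "cmod (k 0) < 1" "cmod (k m) < 1"
          using Schwarz_Pick_modulus by auto
        moreover have m2: "1 + (cmod m)\<^sup>2 \<le> 2 * s"
          using power_mono[of "cmod m" T 2] mT by (simp add: s_def)
        moreover note artanh_dilate_le_double[OF norm_ge_zero m1 m2]
        ultimately have "artanh (cmod (k m)) \<le> artanh (cmod (k 0)) + 2 * artanh (cmod m)"
          using artanh_le_add[of "cmod (k 0)" "cmod (k m)" "cmod m / s"] \<open>0 < s\<close> by fastforce
        moreover have "h (f m) = cmod (k m)"
          using inV[of m] \<open>cmod m < s\<close> e(1) by (simp add: h_def k_def)
        moreover have "cmod (k 0) \<le> h (f 0)"
          using inV[of 0] \<open>0 < s\<close> e(2) by (simp add: h_def k_def)
        moreover have "artanh (cmod (k 0)) \<le> artanh (h (f 0))"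
          using artanh_mono[of "cmod (k 0)" "h (f 0)"] \<open>cmod (k 0) \<le> h (f 0)\<close> hT T by simp
        moreover have "rho (f 0) = artanh (h (f 0)) / 2" using hT by (simp add: rho_def)
        moreover have "rho (f m) \<le> artanh (h (f m)) / 2"
          using artanh_mono[of "min (h (f m)) T" "h (f m)"] h0[of "f m"] T k1 \<open>h (f m) = cmod (k m)\<close>
          by (simp add: rho_def)
        ultimately show ?thesis by simp
      qed
    qed
    have "rho z = 0"
    proof -
      have "norm (Gam z) < \<delta>" using z(3) \<mu> by simp
      then have "h z = 0" using z by (simp add: h_def \<psi>_def u0_def)
      then show ?thesis using T by (simp add: rho_def)
    qed
    have ball_sub: "w \<in> D \<and> Gam w \<in> E \<and> w \<in> V" if "w \<in> kobayashi_ball D z (artanh T / 2)" for w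
    proof -
      have w: "w \<in> D" "kobayashi D z w < ereal (artanh T / 2)" using that by (auto simp: kobayashi_ball_def)
      have "ereal \<bar>rho w - rho z\<bar> < ereal (artanh T / 2)"
        using order.strict_trans1[OF kobayashi_ge[OF lip] w(2)] .
      then have "rho w < artanh T / 2" using \<open>rho z = 0\<close> by simp
      then have "h w < T" using min_absorb2[of T "h w"] unfolding rho_def by fastforce
      then show ?thesis using deep w by blast
    qed
    (* Centre and semi-axes of the inner ellipsoid come from completing the square in inner_ellipsoid. *)
    define c where "c = u0 + of_real (g / (2 * K) - t) *s \<nu>"
    define R where "R = g\<^sup>2 / (4 * K) - 4 * t\<^sup>2"
    have vc: "v - c = (v - u0) - of_real (g / (2 * K) - t) *s \<nu>" for v by (simp add: c_def)
    have K0: "0 < K" using K by simp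
    have \<epsilon>0: "0 \<le> \<epsilon>" using \<epsilon> by simp
    have R: "0 < R" unfolding R_def using inner_ellipsoid(2)[OF \<nu> K0 \<epsilon>0 ts(4)] .
    have E_eq: "E = {v. (cmod (herm (v - c) \<nu>) / (sqrt R / sqrt K))\<^sup>2 + (norm (perp \<nu> (v - c)) / (sqrt R / sqrt (1 + \<epsilon>)))\<^sup>2 < 1}"
      unfolding E_def X_def vc R_def inner_ellipsoid(1)[OF \<nu> K0 \<epsilon>0 ts(4)] ..
    have "0 < sqrt R / sqrt K" "0 < sqrt R / sqrt (1 + \<epsilon>)" using R K0 \<epsilon> by auto
    then obtain em :: "complex ^ 'n \<Rightarrow> complex ^ 'n" and A :: "complex ^ 'n ^ 'n"
      where em: "\<And>x. (em has_derivative (\<lambda>h. A *v h)) (at x)" "inj em" "em ` ball 0 1 = E"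
      using ellipsoid_affine_image[OF \<nu>, of "sqrt R / sqrt K" "sqrt R / sqrt (1 + \<epsilon>)" c] E_eq by metis
    have EN: "v \<in> N" if "v \<in> E" for v using E_small[OF that] \<delta> \<mu> by (meson less_le_trans)
    show ?thesis
    proof (rule fridman_ge)
      show "0 < artanh T / 2" using artanh_strict_mono[of 0 T] T by simp
      show "(\<lambda>x. G (em x)) \<in> holomorphic_maps (ball 0 1) D"
        unfolding holomorphic_maps_def
      proof (safe)
        fix x :: "complex ^ 'n" assume x: "x \<in> ball 0 1"
        then have xE: "em x \<in> E" using em(3) by blast
        show "G (em x) \<in> D" using D_sign[OF EN[OF xE]] E_neg[OF xE] by blast
        obtain B :: "complex ^ 'n ^ 'n" where "(G has_derivative (\<lambda>h. B *v h)) (at (em x))"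
          using G_hol[OF EN[OF xE]] by blast
        from diff_chain_at[OF em(1) this]
        have "((\<lambda>x. G (em x)) has_derivative (\<lambda>h. (B ** A) *v h)) (at x)"
          by (simp add: o_def matrix_vector_mul_assoc)
        then show "\<exists>A. ((\<lambda>x. G (em x)) has_derivative (*v) A) (at x)" by blast
      qed
      show "inj_on (\<lambda>x. G (em x)) (ball 0 1)"
      proof (rule inj_onI)
        fix x y assume xy: "x \<in> ball 0 1" "y \<in> ball 0 1" "G (em x) = G (em y)"
        then have "em x \<in> N" "em y \<in> N" using em(3) EN by blast+
        then have "em x = em y" using xy(3) Gam_G by metis
        then show "x = y" using em(2) by (simp add: inj_eq)
      qed
      show "kobayashi_ball D z (artanh T / 2) \<subseteq> (\<lambda>x. G (em x)) ` ball 0 1"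
      proof
        fix w assume "w \<in> kobayashi_ball D z (artanh T / 2)"
        then have "Gam w \<in> em ` ball 0 1" "G (Gam w) = w" using ball_sub em(3) G_Gam by auto
        then show "w \<in> (\<lambda>x. G (em x)) ` ball 0 1" by (metis image_iff)
      qed
    qed
  qed
  show ?thesis
    by (rule exI[of _ "min \<mu> \<eta>2"]) (use \<mu> \<eta>2 bound in auto)
qed

lemma fridman_tendsto_1: "(fridman D \<longlongrightarrow> 1) (at (G 0) within D)"
proof (rule order_tendstoI)
  fix b :: real assume "1 < b"
  then show "\<forall>\<^sub>F z in at (G 0) within D. fridman D z < b"
    by (intro always_eventually allI) (rule le_less_trans[OF fridman_le_1])
next
  fix b :: real assume b: "b < 1"
  define c where "c = max b (1/2)"
  have c: "b \<le> c" "0 < c" "c < 1" using b by (auto simp: c_def)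
  define c' where "c' = (1 + c) / 2"
  have c': "c < c'" "0 < c'" "c' < 1" using c by (auto simp: c'_def)
  (* The lower bound tanh (artanh T / 2) then equals c'. *)
  define T where "T = tanh (2 * artanh c')"
  have ac: "0 < artanh c'" using artanh_strict_mono[of 0 c'] c' by simp
  have T: "0 < T" "T < 1" "tanh (artanh T / 2) = c'"
    using ac c' by (auto simp: T_def artanh_tanh_real tanh_artanh_real tanh_real_lt_1)
  obtain \<eta> where \<eta>: "0 < \<eta>" "\<And>z. z \<in> D \<Longrightarrow> z \<in> V \<Longrightarrow> norm (Gam z) < \<eta> \<Longrightarrow> c' \<le> fridman D z"
    using fridman_lower_bound[OF T(1,2)] T(3) by auto
  have "open {x \<in> V. Gam x \<in> ball 0 \<eta>}" by (intro Gam_vimage_open) simp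
  moreover have "G 0 \<in> {x \<in> V. Gam x \<in> ball 0 \<eta>}" using N0 G_in Gam_G \<eta> by simp
  ultimately show "\<forall>\<^sub>F z in at (G 0) within D. b < fridman D z"
    unfolding eventually_at_topological using \<eta>(2) c c' by fastforce
qed

end

section \<open>Existence of normal charts\<close>

text \<open>The derivative of \<open>x \<mapsto> \<rho>' x - \<rho>'' p x\<close> is small near \<open>p\<close>, so this map has a small Lipschitz constant;
integrating along the segment from \<open>x\<close> to \<open>y\<close> gives an error that is uniform in both points.\<close>

lemma C2_two_point_expansion:
  fixes \<rho> :: "'a::euclidean_space \<Rightarrow> real" and \<rho>' :: "'a \<Rightarrow> 'a \<Rightarrow>\<^sub>L real"
    and \<rho>'' :: "'a \<Rightarrow> 'a \<Rightarrow>\<^sub>L 'a \<Rightarrow>\<^sub>L real"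
  assumes U: "open U" "p \<in> U"
    and d1: "\<And>x. x \<in> U \<Longrightarrow> (\<rho> has_derivative blinfun_apply (\<rho>' x)) (at x)"
    and d2: "\<And>x. x \<in> U \<Longrightarrow> (\<rho>' has_derivative blinfun_apply (\<rho>'' x)) (at x)"
    and cont: "continuous_on U \<rho>''" and \<epsilon>: "0 < \<epsilon>"
  shows "\<exists>\<delta>>0. ball p \<delta> \<subseteq> U \<and> (\<forall>x\<in>ball p \<delta>. \<forall>y\<in>ball p \<delta>.
    \<bar>\<rho> y - \<rho> x - \<rho>' x (y - x) - \<rho>'' p (y - x) (y - x) / 2\<bar> \<le> \<epsilon> * (norm (y - x))\<^sup>2)"
proof -
  obtain d1' where d1': "0 < d1'" "ball p d1' \<subseteq> U" using U openE by blast
  obtain d2' where d2': "0 < d2'" "\<And>x. x \<in> U \<Longrightarrow> dist x p < d2' \<Longrightarrow> dist (\<rho>'' x) (\<rho>'' p) < \<epsilon>"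
    using cont U \<epsilon> unfolding continuous_on_iff by metis
  define \<delta> where "\<delta> = min d1' d2'"
  have sub: "ball p \<delta> \<subseteq> U" using d1' by (auto simp: \<delta>_def)
  have lip: "norm (\<rho>' y - \<rho>' x - \<rho>'' p (y - x)) \<le> \<epsilon> * norm (y - x)"
    if xy: "x \<in> ball p \<delta>" "y \<in> ball p \<delta>" for x y
  proof -
    have "norm ((\<rho>' y - \<rho>'' p y) - (\<rho>' x - \<rho>'' p x)) \<le> \<epsilon> * norm (y - x)"
    proof (rule differentiable_bound[where S = "ball p \<delta>" and f' = "\<lambda>x. blinfun_apply (\<rho>'' x - \<rho>'' p)"])
      fix z assume z: "z \<in> ball p \<delta>"
      then have zU: "z \<in> U" using sub by blast
      have "((\<lambda>y. \<rho>' y - \<rho>'' p y) has_derivative (\<lambda>h. \<rho>'' z h - \<rho>'' p h)) (at z)"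
        by (intro has_derivative_diff d2[OF zU] bounded_linear_imp_has_derivative blinfun.bounded_linear_right)
      moreover have "blinfun_apply (\<rho>'' z - \<rho>'' p) = (\<lambda>h. \<rho>'' z h - \<rho>'' p h)"
        by (rule ext) (simp add: blinfun.diff_left)
      ultimately show "((\<lambda>y. \<rho>' y - \<rho>'' p y) has_derivative blinfun_apply (\<rho>'' z - \<rho>'' p)) (at z within ball p \<delta>)"
        by (simp add: has_derivative_at_withinI)
      have "dist z p < d2'" using z by (auto simp: \<delta>_def dist_commute)
      then have "norm (\<rho>'' z - \<rho>'' p) \<le> \<epsilon>" using d2'(2)[OF zU] by (simp add: dist_norm)
      then show "onorm (blinfun_apply (\<rho>'' z - \<rho>'' p)) \<le> \<epsilon>" by (simp add: norm_blinfun.rep_eq)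
    qed (use xy in auto)
    then show ?thesis by (simp add: blinfun.diff_right algebra_simps)
  qed
  have "\<bar>\<rho> y - \<rho> x - \<rho>' x (y - x) - \<rho>'' p (y - x) (y - x) / 2\<bar> \<le> \<epsilon> * (norm (y - x))\<^sup>2"
    if xy: "x \<in> ball p \<delta>" "y \<in> ball p \<delta>" for x y
  proof -
    define h where "h = y - x"
    define c where "c s = x + s *\<^sub>R h" for s
    define \<phi> where "\<phi> s = \<rho> (c s) - s * \<rho>' x h - s\<^sup>2 * (\<rho>'' p h h / 2)" for s
    have c_in: "c s \<in> ball p \<delta>" if "0 \<le> s" "s \<le> 1" for s
    proof -
      have "c s = (1 - s) *\<^sub>R x + s *\<^sub>R y" by (simp add: c_def h_def algebra_simps)
      then show ?thesis using convexD[OF convex_ball[of p \<delta>] xy, of "1 - s" s] that by simp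
    qed
    have "DERIV \<phi> s :> \<rho>' (c s) h - \<rho>' x h - s * \<rho>'' p h h" if "0 \<le> s" "s \<le> 1" for s
    proof -
      have dc: "(c has_derivative (\<lambda>k. k *\<^sub>R h)) (at s)"
        unfolding c_def by (auto intro!: derivative_eq_intros)
      have "((\<lambda>s. \<rho> (c s)) has_derivative (\<lambda>k. \<rho>' (c s) (k *\<^sub>R h))) (at s)"
        using diff_chain_at[OF dc d1] c_in[OF that] sub by (auto simp: o_def)
      then have "DERIV (\<lambda>s. \<rho> (c s)) s :> \<rho>' (c s) h"
      proof -
        have "(\<lambda>k. \<rho>' (c s) (k *\<^sub>R h)) = (*) (\<rho>' (c s) h)"
          by (rule ext) (simp add: blinfun.scaleR_right)
        then show ?thesis
          using \<open>((\<lambda>s. \<rho> (c s)) has_derivative (\<lambda>k. \<rho>' (c s) (k *\<^sub>R h))) (at s)\<close>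
          by (simp only: has_field_derivative_def)
      qed
      then show ?thesis
        unfolding \<phi>_def by (auto intro!: derivative_eq_intros)
    qed
    from MVT2[OF zero_less_one this] obtain s where s: "0 < s" "s < 1"
      and eq: "\<phi> 1 - \<phi> 0 = \<rho>' (c s) h - \<rho>' x h - s * \<rho>'' p h h" by auto
    have "\<rho>' (c s) h - \<rho>' x h - s * \<rho>'' p h h = (\<rho>' (c s) - \<rho>' x - \<rho>'' p (c s - x)) h"
      by (simp add: c_def blinfun.diff_left blinfun.scaleR_left blinfun.scaleR_right)
    then have "\<bar>\<phi> 1 - \<phi> 0\<bar> \<le> norm (\<rho>' (c s) - \<rho>' x - \<rho>'' p (c s - x)) * norm h"
      unfolding eq using norm_blinfun[of "\<rho>' (c s) - \<rho>' x - \<rho>'' p (c s - x)" h] by simp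
    also have "\<dots> \<le> (\<epsilon> * norm (c s - x)) * norm h"
      using lip[OF xy(1) c_in[of s]] s by (intro mult_right_mono) auto
    also have "norm (c s - x) \<le> norm h" using s by (simp add: c_def mult_left_le_one_le)
    then have "(\<epsilon> * norm (c s - x)) * norm h \<le> \<epsilon> * (norm h)\<^sup>2"
      using \<epsilon> by (simp add: power2_eq_square mult_right_mono)
    finally show ?thesis by (simp add: \<phi>_def c_def h_def)
  qed
  then show ?thesis using d1' d2' sub by (intro exI[of _ \<delta>]) (auto simp: \<delta>_def)
qed

lemma ii_smult_ii: "\<i> *s (\<i> *s x) = - (x :: complex ^ 'n::finite)"
  by (simp add: vec_eq_iff)

lemma smult_Re_Im: "c *s x = Re c *\<^sub>R x + Im c *\<^sub>R (\<i> *s (x :: complex ^ 'n::finite))"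
  by (simp add: vec_eq_iff complex_eq_iff)

lemma ii_smult_add: "\<i> *s (x + y) = \<i> *s x + \<i> *s (y :: complex ^ 'n::finite)"
  and ii_smult_scaleR: "\<i> *s (a *\<^sub>R x) = a *\<^sub>R (\<i> *s (x :: complex ^ 'n::finite))"
  by (simp_all add: vec_eq_iff algebra_simps)

lemma real_linear_coordinates:
  fixes m :: "complex ^ 'n::finite \<Rightarrow> real"
  assumes "linear m"
  shows "m v = (\<Sum>k\<in>UNIV. Re (v $ k) * m (axis k 1) + Im (v $ k) * m (axis k \<i>))"
proof -
  have "v = (\<Sum>k\<in>UNIV. Re (v $ k) *\<^sub>R axis k 1 + Im (v $ k) *\<^sub>R axis k \<i>)"
  proof (subst vec_eq_iff, rule allI)
    fix i
    have "(\<Sum>k\<in>UNIV. Re (v $ k) *\<^sub>R axis k 1 + Im (v $ k) *\<^sub>R axis k \<i>) $ i =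
        (\<Sum>k\<in>UNIV. if k = i then v $ k else 0)"
      unfolding sum_component by (intro sum.cong) (auto simp: axis_def complex_eq_iff)
    then show "v $ i = (\<Sum>k\<in>UNIV. Re (v $ k) *\<^sub>R axis k 1 + Im (v $ k) *\<^sub>R axis k \<i>) $ i"
      by simp
  qed
  then have "m v = m (\<Sum>k\<in>UNIV. Re (v $ k) *\<^sub>R axis k 1 + Im (v $ k) *\<^sub>R axis k \<i>)" by simp
  also have "\<dots> = (\<Sum>k\<in>UNIV. Re (v $ k) * m (axis k 1) + Im (v $ k) * m (axis k \<i>))"
    using assms by (simp add: linear_sum linear_add linear_scale)
  finally show ?thesis .
qed

text \<open>The complex linear and the complex antilinear functional with real part \<open>m v\<close>, in coordinates.\<close>

lemma wirtinger_sum: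
  fixes m :: "complex ^ 'n::finite \<Rightarrow> real"
  assumes "linear m"
  shows "(\<Sum>k\<in>UNIV. (of_real (m (axis k 1)) - \<i> * of_real (m (axis k \<i>))) * v $ k)
      = Complex (m v) (- m (\<i> *s v))"
    "(\<Sum>k\<in>UNIV. (of_real (m (axis k 1)) + \<i> * of_real (m (axis k \<i>))) * cnj (v $ k))
      = Complex (m v) (m (\<i> *s v))"
  unfolding real_linear_coordinates[OF assms, of v] real_linear_coordinates[OF assms, of "\<i> *s v"]
  by (simp_all add: complex_eq_iff sum.distrib sum_negf sum_subtractf algebra_simps)

lemma complex_tangent_space_iff:
  assumes "(\<rho> has_derivative blinfun_apply m) (at p)"
  shows "v \<in> complex_tangent_space \<rho> p \<longleftrightarrow> m v = 0 \<and> m (\<i> *s v) = 0"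
proof -
  have "((\<lambda>x. complex_of_real (\<rho> x)) has_derivative (\<lambda>h. of_real (m h))) (at p)"
    using has_derivative_of_real[OF assms] .
  then have fd: "frechet_derivative (\<lambda>x. complex_of_real (\<rho> x)) (at p) = (\<lambda>h. of_real (m h))"
    using frechet_derivative_at by metis
  have "(\<Sum>j\<in>UNIV. wirtinger_dz j (\<lambda>x. complex_of_real (\<rho> x)) p * v $ j)
    = Complex (m v) (- m (\<i> *s v)) / 2"
    unfolding wirtinger_dz_def fd
      wirtinger_sum(1)[OF bounded_linear.linear[OF blinfun.bounded_linear_right], symmetric]
      sum_divide_distrib
    by (intro sum.cong refl) simp
  then show ?thesis by (simp only: complex_tangent_space_def mem_Collect_eq) (simp add: complex_eq_iff)
qed

text \<open>Both Wirtinger derivatives are expressed by the real Hessian \<open>H\<close>, and \<open>wirtinger_sum\<close> is applied once in each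
of its arguments. Up to the factor \<open>1 / 2\<close>, the Levi form is the average of the Hessian over the
rotations of \<open>v\<close> by unimodular numbers.\<close>

lemma levi_form_eq:
  fixes \<rho> :: "complex ^ 'n::finite \<Rightarrow> real"
  assumes "open U" "p \<in> U"
    and d1: "\<And>x. x \<in> U \<Longrightarrow> (\<rho> has_derivative blinfun_apply (\<rho>' x)) (at x)"
    and d2: "(\<rho>' has_derivative blinfun_apply H) (at p)"
  shows "levi_form \<rho> p v = (H v v + H (\<i> *s v) (\<i> *s v)) / 4"
proof -
  have lin: "linear (blinfun_apply m)" for m :: "(complex ^ 'n) \<Rightarrow>\<^sub>L real"
    by (intro bounded_linear.linear blinfun.bounded_linear_right)
  have linH: "linear (\<lambda>h. H h w)" for w
    by (rule bounded_linear.linear) (rule bounded_linear_compose[OF blinfun.bounded_linear_left blinfun.bounded_linear_right])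
  have bar: "wirtinger_dzbar k (\<lambda>x. complex_of_real (\<rho> x)) x =
      (of_real (\<rho>' x (axis k 1)) + \<i> * of_real (\<rho>' x (axis k \<i>))) / 2" if "x \<in> U" for k x
  proof -
    have "((\<lambda>x. complex_of_real (\<rho> x)) has_derivative (\<lambda>h. of_real (\<rho>' x h))) (at x)"
      using has_derivative_of_real[OF d1[OF that]] .
    then have "frechet_derivative (\<lambda>x. complex_of_real (\<rho> x)) (at x) = (\<lambda>h. of_real (\<rho>' x h))"
      using frechet_derivative_at by metis
    then show ?thesis by (simp add: wirtinger_dzbar_def)
  qed
  have der: "((\<lambda>x. wirtinger_dzbar k (\<lambda>x. complex_of_real (\<rho> x)) x) has_derivative
     (\<lambda>h. (of_real (H h (axis k 1)) + \<i> * of_real (H h (axis k \<i>))) / 2)) (at p)" for k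
  proof (rule has_derivative_transform_within_open[OF _ assms(1,2) bar[symmetric]])
    have "((\<lambda>x. \<rho>' x w) has_derivative (\<lambda>h. H h w)) (at p)" for w
      by (rule bounded_linear.has_derivative[OF blinfun.bounded_linear_left d2])
    note der1 = has_derivative_of_real[OF this]
    show "((\<lambda>x. (of_real (\<rho>' x (axis k 1)) + \<i> * of_real (\<rho>' x (axis k \<i>))) / 2) has_derivative
        (\<lambda>h. (of_real (H h (axis k 1)) + \<i> * of_real (H h (axis k \<i>))) / 2)) (at p)"
      by (rule bounded_linear.has_derivative[OF bounded_linear_divide
          has_derivative_add[OF der1 has_derivative_mult_right[OF der1]]])
  qed
  have fd: "frechet_derivative (wirtinger_dzbar k (\<lambda>x. complex_of_real (\<rho> x))) (at p) =
      (\<lambda>h. (of_real (H h (axis k 1)) + \<i> * of_real (H h (axis k \<i>))) / 2)" for k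
    using frechet_derivative_at[OF der[of k]] by simp
  have inner_sum: "(\<Sum>k\<in>UNIV. wirtinger_dz j (wirtinger_dzbar k (\<lambda>x. complex_of_real (\<rho> x))) p * v $ j * cnj (v $ k))
     = (Complex (H (axis j 1) v) (H (axis j 1) (\<i> *s v)) - \<i> * Complex (H (axis j \<i>) v) (H (axis j \<i>) (\<i> *s v))) * v $ j / 4" for j
  proof -
    have "(\<Sum>k\<in>UNIV. wirtinger_dz j (wirtinger_dzbar k (\<lambda>x. complex_of_real (\<rho> x))) p * v $ j * cnj (v $ k))
      = ((\<Sum>k\<in>UNIV. (of_real (H (axis j 1) (axis k 1)) + \<i> * of_real (H (axis j 1) (axis k \<i>))) * cnj (v $ k))
        - \<i> * (\<Sum>k\<in>UNIV. (of_real (H (axis j \<i>) (axis k 1)) + \<i> * of_real (H (axis j \<i>) (axis k \<i>))) * cnj (v $ k)))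
        * v $ j / 4"
      unfolding wirtinger_dz_def fd sum_distrib_left sum_subtractf[symmetric] sum_distrib_right sum_divide_distrib
      by (intro sum.cong refl) (simp add: field_simps)
    then show ?thesis unfolding wirtinger_sum(2)[OF lin] .
  qed
  have "(\<Sum>j\<in>UNIV. (Complex (H (axis j 1) v) (H (axis j 1) (\<i> *s v)) - \<i> * Complex (H (axis j \<i>) v) (H (axis j \<i>) (\<i> *s v))) * v $ j / 4)
    = ((\<Sum>j\<in>UNIV. (of_real (H (axis j 1) v) - \<i> * of_real (H (axis j \<i>) v)) * v $ j)
      + \<i> * (\<Sum>j\<in>UNIV. (of_real (H (axis j 1) (\<i> *s v)) - \<i> * of_real (H (axis j \<i>) (\<i> *s v))) * v $ j)) / 4"
    unfolding sum_distrib_left sum.distrib[symmetric] sum_divide_distrib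
    by (intro sum.cong refl) (simp add: Complex_eq field_simps)
  also have "\<dots> = (Complex (H v v) (- H (\<i> *s v) v) + \<i> * Complex (H v (\<i> *s v)) (- H (\<i> *s v) (\<i> *s v))) / 4"
    unfolding wirtinger_sum(1)[OF linH] ..
  finally have outer_sum: "(\<Sum>j\<in>UNIV. (Complex (H (axis j 1) v) (H (axis j 1) (\<i> *s v)) -
      \<i> * Complex (H (axis j \<i>) v) (H (axis j \<i>) (\<i> *s v))) * v $ j / 4)
    = (Complex (H v v) (- H (\<i> *s v) v) + \<i> * Complex (H v (\<i> *s v)) (- H (\<i> *s v) (\<i> *s v))) / 4" .
  show ?thesis unfolding levi_form_def inner_sum outer_sum by simp
qed

text \<open>Half of a real quadratic form on a complex space is the sum of the real part of a complex quadratic form, which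
changes sign when its argument is multiplied by \<open>\<i>\<close>, and of a Hermitian form, which does not change.\<close>

lemma polarization:
  fixes A :: "complex ^ 'n::finite \<Rightarrow> complex ^ 'n \<Rightarrow> real"
  assumes "bilinear A"
  obtains S h :: "complex ^ 'n \<Rightarrow> complex ^ 'n \<Rightarrow> complex"
  where "\<And>x y z. S (x + y) z = S x z + S y z" "\<And>c x z. S (c *s x) z = c * S x z" "\<And>x z. S z x = S x z"
    "\<And>x. Re (S x x) = (A x x - A (\<i> *s x) (\<i> *s x)) / 4"
    "\<And>x y z. h (x + y) z = h x z + h y z" "\<And>c x z. h (c *s x) z = c * h x z" "\<And>x z. h z x = cnj (h x z)"
    "\<And>x. Re (h x x) = (A x x + A (\<i> *s x) (\<i> *s x)) / 4"
proof -
  define B where "B x y = (A x y + A y x) / 2" for x y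
  note bil = bilinear_ladd[OF assms] bilinear_radd[OF assms] bilinear_lmul[OF assms] bilinear_rmul[OF assms]
    bilinear_lneg[OF assms] bilinear_rneg[OF assms]
  have Badd: "B (x + y) z = B x z + B y z" "B z (x + y) = B z x + B z y" for x y z
    by (simp_all add: B_def bil field_simps)
  have Bsc: "B (a *\<^sub>R x) z = a * B x z" "B z (a *\<^sub>R x) = a * B z x" for a x z
    by (simp_all add: B_def bil field_simps)
  have Bneg: "B (- x) z = - B x z" "B z (- x) = - B z x" for x z
    by (simp_all add: B_def bil field_simps)
  have Bsym: "B x y = B y x" for x y by (simp add: B_def)
  define S where "S x y = Complex ((B x y - B (\<i> *s x) (\<i> *s y)) / 4) (- (B (\<i> *s x) y + B x (\<i> *s y)) / 4)" for x y
  define h where "h x y = Complex ((B x y + B (\<i> *s x) (\<i> *s y)) / 4) ((B x (\<i> *s y) - B (\<i> *s x) y) / 4)" for x y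
  have Sadd: "S (x + y) z = S x z + S y z" and hadd: "h (x + y) z = h x z + h y z" for x y z
    by (simp_all add: S_def h_def Badd ii_smult_add complex_eq_iff field_simps)
  have Ssc: "S (a *\<^sub>R x) z = of_real a * S x z" and hsc: "h (a *\<^sub>R x) z = of_real a * h x z" for a x z
    by (simp_all add: S_def h_def Bsc ii_smult_scaleR complex_eq_iff field_simps)
  have Sii: "S (\<i> *s x) z = \<i> * S x z" and hii: "h (\<i> *s x) z = \<i> * h x z" for x z
    by (simp_all add: S_def h_def ii_smult_ii Bneg complex_eq_iff field_simps)
  show ?thesis
  proof (rule that[of S h])
    show "S (c *s x) z = c * S x z" "h (c *s x) z = c * h x z" for c x z
      unfolding smult_Re_Im[of c x] Sadd hadd Ssc hsc Sii hii
      by (simp_all add: complex_eq_iff)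
    show "S z x = S x z" for x z
      unfolding S_def using Bsym by (simp add: add.commute)
    show "h z x = cnj (h x z)" for x z
      using Bsym[of z x] Bsym[of "\<i> *s z" "\<i> *s x"] Bsym[of z "\<i> *s x"] Bsym[of "\<i> *s z" x]
      unfolding h_def by (simp add: complex_eq_iff field_simps)
    show "S (x + y) z = S x z + S y z" "h (x + y) z = h x z + h y z" for x y z
      by (rule Sadd hadd)+
    show "Re (S x x) = (A x x - A (\<i> *s x) (\<i> *s x)) / 4"
      "Re (h x x) = (A x x + A (\<i> *s x) (\<i> *s x)) / 4" for x
      by (simp_all add: S_def h_def B_def)
  qed
qed

text \<open>Orthonormalization: fewer than \<open>n\<close> linear conditions on a vector of an \<open>n\<close>-dimensional space have a nonzero solution,
because the corresponding square matrix has a zero row and so cannot be injective.\<close>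

lemma hermitian_orthonormal_family:
  fixes h :: "complex ^ 'n::finite \<Rightarrow> complex ^ 'n \<Rightarrow> complex"
  assumes add: "\<And>x y z. h (x + y) z = h x z + h y z" and smult: "\<And>c x z. h (c *s x) z = c * h x z"
    and sym: "\<And>x z. h z x = cnj (h x z)" and pos: "\<And>x. x \<noteq> 0 \<Longrightarrow> 0 < Re (h x x)"
    and "finite (I :: 'n set)"
  shows "\<exists>e. \<forall>i\<in>I. \<forall>j\<in>I. h (e i) (e j) = (if i = j then 1 else 0)"
  using \<open>finite I\<close>
proof (induction I)
  case (insert k I)
  from insert.IH obtain e where "\<forall>i\<in>I. \<forall>j\<in>I. h (e i) (e j) = (if i = j then 1 else 0)" ..
  then have e: "h (e i) (e j) = (if i = j then 1 else 0)" if "i \<in> I" "j \<in> I" for i j using that by simp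
  define L where "L v = (\<chi> i. if i \<in> I then h v (e i) else 0)" for v
  have "L (x + y) = L x + L y" "L (c *s x) = c *s L x" for x y c
    by (simp_all add: L_def vec_eq_iff add smult)
  then obtain A where A: "L = (\<lambda>v. A *v v)" using complex_linear_matrix by blast
  have "L v \<noteq> axis k 1" for v using \<open>k \<notin> I\<close> by (auto simp: L_def vec_eq_iff axis_def)
  then have "\<not> surj ((*v) A)" unfolding A surj_def by metis
  then have "\<not> inj ((*v) A)" using vec.linear_injective_imp_surjective[OF matrix_vector_mul_linear_gen] by blast
  then obtain v where v: "A *v v = 0" "v \<noteq> 0" by (auto simp: vec.inj_iff_eq_0)
  have hv: "h v (e i) = 0" if "i \<in> I" for i
  proof -
    have "L v $ i = 0" using v(1) by (simp add: A)
    then show ?thesis using that by (simp add: L_def)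
  qed
  define c where "c = Re (h v v)"
  have c: "0 < c" using pos v by (simp add: c_def)
  have hvv: "h v v = of_real c"
    using sym[of v v] by (simp add: c_def complex_eq_iff)
  have smult2: "h z (d *s x) = cnj d * h z x" for d x z
    by (metis smult sym complex_cnj_mult)
  define f where "f = of_real (1 / sqrt c) *s v"
  have "h f f = of_real (1 / sqrt c * (1 / sqrt c) * c)"
    by (simp only: f_def smult smult2 hvv complex_cnj_complex_of_real of_real_mult mult.assoc)
  then have ff: "h f f = 1" using c by simp
  have fe: "h f (e i) = 0" "h (e i) f = 0" if "i \<in> I" for i
    using hv[OF that] sym[of "e i" f] sym[of f "e i"] by (simp_all add: f_def smult)
  show ?case
    by (rule exI[of _ "e(k := f)"]) (use e ff fe \<open>k \<notin> I\<close> in auto)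
qed simp

lemma hermitian_diagonalization:
  fixes h :: "complex ^ 'n::finite \<Rightarrow> complex ^ 'n \<Rightarrow> complex"
  assumes add: "\<And>x y z. h (x + y) z = h x z + h y z" and smult: "\<And>c x z. h (c *s x) z = c * h x z"
    and sym: "\<And>x z. h z x = cnj (h x z)" and pos: "\<And>x. x \<noteq> 0 \<Longrightarrow> 0 < Re (h x x)"
  obtains A B :: "complex ^ 'n ^ 'n"
  where "\<And>u. Re (h (A *v u) (A *v u)) = (norm u)\<^sup>2" "B ** A = mat 1" "A ** B = mat 1"
proof -
  obtain e :: "'n \<Rightarrow> complex ^ 'n" where e: "\<And>i j. h (e i) (e j) = (if i = j then 1 else 0)"
  proof -
    have "\<exists>e :: 'n \<Rightarrow> complex ^ 'n. \<forall>i\<in>UNIV. \<forall>j\<in>UNIV. h (e i) (e j) = (if i = j then 1 else 0)"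
      by (rule hermitian_orthonormal_family[OF add smult sym]) (auto intro: pos)
    then obtain e :: "'n \<Rightarrow> complex ^ 'n" where "\<forall>i\<in>UNIV. \<forall>j\<in>UNIV. h (e i) (e j) = (if i = j then 1 else 0)" ..
    then show ?thesis using that[of e] by simp
  qed
  define L where "L u = (\<Sum>i\<in>UNIV. u $ i *s e i)" for u :: "complex ^ 'n"
  have "L (x + y) = L x + L y" "L (c *s x) = c *s L x" for x y c
    by (simp_all add: L_def vec.scale_left_distrib sum.distrib vec.scale_sum_right)
  then obtain A where A: "L = (\<lambda>v. A *v v)" using complex_linear_matrix by blast
  have h0: "h 0 z = 0" for z using add[of 0 0 z] by simp
  have hsum: "h (sum f J) z = (\<Sum>i\<in>J. h (f i) z)" if "finite J" for f z and J :: "'n set"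
    using that by (induction J) (simp_all add: h0 add)
  have hsum2: "h z (sum f J) = (\<Sum>i\<in>J. h z (f i))" if "finite J" for f z and J :: "'n set"
  proof -
    have "h z (sum f J) = cnj (\<Sum>i\<in>J. h (f i) z)" by (subst sym) (simp add: hsum[OF that])
    also have "\<dots> = (\<Sum>i\<in>J. cnj (h (f i) z))" by simp
    also have "\<dots> = (\<Sum>i\<in>J. h z (f i))" by (intro sum.cong refl sym[symmetric])
    finally show ?thesis .
  qed
  have smult2: "h z (d *s x) = cnj d * h z x" for d x z
    by (metis smult sym complex_cnj_mult)
  have "h (L u) (L u) = (\<Sum>i\<in>UNIV. u $ i * cnj (u $ i))" for u
    by (simp add: L_def hsum hsum2 smult smult2 e if_distrib mult.commute cong: if_cong)
  then have eq: "Re (h (A *v u) (A *v u)) = (norm u)\<^sup>2" for u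
    unfolding A using herm_self[of u] by (simp add: herm_def)
  have "A *v x = 0 \<Longrightarrow> x = 0" for x using eq[of x] by (simp add: h0)
  then obtain B where "B ** A = mat 1" using matrix_left_invertible_ker by metis
  then show ?thesis using that eq matrix_left_right_inverse by metis
qed

text \<open>On the compact part of the unit sphere where \<open>L\<close> is not positive, \<open>k\<close> is bounded away from \<open>0\<close>.\<close>

lemma positive_definite_penalty:
  fixes L k :: "'a::euclidean_space \<Rightarrow> real"
  assumes contL: "continuous_on UNIV L" and contk: "continuous_on UNIV k"
    and homL: "\<And>a v. L (a *\<^sub>R v) = a\<^sup>2 * L v" and homk: "\<And>a v. k (a *\<^sub>R v) = a\<^sup>2 * k v"
    and k: "\<And>v. 0 \<le> k v" and pos: "\<And>v. v \<noteq> 0 \<Longrightarrow> k v = 0 \<Longrightarrow> 0 < L v"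
  obtains M where "0 \<le> M" "\<And>v. v \<noteq> 0 \<Longrightarrow> 0 < L v + M * k v"
proof -
  define K where "K = sphere 0 1 \<inter> {v. L v \<le> 0}"
  have "closed {v. L v \<le> 0}" by (intro closed_Collect_le contL continuous_on_const)
  then have "compact K" unfolding K_def by (intro compact_Int_closed) auto
  have "\<exists>M\<ge>0. \<forall>v\<in>K. 0 < L v + M * k v"
  proof (cases "K = {}")
    case False
    obtain w where w: "w \<in> K" "\<And>v. v \<in> K \<Longrightarrow> k w \<le> k v"
      using continuous_attains_inf[OF \<open>compact K\<close> False continuous_on_subset[OF contk]] by blast
    obtain l where l: "l \<in> K" "\<And>v. v \<in> K \<Longrightarrow> L l \<le> L v"
      using continuous_attains_inf[OF \<open>compact K\<close> False continuous_on_subset[OF contL]] by blast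
    have "w \<noteq> 0" "L w \<le> 0" using w by (auto simp: K_def)
    then have "k w \<noteq> 0" using pos[of w] by linarith
    then have kw: "0 < k w" using k[of w] by linarith
    define M where "M = (\<bar>L l\<bar> + 1) / k w"
    have M: "0 \<le> M" using kw by (simp add: M_def)
    have "0 < L v + M * k v" if "v \<in> K" for v
    proof -
      have "\<bar>L l\<bar> + 1 = M * k w" using kw by (simp add: M_def)
      also have "\<dots> \<le> M * k v" using M w(2)[OF that] by (rule mult_left_mono[rotated])
      finally show ?thesis using l(2)[OF that] by linarith
    qed
    then show ?thesis using M by blast
  qed auto
  then obtain M where M: "0 \<le> M" "\<And>v. v \<in> K \<Longrightarrow> 0 < L v + M * k v" by blast
  have "0 < L v + M * k v" if "v \<noteq> 0" for v
  proof -
    define u where "u = (1 / norm v) *\<^sub>R v"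
    have u: "norm u = 1" "v = norm v *\<^sub>R u" using that by (auto simp: u_def)
    have "0 < L u + M * k u"
    proof (cases "L u \<le> 0")
      case True then show ?thesis using M(2)[of u] u by (simp add: K_def)
    next
      case False then show ?thesis using M(1) k[of u] by (smt (verit) mult_nonneg_nonneg)
    qed
    then have "0 < (norm v)\<^sup>2 * (L u + M * k u)" using that by simp
    also have "\<dots> = L v + M * k v"
    proof -
      have "L v = (norm v)\<^sup>2 * L u" "k v = (norm v)\<^sup>2 * k u"
        using homL[of "norm v" u] homk[of "norm v" u] u(2) by simp_all
      then show ?thesis by (simp add: algebra_simps)
    qed
    finally show ?thesis .
  qed
  then show ?thesis using that M(1) by blast
qed

lemma inv_complex_linear:
  fixes f :: "complex ^ 'n::finite \<Rightarrow> complex ^ 'n"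
  assumes "bij f" and f: "f = (\<lambda>h. A *v h)"
  shows "\<exists>B. inv f = (\<lambda>h. B *v h)"
proof (rule complex_linear_matrix)
  have fi: "f (inv f x) = x" and ifx: "inv f (f x) = x" for x
    using assms(1) by (simp_all add: bij_is_surj surj_f_inv_f bij_is_inj)
  have "f (inv f x + inv f y) = x + y" "f (c *s inv f x) = c *s x" for x y c
    using fi by (simp_all add: f matrix_vector_right_distrib vector_scalar_commute)
  then show "inv f (x + y) = inv f x + inv f y" "inv f (c *s x) = c *s inv f x" for x y c
    by (metis ifx)+
qed

lemma smallo_of_bound:
  fixes f g c :: "'a \<Rightarrow> real"
  assumes "(c \<longlongrightarrow> 0) F" "\<forall>\<^sub>F x in F. \<bar>f x\<bar> \<le> c x * g x" "\<And>x. 0 \<le> g x"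
  shows "f \<in> o[F](g)"
proof (rule landau_o.smallI)
  fix \<epsilon> :: real assume "0 < \<epsilon>"
  then have "\<forall>\<^sub>F x in F. c x < \<epsilon>" using assms(1) order_tendstoD(2) by blast
  then show "\<forall>\<^sub>F x in F. norm (f x) \<le> \<epsilon> * norm (g x)"
    using assms(2)
  proof eventually_elim
    case (elim x)
    then have "c x * g x \<le> \<epsilon> * g x" using assms(3) by (intro mult_right_mono) auto
    then show ?case using elim assms(3)[of x] by simp
  qed
qed

lemma frontier_defining_zero:
  assumes "open D" "p \<in> frontier D" "C2_local_defining_function D p U \<rho>"
  shows "\<rho> p = 0"
proof (rule ccontr)
  assume nz: "\<rho> p \<noteq> 0"
  have U: "open U" "p \<in> U" "D \<inter> U = {x \<in> U. \<rho> x < 0}" and C2: "C2_on U \<rho>"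
    using assms(3) by (auto simp: C2_local_defining_function_def)
  have "isCont \<rho> p" using C2 U(2) unfolding C2_on_def by (meson has_derivative_continuous)
  have "p \<notin> D" "p \<in> closure D" using assms by (auto simp: frontier_def interior_open)
  then have "0 < \<rho> p" using nz U by force
  then have "\<forall>\<^sub>F x in nhds p. 0 < \<rho> x"
    using \<open>isCont \<rho> p\<close> order_tendstoD(1) by (metis isCont_def tendsto_nhds_iff)
  moreover have "\<forall>\<^sub>F x in nhds p. x \<in> U" using U eventually_nhds_in_open by blast
  ultimately have "\<forall>\<^sub>F x in nhds p. x \<notin> D"
    by eventually_elim (use U(3) in force)
  then obtain W where "open W" "p \<in> W" "W \<inter> D = {}" unfolding eventually_nhds by blast
  then show False using \<open>p \<in> closure D\<close> by (metis disjoint_iff open_Int_closure_eq_empty)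
qed

text \<open>The chart is \<open>G u = p + T u - Q u u\<close>. Here \<open>T\<close> diagonalizes the Hermitian part of the Hessian \<open>A\<close> of
\<open>\<rho> + M / 2 * \<rho>\<^sup>2\<close>, which the choice of \<open>M\<close> makes positive definite. The quadratic form \<open>Q u u\<close> is a multiple of a vector \<open>e\<close> transversal to the
complex tangent space, chosen such that composing the first derivative of \<open>\<rho>\<close> with it cancels the remaining,
pluriharmonic part of \<open>A\<close>; this is \<open>T_norm\<close>. The inverse function theorem provides the inverse of \<open>G\<close>. The two-point
expansion of \<open>r\<close> follows from that of \<open>\<rho>\<close> by estimating four remainders along the filter of pairs of
points tending to \<open>0\<close>.\<close>

lemma exists_normal_chart:
  fixes D :: "(complex ^ 'n::finite) set"
  assumes openD: "open D" and spc: "strongly_pseudoconvex_point D p"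
  obtains N V G Gam r n where "normal_chart D N V G Gam r n" "G 0 = p"
proof -
  obtain U \<rho> where ldf: "C2_local_defining_function D p U \<rho>"
    and levi: "\<And>v. v \<in> complex_tangent_space \<rho> p \<Longrightarrow> v \<noteq> 0 \<Longrightarrow> levi_form \<rho> p v > 0"
    using spc unfolding strongly_pseudoconvex_point_def by blast
  have fr: "p \<in> frontier D" using spc unfolding strongly_pseudoconvex_point_def by blast
  have \<rho>p: "\<rho> p = 0" using frontier_defining_zero[OF openD fr ldf] .
  have U: "open U" "p \<in> U" and DU: "D \<inter> U = {x \<in> U. \<rho> x < 0}" and C2: "C2_on U \<rho>"
    and grad: "frechet_derivative \<rho> (at p) \<noteq> (\<lambda>v. 0)"
    using ldf by (auto simp: C2_local_defining_function_def)
  obtain \<rho>' :: "complex ^ 'n \<Rightarrow> (complex ^ 'n) \<Rightarrow>\<^sub>L real" and \<rho>''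
    where d1: "\<And>x. x \<in> U \<Longrightarrow> (\<rho> has_derivative blinfun_apply (\<rho>' x)) (at x)"
      and d2: "\<And>x. x \<in> U \<Longrightarrow> (\<rho>' has_derivative blinfun_apply (\<rho>'' x)) (at x)"
      and cont2: "continuous_on U \<rho>''"
    using C2 unfolding C2_on_def by blast
  define m where "m = \<rho>' p"
  define H where "H = \<rho>'' p"
  have frechet: "frechet_derivative \<rho> (at p) = blinfun_apply m"
    using frechet_derivative_at[OF d1[OF U(2)]] by (simp add: m_def)
  obtain x1 where x1: "m x1 \<noteq> 0" using grad unfolding frechet by blast
  define L where "L v = H v v + H (\<i> *s v) (\<i> *s v)" for v
  define k where "k v = (m v)\<^sup>2 + (m (\<i> *s v))\<^sup>2" for v
  have ii_bl: "bounded_linear (\<lambda>v :: complex ^ 'n. \<i> *s v)"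
    by (rule bounded_linear_intro[where K = 1]) (simp_all add: ii_smult_add ii_smult_scaleR norm_smult_vec)
  obtain M where M: "0 \<le> M" "\<And>v. v \<noteq> 0 \<Longrightarrow> 0 < L v + M * k v"
  proof (rule positive_definite_penalty[of L k])
    note ii_cont = linear_continuous_on[OF ii_bl, of UNIV]
    show "continuous_on UNIV L" "continuous_on UNIV k"
      unfolding L_def k_def by (intro continuous_intros ii_cont)+
    show "L (a *\<^sub>R v) = a\<^sup>2 * L v" "k (a *\<^sub>R v) = a\<^sup>2 * k v" for a v
      by (simp_all add: L_def k_def ii_smult_scaleR blinfun.scaleR_left blinfun.scaleR_right
          power_mult_distrib power2_eq_square algebra_simps)
    show "0 \<le> k v" for v by (simp add: k_def)
    show "0 < L v" if "v \<noteq> 0" "k v = 0" for v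
    proof -
      have "m v = 0" "m (\<i> *s v) = 0" using that(2) by (auto simp: k_def sum_power2_eq_zero_iff)
      then have "v \<in> complex_tangent_space \<rho> p"
        using complex_tangent_space_iff[OF d1[OF U(2)]] by (simp add: m_def)
      then have "0 < levi_form \<rho> p v" using levi that by blast
      then show ?thesis using levi_form_eq[OF U d1 d2[OF U(2)]] by (simp add: L_def H_def)
    qed
  qed blast
  define A where "A v w = H v w + M * m v * m w" for v w
  have bilA: "bilinear A"
    unfolding bilinear_def A_def
    by (auto intro!: linearI simp: blinfun.add_left blinfun.add_right blinfun.scaleR_left
        blinfun.scaleR_right algebra_simps)
  obtain S h where Sadd: "\<And>x y z. S (x + y) z = S x z + S y z" and Ssm: "\<And>c x z. S (c *s x) z = c * S x z"
    and Ssym: "\<And>x z. S z x = S x z"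
    and SA: "\<And>x. Re (S x x) = (A x x - A (\<i> *s x) (\<i> *s x)) / 4"
    and hadd: "\<And>x y z. h (x + y) z = h x z + h y z" and hsm: "\<And>c x z. h (c *s x) z = c * h x z"
    and hsym: "\<And>x z. h z x = cnj (h x z)"
    and hA: "\<And>x. Re (h x x) = (A x x + A (\<i> *s x) (\<i> *s x)) / 4"
    using polarization[OF bilA] by blast
  have "0 < Re (h x x)" if "x \<noteq> 0" for x
    using M(2)[OF that] by (simp add: hA A_def L_def k_def power2_eq_square algebra_simps)
  then obtain TA TB :: "complex ^ 'n ^ 'n" where TA: "\<And>u. Re (h (TA *v u) (TA *v u)) = (norm u)\<^sup>2"
    and TB: "TB ** TA = mat 1" "TA ** TB = mat 1"
    using hermitian_diagonalization[of h, OF hadd hsm hsym] by metis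
  define T where "T u = TA *v u" for u
  have T_bl: "bounded_linear T" unfolding T_def by simp
  have T_add: "T (x + y) = T x + T y" and T_sm: "T (c *s x) = c *s T x" for x y c
    by (simp_all add: T_def matrix_vector_right_distrib vector_scalar_commute)
  (* e is the multiple of x1 on which the complex linear functional with real part m takes the value 1. *)
  define e where "e = (1 / Complex (m x1) (- m (\<i> *s x1))) *s x1"
  have m_e: "m (c *s e) = Re c" for c
  proof -
    define lam where "lam v = Complex (m v) (- m (\<i> *s v))" for v
    have lam_sm: "lam (c *s v) = c * lam v" for c v
    proof -
      have m_sm: "m (c *s v) = Re c * m v + Im c * m (\<i> *s v)" for c v
        by (subst smult_Re_Im) (simp add: blinfun.add_right blinfun.scaleR_right)
      have "lam (c *s v) = Complex (m (c *s v)) (- m ((\<i> * c) *s v))" by (simp add: lam_def)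
      also have "\<dots> = c * lam v"
        unfolding m_sm[of c v] m_sm[of "\<i> * c" v] lam_def by (simp add: complex_eq_iff)
      finally show ?thesis .
    qed
    have "lam x1 \<noteq> 0" using x1 by (simp add: lam_def complex_eq_iff)
    then have "lam (c *s e) = c" by (simp add: e_def lam_sm lam_def[symmetric])
    then show ?thesis by (simp add: lam_def complex_eq_iff)
  qed
  define Q where "Q u w = S (T u) (T w) *s e" for u w
  have Q_add: "Q (x + y) z = Q x z + Q y z" "Q z (x + y) = Q z x + Q z y" for x y z
    using Sadd Ssym by (simp_all add: Q_def T_add vec.scale_left_distrib)
  have Q_sm: "Q (c *s x) z = c *s Q x z" "Q z (c *s x) = c *s Q z x" for c x z
    using Ssm Ssym by (simp_all add: Q_def T_sm)
  have scaleR_smult: "a *\<^sub>R x = of_real a *s x" for a and x :: "complex ^ 'n"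
    by (simp add: vec_eq_iff complex_eq_iff)
  have "bilinear Q"
    unfolding bilinear_def
  proof (intro conjI allI linearI)
    show "Q (c *\<^sub>R x) y = c *\<^sub>R Q x y" "Q y (c *\<^sub>R x) = c *\<^sub>R Q y x" for c x y
      by (simp_all only: scaleR_smult Q_sm)
  qed (simp_all add: Q_add)
  then interpret Q: bounded_bilinear Q by (simp add: bilinear_conv_bounded_bilinear)
  define G where "G u = p + T u - Q u u" for u
  define DG where "DG u w = T w - (Q u w + Q w u)" for u w
  have DG_bl: "bounded_linear (DG u)" for u
    unfolding DG_def
    by (intro bounded_linear_sub T_bl bounded_linear_add Q.bounded_linear_right Q.bounded_linear_left)
  have G_der: "(G has_derivative DG u) (at u)" for u
  proof -
    have "((\<lambda>u. p + T u - Q u u) has_derivative (\<lambda>w. 0 + T w - (Q u w + Q w u))) (at u)"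
      by (intro has_derivative_diff has_derivative_add has_derivative_const
          bounded_linear_imp_has_derivative[OF T_bl] Q.FDERIV has_derivative_ident)
    then show ?thesis unfolding G_def DG_def by simp
  qed
  have DG_mat: "\<exists>B. DG u = (\<lambda>w. B *v w)" for u
    by (rule complex_linear_matrix)
       (simp_all add: DG_def T_add Q_add T_sm Q_sm vec.scale_right_diff_distrib vec.scale_right_distrib)
  have G0: "G 0 = p" by (simp add: G_def T_def Q.zero_left)
  have G_cont: "continuous_on UNIV G"
    using G_der by (meson continuous_at_imp_continuous_on has_derivative_continuous)
  have \<rho>_cont: "continuous_on U \<rho>"
    using d1 by (meson continuous_at_imp_continuous_on has_derivative_continuous)
  (* On U1 the functions \<rho> and \<rho> + M / 2 * \<rho>^2 have the same sign. *)
  define U1 where "U1 = {x \<in> U. 0 < 1 + M / 2 * \<rho> x}"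
  have "continuous_on U (\<lambda>x. 1 + M / 2 * \<rho> x)" by (intro continuous_intros \<rho>_cont)
  from continuous_open_preimage[OF this U(1), of "{0<..}"] have "open U1"
    by (simp add: U1_def vimage_def Int_def)
  define U2 where "U2 = {u. G u \<in> U1}"
  have "open U2"
    unfolding U2_def using open_vimage[OF \<open>open U1\<close> G_cont] by (simp add: vimage_def)
  have "0 \<in> U2" using U \<rho>p by (simp add: U2_def U1_def G0)
  define f' where "f' u = Blinfun (DG u)" for u
  have f'_apply: "blinfun_apply (f' u) = DG u" for u
    by (simp add: f'_def bounded_linear_Blinfun_apply[OF DG_bl])
  have f'_cont: "continuous_on U2 f'"
    by (rule continuous_on_blinfun_componentwise)
       (auto simp: f'_apply DG_def intro!: continuous_intros Q.continuous_on)
  have bl_TB: "bounded_linear ((*v) TB)" by simp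
  have "Blinfun ((*v) TB) o\<^sub>L f' 0 = id_blinfun"
    by (rule blinfun_eqI)
       (simp add: f'_apply bounded_linear_Blinfun_apply[OF bl_TB] DG_def Q.zero_left Q.zero_right T_def
         matrix_vector_mul_assoc TB(1))
  then obtain N V Gam g' where N: "open N" "N \<subseteq> U2" "0 \<in> N" "open V" "homeomorphism N V G Gam"
    and Gam: "\<And>y. y \<in> V \<Longrightarrow> (Gam has_derivative (g' y)) (at y)"
      "\<And>y. y \<in> V \<Longrightarrow> g' y = inv (blinfun_apply (f' (Gam y)))"
      "\<And>y. y \<in> V \<Longrightarrow> bij (blinfun_apply (f' (Gam y)))"
    using inverse_function_theorem[OF \<open>open U2\<close> _ f'_cont \<open>0 \<in> U2\<close>, of G] G_der f'_apply by metis
  define r where "r u = \<rho> (G u) + M / 2 * (\<rho> (G u))\<^sup>2" for u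
  define l where "l u w = (1 + M * \<rho> (G u)) * \<rho>' (G u) (DG u w)" for u w
  (* n is the gradient of r, representing the derivative l by the real inner product. *)
  define n where "n u = (\<Sum>b\<in>Basis. l u b *\<^sub>R b)" for u
  have n_inner: "inner (n u) w = l u w" for u w
  proof -
    have "l u w = (\<Sum>b\<in>Basis. (w \<bullet> b) * l u b)"
    proof -
      have bl: "bounded_linear (l u)"
        unfolding l_def
        by (intro bounded_linear_const_mult bounded_linear_compose[OF blinfun.bounded_linear_right DG_bl])
      have "l u w = l u (\<Sum>b\<in>Basis. (w \<bullet> b) *\<^sub>R b)" by (simp add: euclidean_representation)
      also have "\<dots> = (\<Sum>b\<in>Basis. (w \<bullet> b) * l u b)"
        using bounded_linear.linear[OF bl] by (simp add: linear_sum linear_scale)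
      finally show ?thesis .
    qed
    then show ?thesis
      unfolding n_def inner_sum_left inner_scaleR_left by (simp add: mult.commute inner_commute)
  qed
  have \<rho>'_tendsto: "(\<rho>' \<longlongrightarrow> m) (nhds p)" and \<rho>_tendsto: "(\<rho> \<longlongrightarrow> 0) (nhds p)"
    using has_derivative_continuous[OF d2[OF U(2)]] has_derivative_continuous[OF d1[OF U(2)]] \<rho>p
    by (simp_all add: continuous_within m_def tendsto_nhds_iff)
  have G_tendsto: "(G \<longlongrightarrow> p) (nhds 0)"
    using has_derivative_continuous[OF G_der[of 0]] G0 by (simp add: continuous_within tendsto_nhds_iff)
  note \<rho>'G = filterlim_compose[OF \<rho>'_tendsto G_tendsto] and \<rho>G = filterlim_compose[OF \<rho>_tendsto G_tendsto]
  have n_nhds: "(n \<longlongrightarrow> n 0) (nhds 0)"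
  proof -
    have "((\<lambda>u. l u b) \<longlongrightarrow> (1 + M * 0) * m (DG 0 b)) (nhds 0)" for b
      unfolding l_def DG_def
      by (intro tendsto_intros \<rho>'G \<rho>G blinfun.tendsto Q.tendsto filterlim_ident)
    then show ?thesis
      unfolding n_def by (intro tendsto_intros) (simp add: l_def G0 \<rho>p m_def)
  qed
  have T_norm: "(norm w)\<^sup>2 = H (T w) (T w) / 2 + M / 2 * (m (T w))\<^sup>2 - m (Q w w)" for w
  proof -
    have "m (Q w w) = (A (T w) (T w) - A (\<i> *s T w) (\<i> *s T w)) / 4"
      unfolding Q_def m_e SA ..
    moreover have "(norm w)\<^sup>2 = (A (T w) (T w) + A (\<i> *s T w) (\<i> *s T w)) / 4"
      using TA[of w] hA[of "T w"] by (simp add: T_def)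
    ultimately show ?thesis by (simp add: A_def power2_eq_square field_simps)
  qed
  define F :: "((complex ^ 'n) \<times> (complex ^ 'n)) filter" where "F = nhds 0 \<times>\<^sub>F nhds 0"
  define d where "d z = snd z - fst z" for z :: "(complex ^ 'n) \<times> (complex ^ 'n)"
  define nd where "nd z = norm (d z)" for z
  define X Y where "X z = G (fst z)" and "Y z = G (snd z)" for z :: "(complex ^ 'n) \<times> (complex ^ 'n)"
  define W where "W z = Y z - X z" for z
  have fst0: "filterlim fst (nhds 0) F" and snd0: "filterlim snd (nhds 0) F"
    unfolding F_def by (rule filterlim_fst filterlim_snd)+
  have d0: "(d \<longlongrightarrow> 0) F" unfolding d_def using tendsto_diff[OF snd0 fst0] by simp
  have nd0: "(nd \<longlongrightarrow> 0) F" unfolding nd_def using tendsto_norm[OF d0] by simp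
  have X0: "(X \<longlongrightarrow> p) F" and Y0: "(Y \<longlongrightarrow> p) F"
    unfolding X_def Y_def by (rule filterlim_compose[OF G_tendsto] fst0 snd0)+
  have \<rho>X: "((\<lambda>z. \<rho> (X z)) \<longlongrightarrow> 0) F" and \<rho>'X: "((\<lambda>z. \<rho>' (X z)) \<longlongrightarrow> m) F"
    by (rule filterlim_compose[OF \<rho>_tendsto X0] filterlim_compose[OF \<rho>'_tendsto X0])+
  obtain C where C: "0 < C" "\<And>x y. norm (Q x y) \<le> norm x * norm y * C" using Q.pos_bounded by blast
  obtain K where K: "0 < K" "\<And>x. norm (T x) \<le> norm x * K" using bounded_linear.pos_bounded[OF T_bl] by blast
  have W_eq: "W z = DG (fst z) (d z) - Q (d z) (d z)" for z
  proof -
    obtain u v where z: "z = (u, v)" by (cases z)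
    have "Q v v = Q (u + (v - u)) (u + (v - u))" by simp
    also have "\<dots> = Q u u + Q u (v - u) + (Q (v - u) u + Q (v - u) (v - u))" by (simp only: Q_add ac_simps)
    finally have "Q v v = Q u u + Q u (v - u) + (Q (v - u) u + Q (v - u) (v - u))" .
    moreover have "T (v - u) = T v - T u" by (simp add: T_def matrix_vector_mult_diff_distrib)
    ultimately show ?thesis by (simp add: z W_def X_def Y_def d_def G_def DG_def)
  qed
  define c1 where "c1 z = (nd z + 2 * norm (fst z)) * C" for z
  have c10: "(c1 \<longlongrightarrow> 0) F"
  proof -
    have "((\<lambda>z. (nd z + 2 * norm (fst z)) * C) \<longlongrightarrow> (0 + 2 * norm (0 :: complex ^ 'n)) * C) F"
      by (rule tendsto_mult tendsto_add nd0 tendsto_const tendsto_norm fst0)+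
    then show ?thesis unfolding c1_def by simp
  qed
  have W_T: "norm (W z - T (d z)) \<le> c1 z * nd z" for z
  proof -
    have "W z - T (d z) = - (Q (fst z) (d z) + Q (d z) (fst z) + Q (d z) (d z))"
      by (simp add: W_eq DG_def)
    then have "norm (W z - T (d z)) \<le> norm (Q (fst z) (d z)) + norm (Q (d z) (fst z)) + norm (Q (d z) (d z))"
      using norm_triangle_ineq[of "Q (fst z) (d z) + Q (d z) (fst z)" "Q (d z) (d z)"]
        norm_triangle_ineq[of "Q (fst z) (d z)" "Q (d z) (fst z)"] by (simp only: norm_minus_cancel)
    also have "\<dots> \<le> norm (fst z) * nd z * C + nd z * norm (fst z) * C + nd z * nd z * C"
      unfolding nd_def by (intro add_mono C)
    also have "\<dots> = c1 z * nd z" by (simp add: c1_def algebra_simps)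
    finally show ?thesis .
  qed
  have c1_nonneg: "0 \<le> c1 z" and nd_nonneg: "0 \<le> nd z" for z using C by (simp_all add: c1_def nd_def)
  have T_le: "norm (T (d z)) \<le> K * nd z" for z using K(2)[of "d z"] by (simp add: nd_def mult.commute)
  have W_le: "norm (W z) \<le> (K + c1 z) * nd z" for z
    using norm_triangle_sub[of "W z" "T (d z)"] W_T[of z] T_le[of z] by (simp add: algebra_simps)
  have H_le: "\<bar>H x y\<bar> \<le> norm H * norm x * norm y" for x y
    using order_trans[OF norm_blinfun[of "H x" y] mult_right_mono[OF norm_blinfun[of H x] norm_ge_zero]] by simp
  define a where "a z = 1 + M * \<rho> (X z)" for z
  have a1: "(a \<longlongrightarrow> 1) F" unfolding a_def using \<rho>X by (auto intro!: tendsto_eq_intros)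
  (* R1: change of the first derivative, applied to the quadratic part of G; R2: Hessian along the chart instead of along T;
     E: Taylor remainder of \<rho>; R4: the square of the increment of \<rho> against that of its linearization. *)
  define R1 where "R1 z = m (Q (d z) (d z)) - a z * \<rho>' (X z) (Q (d z) (d z))" for z
  define R2 where "R2 z = (a z * H (W z) (W z) - H (T (d z)) (T (d z))) / 2" for z
  define E where "E z = \<rho> (Y z) - \<rho> (X z) - \<rho>' (X z) (W z) - H (W z) (W z) / 2" for z
  define R4 where "R4 z = (\<rho> (Y z) - \<rho> (X z))\<^sup>2 - (m (T (d z)))\<^sup>2" for z
  have o1: "R1 \<in> o[F](\<lambda>z. (nd z)\<^sup>2)"
  proof (rule smallo_of_bound[where c = "\<lambda>z. norm (m - a z *\<^sub>R \<rho>' (X z)) * C"])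
    show "((\<lambda>z. norm (m - a z *\<^sub>R \<rho>' (X z)) * C) \<longlongrightarrow> 0) F"
      using a1 \<rho>'X by (auto intro!: tendsto_eq_intros)
    have "\<bar>R1 z\<bar> \<le> norm (m - a z *\<^sub>R \<rho>' (X z)) * C * (nd z)\<^sup>2" for z
    proof -
      have "R1 z = (m - a z *\<^sub>R \<rho>' (X z)) (Q (d z) (d z))"
        by (simp add: R1_def blinfun.diff_left blinfun.scaleR_left)
      then have "\<bar>R1 z\<bar> \<le> norm (m - a z *\<^sub>R \<rho>' (X z)) * norm (Q (d z) (d z))"
        using norm_blinfun[of "m - a z *\<^sub>R \<rho>' (X z)" "Q (d z) (d z)"] by simp
      also have "\<dots> \<le> norm (m - a z *\<^sub>R \<rho>' (X z)) * (nd z * nd z * C)"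
        unfolding nd_def by (intro mult_left_mono C) auto
      finally show ?thesis by (simp add: power2_eq_square mult_ac)
    qed
    then show "\<forall>\<^sub>F z in F. \<bar>R1 z\<bar> \<le> norm (m - a z *\<^sub>R \<rho>' (X z)) * C * (nd z)\<^sup>2" by simp
  qed simp
  have o2: "R2 \<in> o[F](\<lambda>z. (nd z)\<^sup>2)"
  proof (rule smallo_of_bound[where c = "\<lambda>z. norm H * (\<bar>a z - 1\<bar> * (K + c1 z)\<^sup>2 + c1 z * (K + c1 z) + K * c1 z) / 2"])
    show "((\<lambda>z. norm H * (\<bar>a z - 1\<bar> * (K + c1 z)\<^sup>2 + c1 z * (K + c1 z) + K * c1 z) / 2) \<longlongrightarrow> 0) F"
      using a1 c10 by (auto intro!: tendsto_eq_intros)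
    have "\<bar>R2 z\<bar> \<le> norm H * (\<bar>a z - 1\<bar> * (K + c1 z)\<^sup>2 + c1 z * (K + c1 z) + K * c1 z) / 2 * (nd z)\<^sup>2" for z
    proof -
      let ?w = "W z" and ?t = "T (d z)"
      have "2 * R2 z = (a z - 1) * H ?w ?w + H (?w - ?t) ?w + H ?t (?w - ?t)"
        by (simp add: R2_def blinfun.diff_left blinfun.diff_right field_simps)
      then have "2 * \<bar>R2 z\<bar> \<le> \<bar>a z - 1\<bar> * \<bar>H ?w ?w\<bar> + \<bar>H (?w - ?t) ?w\<bar> + \<bar>H ?t (?w - ?t)\<bar>"
        unfolding abs_mult[symmetric] by linarith
      also have "\<dots> \<le> \<bar>a z - 1\<bar> * (norm H * ((K + c1 z) * nd z) * ((K + c1 z) * nd z))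
          + norm H * (c1 z * nd z) * ((K + c1 z) * nd z) + norm H * (K * nd z) * (c1 z * nd z)"
        using c1_nonneg[of z] nd_nonneg[of z] K(1)
        by (intro add_mono mult_left_mono order_trans[OF H_le] mult_mono W_le W_T T_le order_refl) auto
      finally show ?thesis by (simp add: power2_eq_square algebra_simps)
    qed
    then show "\<forall>\<^sub>F z in F. \<bar>R2 z\<bar> \<le> norm H * (\<bar>a z - 1\<bar> * (K + c1 z)\<^sup>2 + c1 z * (K + c1 z) + K * c1 z) / 2 * (nd z)\<^sup>2"
      by simp
  qed simp
  have W_O: "(\<lambda>z. norm (W z)) \<in> O[F](nd)"
  proof (rule bigoI[of _ "K + 1"])
    have "\<forall>\<^sub>F z in F. c1 z < 1" using order_tendstoD(2)[OF c10, of 1] by simp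
    then show "\<forall>\<^sub>F z in F. norm (norm (W z)) \<le> (K + 1) * norm (nd z)"
    proof eventually_elim
      case (elim z)
      have "norm (W z) \<le> (K + c1 z) * nd z" by (rule W_le)
      also have "\<dots> \<le> (K + 1) * nd z" using elim nd_nonneg by (intro mult_right_mono) auto
      finally show ?case using nd_nonneg[of z] by simp
    qed
  qed
  have E_o: "E \<in> o[F](\<lambda>z. (nd z)\<^sup>2)"
  proof -
    have "E \<in> o[F](\<lambda>z. (norm (W z))\<^sup>2)"
    proof (rule landau_o.smallI)
      fix \<epsilon> :: real assume "0 < \<epsilon>"
      then obtain \<delta> where \<delta>: "0 < \<delta>" "\<And>x y. x \<in> ball p \<delta> \<Longrightarrow> y \<in> ball p \<delta> \<Longrightarrow>
          \<bar>\<rho> y - \<rho> x - \<rho>' x (y - x) - \<rho>'' p (y - x) (y - x) / 2\<bar> \<le> \<epsilon> * (norm (y - x))\<^sup>2"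
        using C2_two_point_expansion[OF U d1 d2 cont2] by meson
      have "\<forall>\<^sub>F z in F. dist (X z) p < \<delta>" "\<forall>\<^sub>F z in F. dist (Y z) p < \<delta>"
        using tendstoD[OF X0 \<delta>(1)] tendstoD[OF Y0 \<delta>(1)] by auto
      then show "\<forall>\<^sub>F z in F. norm (E z) \<le> \<epsilon> * norm ((norm (W z))\<^sup>2)"
      proof eventually_elim
        case (elim z)
        then show ?case using \<delta>(2)[of "X z" "Y z"] by (simp add: E_def H_def W_def dist_commute)
      qed
    qed
    moreover have "(\<lambda>z. (norm (W z))\<^sup>2) \<in> O[F](\<lambda>z. (nd z)\<^sup>2)"
      using landau_o.big_power[OF W_O, of 2] .
    ultimately show ?thesis by (rule landau_o.small_big_trans)
  qed
  have a_O: "a \<in> O[F](\<lambda>_. 1)"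
    using a1 by (intro bigoI_tendsto[where c = 1]) auto
  have o3: "(\<lambda>z. a z * E z) \<in> o[F](\<lambda>z. (nd z)\<^sup>2)"
    using landau_o.big_small_mult[OF a_O E_o] by simp
  define B where "B z = \<rho> (Y z) - \<rho> (X z) - m (T (d z))" for z
  have nd_O1: "nd \<in> O[F](\<lambda>_. 1)"
    using nd0 by (intro bigoI_tendsto[where c = 0]) auto
  have nd2_O: "(\<lambda>z. (nd z)\<^sup>2) \<in> O[F](nd)"
    using landau_o.big.mult[OF nd_O1 landau_o.big_refl[of nd F]] by (simp add: power2_eq_square)
  have B_o: "B \<in> o[F](nd)"
  proof -
    have b1: "(\<lambda>z. \<rho>' (X z) (W z) - m (T (d z))) \<in> o[F](nd)"
    proof (rule smallo_of_bound[where c = "\<lambda>z. norm (\<rho>' (X z) - m) * (K + c1 z) + norm m * c1 z"])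
      show "((\<lambda>z. norm (\<rho>' (X z) - m) * (K + c1 z) + norm m * c1 z) \<longlongrightarrow> 0) F"
        using \<rho>'X c10 by (auto intro!: tendsto_eq_intros)
      have "\<bar>\<rho>' (X z) (W z) - m (T (d z))\<bar> \<le> (norm (\<rho>' (X z) - m) * (K + c1 z) + norm m * c1 z) * nd z" for z
      proof -
        have "\<rho>' (X z) (W z) - m (T (d z)) = (\<rho>' (X z) - m) (W z) + m (W z - T (d z))"
          by (simp add: blinfun.diff_left blinfun.diff_right)
        then have "\<bar>\<rho>' (X z) (W z) - m (T (d z))\<bar> \<le> norm (\<rho>' (X z) - m) * norm (W z) + norm m * norm (W z - T (d z))"
          using norm_blinfun[of "\<rho>' (X z) - m" "W z"] norm_blinfun[of m "W z - T (d z)"] by simp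
        also have "\<dots> \<le> norm (\<rho>' (X z) - m) * ((K + c1 z) * nd z) + norm m * (c1 z * nd z)"
          by (intro add_mono mult_left_mono W_le W_T) auto
        finally show ?thesis by (simp add: algebra_simps)
      qed
      then show "\<forall>\<^sub>F z in F. \<bar>\<rho>' (X z) (W z) - m (T (d z))\<bar> \<le> (norm (\<rho>' (X z) - m) * (K + c1 z) + norm m * c1 z) * nd z"
        by simp
    qed (rule nd_nonneg)
    have b2: "(\<lambda>z. H (W z) (W z) / 2) \<in> o[F](nd)"
    proof (rule smallo_of_bound[where c = "\<lambda>z. norm H * (K + c1 z)\<^sup>2 * nd z"])
      show "((\<lambda>z. norm H * (K + c1 z)\<^sup>2 * nd z) \<longlongrightarrow> 0) F"
        using nd0 c10 by (auto intro!: tendsto_eq_intros)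
      have "\<bar>H (W z) (W z) / 2\<bar> \<le> norm H * (K + c1 z)\<^sup>2 * nd z * nd z" for z
      proof -
        have "\<bar>H (W z) (W z) / 2\<bar> \<le> norm H * norm (W z) * norm (W z)" using H_le[of "W z" "W z"] by simp
        also have "\<dots> \<le> norm H * ((K + c1 z) * nd z) * ((K + c1 z) * nd z)"
          using c1_nonneg[of z] nd_nonneg[of z] K(1)
          by (intro mult_mono mult_left_mono W_le) auto
        finally show ?thesis by (simp add: power2_eq_square mult_ac)
      qed
      then show "\<forall>\<^sub>F z in F. \<bar>H (W z) (W z) / 2\<bar> \<le> norm H * (K + c1 z)\<^sup>2 * nd z * nd z" by simp
    qed (rule nd_nonneg)
    have b3: "E \<in> o[F](nd)" using landau_o.small_big_trans[OF E_o nd2_O] .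
    have "(\<lambda>z. (\<rho>' (X z) (W z) - m (T (d z))) + H (W z) (W z) / 2 + E z) \<in> o[F](nd)"
      by (rule sum_in_smallo(1)[OF sum_in_smallo(1)[OF b1 b2] b3])
    also have "(\<lambda>z. (\<rho>' (X z) (W z) - m (T (d z))) + H (W z) (W z) / 2 + E z) = B"
      by (rule ext) (simp add: B_def E_def)
    finally show ?thesis .
  qed
  have o4: "R4 \<in> o[F](\<lambda>z. (nd z)\<^sup>2)"
  proof -
    have "(\<lambda>z. m (T (d z))) \<in> O[F](nd)"
    proof (rule bigoI[of _ "norm m * K"])
      have "norm (m (T (d z))) \<le> norm m * K * norm (nd z)" for z
        using order_trans[OF norm_blinfun[of m "T (d z)"] mult_left_mono[OF T_le[of z] norm_ge_zero]] nd_nonneg[of z]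
        by (simp add: mult_ac)
      then show "\<forall>\<^sub>F z in F. norm (m (T (d z))) \<le> norm m * K * norm (nd z)" by simp
    qed
    then have "(\<lambda>z. B z * m (T (d z))) \<in> o[F](\<lambda>z. nd z * nd z)"
      by (rule landau_o.small_big_mult[OF B_o])
    moreover have "(\<lambda>z. B z * B z) \<in> o[F](\<lambda>z. nd z * nd z)"
      by (rule landau_o.small_big_mult[OF B_o landau_o.small_imp_big[OF B_o]])
    ultimately have "(\<lambda>z. B z * B z + (B z * m (T (d z)) + B z * m (T (d z)))) \<in> o[F](\<lambda>z. nd z * nd z)"
      by (intro sum_in_smallo)
    also have "(\<lambda>z. B z * B z + (B z * m (T (d z)) + B z * m (T (d z)))) = R4"
      by (rule ext) (simp add: B_def R4_def power2_eq_square algebra_simps)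
    finally show ?thesis by (simp add: power2_eq_square)
  qed
  define R where "R z = R1 z + R2 z + a z * E z + M / 2 * R4 z" for z
  have R_o: "R \<in> o[F](\<lambda>z. (nd z)\<^sup>2)"
  proof -
    have "(\<lambda>z. M / 2 * R4 z) \<in> o[F](\<lambda>z. (nd z)\<^sup>2)" using o4 by (cases "M = 0") simp_all
    then show ?thesis unfolding R_def by (intro sum_in_smallo o1 o2 o3)
  qed
  have R_eq: "R (u, v) = r v - r u - inner (n u) (v - u) - (norm (v - u))\<^sup>2" for u v
  proof -
    define z where "z = (u, v)"
    have z: "fst z = u" "d z = v - u" by (simp_all add: z_def d_def)
    define D1 where "D1 = \<rho> (Y z) - \<rho> (X z)"
    have "r v - r u = a z * D1 + M / 2 * D1\<^sup>2"
      by (simp add: r_def D1_def a_def X_def Y_def z_def power2_eq_square algebra_simps)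
    moreover have D1_eq: "D1 = \<rho>' (X z) (DG u (v - u)) - \<rho>' (X z) (Q (v - u) (v - u)) + H (W z) (W z) / 2 + E z"
      unfolding D1_def E_def W_eq[of z] z by (simp add: blinfun.diff_right)
    then have "a z * D1 = a z * \<rho>' (X z) (DG u (v - u)) - a z * \<rho>' (X z) (Q (v - u) (v - u))
        + a z * H (W z) (W z) / 2 + a z * E z"
      by (subst D1_eq) (simp add: algebra_simps)
    moreover have "inner (n u) (v - u) = a z * \<rho>' (X z) (DG u (v - u))"
      by (simp add: n_inner l_def a_def X_def z)
    ultimately have "r v - r u - inner (n u) (v - u) - (norm (v - u))\<^sup>2 = R z"
      unfolding R_def R1_def R2_def R4_def T_norm[of "v - u"] z D1_def[symmetric]
      by (simp add: field_simps)
    then show ?thesis by (simp add: z_def)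
  qed
  have "normal_chart D N V G Gam r n"
  proof
    show "\<exists>A. (G has_derivative (*v) A) (at u)" for u using G_der[of u] DG_mat[of u] by auto
    show "\<exists>A. (Gam has_derivative (*v) A) (at x)" if "x \<in> V" for x
    proof -
      have "\<exists>B. inv (DG (Gam x)) = (\<lambda>h. B *v h)"
        using inv_complex_linear DG_mat[of "Gam x"] Gam(3)[OF that] by (auto simp: f'_apply)
      then show ?thesis using Gam(1,2)[OF that] by (auto simp: f'_apply)
    qed
    show "G u \<in> D \<longleftrightarrow> r u < 0" if "u \<in> N" for u
    proof -
      have Gu: "G u \<in> U" "0 < 1 + M / 2 * \<rho> (G u)" using that N by (auto simp: U2_def U1_def)
      have "r u = \<rho> (G u) * (1 + M / 2 * \<rho> (G u))"
        by (simp add: r_def power2_eq_square algebra_simps)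
      then have "r u < 0 \<longleftrightarrow> \<rho> (G u) < 0" using Gu(2) by (simp add: mult_less_0_iff)
      then show ?thesis using DU Gu(1) by blast
    qed
    show "r 0 = 0" by (simp add: r_def G0 \<rho>p)
    show "n 0 \<noteq> 0"
    proof
      assume "n 0 = 0"
      then have "l 0 (TB *v x1) = 0" using n_inner[of 0 "TB *v x1"] by simp
      then have "m x1 = 0"
        by (simp add: l_def G0 \<rho>p m_def DG_def Q.zero_left Q.zero_right T_def matrix_vector_mul_assoc TB(2))
      then show False using x1 by simp
    qed
    show "(n \<longlongrightarrow> n 0) (at 0)" using n_nhds by (simp add: tendsto_nhds_iff)
    show "\<exists>\<delta>>0. \<forall>u v. norm u < \<delta> \<longrightarrow> norm v < \<delta> \<longrightarrow>
       \<bar>r v - r u - inner (n u) (v - u) - (norm (v - u))\<^sup>2\<bar> \<le> \<epsilon> * (norm (v - u))\<^sup>2" if "0 < \<epsilon>" for \<epsilon>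
    proof -
      have "\<forall>\<^sub>F z in F. norm (R z) \<le> \<epsilon> * norm ((nd z)\<^sup>2)" using landau_o.smallD[OF R_o that] .
      then obtain P1 P2 where P: "eventually P1 (nhds (0 :: complex ^ 'n))" "eventually P2 (nhds (0 :: complex ^ 'n))"
        "\<And>u v. P1 u \<Longrightarrow> P2 v \<Longrightarrow> norm (R (u, v)) \<le> \<epsilon> * norm ((nd (u, v))\<^sup>2)"
        unfolding F_def eventually_prod_filter by blast
      obtain \<delta>1 \<delta>2 where \<delta>: "0 < \<delta>1" "\<And>u. norm u < \<delta>1 \<Longrightarrow> P1 u" "0 < \<delta>2" "\<And>u. norm u < \<delta>2 \<Longrightarrow> P2 u"
        using P(1,2) unfolding eventually_nhds_metric by (auto simp: dist_norm)
      show ?thesis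
      proof (intro exI[of _ "min \<delta>1 \<delta>2"] conjI allI impI)
        fix u v :: "complex ^ 'n" assume "norm u < min \<delta>1 \<delta>2" "norm v < min \<delta>1 \<delta>2"
        then have "norm (R (u, v)) \<le> \<epsilon> * norm ((nd (u, v))\<^sup>2)" using P(3) \<delta> by simp
        then show "\<bar>r v - r u - inner (n u) (v - u) - (norm (v - u))\<^sup>2\<bar> \<le> \<epsilon> * (norm (v - u))\<^sup>2"
          by (simp add: R_eq[symmetric] nd_def d_def)
      qed (use \<delta> in simp)
    qed
  qed (use N openD in auto)
  then show ?thesis using that G0 by blast
qed

theorem proposition4:
  fixes D :: "(complex ^ 'n::finite) set" and p0 :: "complex ^ 'n"
  assumes "open D" and "connected D"
    and "strongly_pseudoconvex_point D p0"
  shows "(fridman D \<longlongrightarrow> 1) (at p0 within D)"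
proof -
  obtain N V G Gam r n where "normal_chart D N V G Gam r n" "G 0 = p0"
    using exists_normal_chart[OF assms(1,3)] by blast
  then show ?thesis using normal_chart.fridman_tendsto_1 by metis
qed

end
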